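(* Let $K$ be a non-archimedean local field with valuation ring $R$, and let $S$ be an infinite subset of $R$. The following two conditions are equivalent: (1) the subset $S$ of $R$ is transient; (2) the sequence $\frac1n n!_S$ converges to a finite $H(S)\in(0,\infty)$. Moreover, if $S$ is transient, then every factorial-determining sequence $s_0,s_1,s_2,\dots$ of $S$ is equidistributed in the closure $\overline S$ with respect to the harmonic measure $\mu_{\mathrm{har}}$ (i.e. $\frac1n\sum_{j=0}^{n-1}\delta_{s_j}\to\mu_{\mathrm{har}}$ weakly on $\overline S$), and $$H(S)=\int_{\{(x,y)\in\overline S\times\overline S,\ x\ne y\}}\mathrm{val}(x-y)\,d\mu_{\mathrm{har}}(x)\,d\mu_{\mathrm{har}}(y)=\int_{\overline S}\mathrm{val}(x_0-y)\,d\mu_{\mathrm{har}}(y)$$ where the last equality holds for $\mu_{\mathrm{har}}$-almost every $x_0\in\overline S$.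
   Context: $K$ has normalized discrete valuation $\mathrm{val}$, valuation ring $R$, maximal ideal $\mathfrak m$, and finite residue field. $\overline S$ is the closure of $S$ in $R$. Logarithmic factorials of $S$: choose $s_0\in S$ arbitrarily; given $s_0,\dots,s_{n-1}$ choose $s_n\in S$ minimizing $\mathrm{val}\bigl(\prod_{j<n}(s-s_j)\bigr)$ over $s\in S$. Any sequence so obtained is called factorial-determining, and $n!_S:=\mathrm{val}\bigl(\prod_{j<n}(s_n-s_j)\bigr)$, which is independent of the choices. Adelic tree $T_S$: for $h\ge0$ let $V_h$ be the image of $S$ in $R/\mathfrak m^h$. The vertex set of $T_S$ is $\bigsqcup_{h\ge0}V_h$, rooted at the unique element $\mathfrak r$ of $V_0$, and $u\in V_h$ is adjacent to $v\in V_{h+1}$ iff $v$ maps to $u$ under $R/\mathfrak m^{h+1}\to R/\mathfrak m^h$. The set $\partial T_S$ of infinite paths from the root is identified with $\overline S$. $S$ is called transient if simple random walk on $T_S$ started at the root (moving to a uniformly chosen neighbour at each step) is transient, i.e. almost surely returns to the root finitely many times. In that case, orient edges away from the root and let $v^-$ be the parent of $v$. A unit flow is $\theta:E(T_S)\to\mathbb R_{\ge0}$ with $\theta(v^-v)=\sum_{vu}\theta(vu)$ (sum over children $u$ of $v$) for all $v\neq\mathfrak r$, and with $\sum_{\mathfrak rv}\theta(\mathfrak rv)=1$; its energy is $\sum_e\theta(e)^2$. There is a unique unit flow $\eta$ of minimum (finite) energy, and the harmonic measure $\mu_{\mathrm{har}}$ is the Borel probability measure on $\overline S=\partial T_S$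 such that, for each vertex $v\in V_h$, $h\geq 1$, the set of elements of $\overline S$ with image $v$ in $R/\mathfrak m^h$ has measure $\eta(v^-v)$. *)

theory Defs
  imports "HOL-Probability.Probability"
begin

section \<open>Non-archimedean local fields\<close>

definition val_ring :: "('a::field \<Rightarrow> ereal) \<Rightarrow> 'a set" where
  "val_ring v = {x. 0 \<le> v x}"

definition max_ideal :: "('a::field \<Rightarrow> ereal) \<Rightarrow> 'a set" where
  "max_ideal v = {x. 0 < v x}"

inductive_set ideal_mult :: "'a::field set \<Rightarrow> 'a set \<Rightarrow> 'a set" for I J where
  mult: "a \<in> I \<Longrightarrow> b \<in> J \<Longrightarrow> a * b \<in> ideal_mult I J"
| add: "x \<in> ideal_mult I J \<Longrightarrow> y \<in> ideal_mult I J \<Longrightarrow> x + y \<in> ideal_mult I J"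

primrec max_ideal_pow :: "('a::field \<Rightarrow> ereal) \<Rightarrow> nat \<Rightarrow> 'a set" where
  "max_ideal_pow v 0 = val_ring v"
| "max_ideal_pow v (Suc h) = ideal_mult (max_ideal v) (max_ideal_pow v h)"

text \<open>The image of \<open>x\<close> in \<open>R/m\<^sup>h\<close>, as a coset.\<close>

definition residue_class :: "('a::field \<Rightarrow> ereal) \<Rightarrow> nat \<Rightarrow> 'a \<Rightarrow> 'a set" where
  "residue_class v h x = (\<lambda>y. x + y) ` max_ideal_pow v h"

text \<open>The metric of the absolute value \<open>2 powr - v x\<close>. The base 2 is immaterial: only the
  topology and the notion of a Cauchy sequence are used.\<close>

definition val_dist :: "('a::field \<Rightarrow> ereal) \<Rightarrow> 'a \<Rightarrow> 'a \<Rightarrow> real" where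
  "val_dist v x y = (if x = y then 0 else 2 powr - real_of_ereal (v (x - y)))"

text \<open>The whole type \<open>'a\<close> is the field \<open>K\<close>. The valuation has \<open>v 0 = \<infinity>\<close>, and \<open>val_range\<close> says
  that it is discrete and normalized.\<close>

locale discrete_valuation =
  fixes v :: "'a::field \<Rightarrow> ereal"
  assumes val_zero: "v 0 = \<infinity>"
    and val_range: "v ` (- {0}) = ereal ` \<int>"
    and val_mult: "v (x * y) = v x + v y"
    and val_add: "min (v x) (v y) \<le> v (x + y)"

locale nonarch_local_field = discrete_valuation v for v :: "'a::field \<Rightarrow> ereal" +
  assumes complete: "Metric_space.mcomplete UNIV (val_dist v)"
    and finite_residue_field: "finite (residue_class v 1 ` val_ring v)"

context discrete_valuation
begin

lemma val_int: "x \<noteq> 0 \<Longrightarrow> \<exists>k::int. v x = ereal (of_int k)"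
proof -
  assume "x \<noteq> 0"
  then have "v x \<in> ereal ` \<int>" using val_range by blast
  then show ?thesis by (auto elim: Ints_cases)
qed

lemma val_one: "v 1 = 0"
proof -
  obtain k :: int where "v 1 = ereal (of_int k)" using val_int[of 1] by auto
  with val_mult[of 1 1] show ?thesis by simp
qed

lemma val_minus: "v (- x) = v x"
proof -
  obtain k :: int where k: "v (- 1) = ereal (of_int k)" using val_int[of "- 1"] by auto
  with val_mult[of "- 1" "- 1"] val_one have "v (- 1) = 0" by (simp add: zero_ereal_def)
  then show ?thesis using val_mult[of "- 1" x] by simp
qed

lemma Metric_space_val_dist: "Metric_space UNIV (val_dist v)"
proof
  fix x y z :: 'a
  show "0 \<le> val_dist v x y" by (simp add: val_dist_def)
  show "val_dist v x y = val_dist v y x"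
    using val_minus[of "x - y"] by (simp add: val_dist_def)
  show "val_dist v x y = 0 \<longleftrightarrow> x = y" by (simp add: val_dist_def)
  show "val_dist v x z \<le> val_dist v x y + val_dist v y z"
  proof (cases "x = y \<or> y = z \<or> x = z")
    case True
    then show ?thesis by (auto simp: val_dist_def)
  next
    case False
    then obtain a b c :: int where abc: "v (x - y) = ereal (of_int a)"
      "v (y - z) = ereal (of_int b)" "v (x - z) = ereal (of_int c)"
      using val_int[of "x - y"] val_int[of "y - z"] val_int[of "x - z"] by auto
    have "min a b \<le> c" using val_add[of "x - y" "y - z"] abc by (auto simp: min_def split: if_splits)
    then have "- real_of_int c \<le> - real_of_int a \<or> - real_of_int c \<le> - real_of_int b" by linarith
    then have "2 powr - real_of_int c \<le> (2::real) powr - real_of_int a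
        \<or> 2 powr - real_of_int c \<le> (2::real) powr - real_of_int b" by auto
    moreover have "(0::real) \<le> 2 powr - real_of_int a" "(0::real) \<le> 2 powr - real_of_int b" by auto
    ultimately have "2 powr - real_of_int c \<le> (2::real) powr - real_of_int a + 2 powr - real_of_int b"
      by linarith
    then show ?thesis using False by (simp add: val_dist_def abc)
  qed
qed

lemma max_ideal_pow_eq: "max_ideal_pow v h = {x. ereal (real h) \<le> v x}"
proof (induction h)
  case 0
  then show ?case by (simp add: val_ring_def zero_ereal_def)
next
  case (Suc h)
  have 1: "ereal (real (Suc h)) \<le> v x" if "x \<in> ideal_mult (max_ideal v) (max_ideal_pow v h)" for x
    using that
  proof induction
    case (mult a b)
    have "1 \<le> v a"
    proof (cases "a = 0")
      case False
      then obtain k :: int where k: "v a = ereal (of_int k)" using val_int by blast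
      with mult(1) show ?thesis by (simp add: max_ideal_def)
    qed (simp add: val_zero)
    moreover have "ereal (real h) \<le> v b" using mult(2) Suc.IH by simp
    ultimately have "1 + ereal (real h) \<le> v a + v b" by (rule add_mono)
    then show ?case by (simp add: val_mult one_ereal_def)
  next
    case (add x y)
    then show ?case using val_add[of x y] by (metis min.boundedI order_trans)
  qed
  have "(1::ereal) \<in> ereal ` \<int>" by (metis Ints_1 image_eqI one_ereal_def)
  with val_range obtain p where p: "p \<noteq> 0" "v p = 1" by (metis ComplD imageE insertI1)
  have 2: "x \<in> ideal_mult (max_ideal v) (max_ideal_pow v h)" if x: "ereal (real (Suc h)) \<le> v x" for x
  proof -
    have xp: "x = p * (x / p)" using p by simp
    have "1 + ereal (real h) \<le> 1 + v (x / p)"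
      using x val_mult[of p "x / p"] xp p(2) by (simp add: one_ereal_def)
    then have "ereal (real h) \<le> v (x / p)" by (cases "v (x / p)") (auto simp: one_ereal_def)
    then show ?thesis using p Suc.IH
      by (subst xp, intro ideal_mult.mult) (auto simp: max_ideal_def)
  qed
  show ?case using 1 2 by auto
qed

end

definition ring_topology :: "('a::field \<Rightarrow> ereal) \<Rightarrow> 'a topology" where
  "ring_topology v = subtopology (Metric_space.mtopology UNIV (val_dist v)) (val_ring v)"

definition ring_closure :: "('a::field \<Rightarrow> ereal) \<Rightarrow> 'a set \<Rightarrow> 'a set" where
  "ring_closure v S = ring_topology v closure_of S"

section \<open>Logarithmic factorials\<close>

definition factorial_determining ::
    "('a::field \<Rightarrow> ereal) \<Rightarrow> 'a set \<Rightarrow> (nat \<Rightarrow> 'a) \<Rightarrow> bool" where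
  "factorial_determining v S s \<longleftrightarrow>
     (\<forall>n. s n \<in> S \<and> (\<forall>t\<in>S. v (\<Prod>j<n. s n - s j) \<le> v (\<Prod>j<n. t - s j)))"

text \<open>The value does not depend on the factorial-determining sequence that is chosen.\<close>

definition log_factorial :: "('a::field \<Rightarrow> ereal) \<Rightarrow> 'a set \<Rightarrow> nat \<Rightarrow> ereal" where
  "log_factorial v S n =
     (let s = (SOME s. factorial_determining v S s) in v (\<Prod>j<n. s n - s j))"

definition H_lim :: "('a::field \<Rightarrow> ereal) \<Rightarrow> 'a set \<Rightarrow> ereal" where
  "H_lim v S = lim (\<lambda>n. log_factorial v S n / ereal (real n))"

section \<open>The adelic tree and its simple random walk\<close>

text \<open>The vertices of the tree of \<open>S\<close> are the \<open>tree_vertex v h x\<close> with \<open>x \<in> S\<close>. The tag \<open>h\<close> makes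
  the union of the images \<open>V\<^sub>h\<close> of \<open>S\<close> in \<open>R/m\<^sup>h\<close> disjoint.\<close>

type_synonym 'a vertex = "nat \<times> 'a set"

definition tree_vertex :: "('a::field \<Rightarrow> ereal) \<Rightarrow> nat \<Rightarrow> 'a \<Rightarrow> 'a vertex" where
  "tree_vertex v h x = (h, residue_class v h x)"

definition tree_root :: "('a::field \<Rightarrow> ereal) \<Rightarrow> 'a vertex" where
  "tree_root v = (0, val_ring v)"

text \<open>Edges are oriented away from the root. An element of \<open>V\<^bsub>h+1\<^esub>\<close> is the class of some
  \<open>x \<in> S\<close>, and the projection to \<open>R/m\<^sup>h\<close> sends it to the class of the same \<open>x\<close>.\<close>

definition tree_edges :: "('a::field \<Rightarrow> ereal) \<Rightarrow> 'a set \<Rightarrow> ('a vertex \<times> 'a vertex) set" where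
  "tree_edges v S = {(tree_vertex v h x, tree_vertex v (Suc h) x) | h x. x \<in> S}"

definition children :: "('a::field \<Rightarrow> ereal) \<Rightarrow> 'a set \<Rightarrow> 'a vertex \<Rightarrow> 'a vertex set" where
  "children v S a = {b. (a, b) \<in> tree_edges v S}"

definition neighbours :: "('a::field \<Rightarrow> ereal) \<Rightarrow> 'a set \<Rightarrow> 'a vertex \<Rightarrow> 'a vertex set" where
  "neighbours v S a = {b. (a, b) \<in> tree_edges v S \<or> (b, a) \<in> tree_edges v S}"

text \<open>The law of the position at time \<open>n\<close>, given the positions at the times before \<open>n\<close>.\<close>

definition walk_step ::
    "('a::field \<Rightarrow> ereal) \<Rightarrow> 'a set \<Rightarrow> nat \<Rightarrow> (nat \<Rightarrow> 'a vertex) \<Rightarrow> 'a vertex measure" where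
  "walk_step v S n \<omega> = measure_pmf
     (case n of 0 \<Rightarrow> return_pmf (tree_root v) | Suc k \<Rightarrow> pmf_of_set (neighbours v S (\<omega> k)))"

interpretation walk: Ionescu_Tulcea "walk_step v S" "\<lambda>_. count_space UNIV" for v S
proof (rule Ionescu_Tulcea.intro)
  fix i :: nat
  show "walk_step v S i \<in> measurable (PiM {0..<i} (\<lambda>_. count_space UNIV)) (subprob_algebra (count_space UNIV))"
  proof (cases i)
    case 0
    then show ?thesis unfolding walk_step_def[abs_def] by (simp add: measure_pmf_in_subprob_algebra)
  next
    case (Suc k)
    have "(\<lambda>\<omega>. \<omega> k) \<in> measurable (PiM {0..<i} (\<lambda>_. count_space UNIV)) (count_space UNIV)"
      using Suc by (intro measurable_component_singleton) auto
    moreover have "(\<lambda>a. measure_pmf (pmf_of_set (neighbours v S a)))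
        \<in> measurable (count_space UNIV) (subprob_algebra (count_space UNIV))"
      by (simp add: measure_pmf_in_subprob_algebra)
    ultimately have "(\<lambda>\<omega>. measure_pmf (pmf_of_set (neighbours v S (\<omega> k))))
        \<in> measurable (PiM {0..<i} (\<lambda>_. count_space UNIV)) (subprob_algebra (count_space UNIV))"
      by (rule measurable_compose)
    then show ?thesis unfolding walk_step_def[abs_def] using Suc by simp
  qed
qed (simp add: walk_step_def prob_space_measure_pmf)

text \<open>The law of the walk on the space of all sequences of vertices: the measure given by the
  Ionescu-Tulcea theorem from the one-step kernels.\<close>

definition walk_law :: "('a::field \<Rightarrow> ereal) \<Rightarrow> 'a set \<Rightarrow> (nat \<Rightarrow> 'a vertex) measure" where
  "walk_law v S = walk.PF.lim v S"

definition transient :: "('a::field \<Rightarrow> ereal) \<Rightarrow> 'a set \<Rightarrow> bool" where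
  "transient v S \<longleftrightarrow> (AE \<omega> in walk_law v S. finite {n. \<omega> n = tree_root v})"

section \<open>Flows and the harmonic measure\<close>

definition unit_flow ::
    "('a::field \<Rightarrow> ereal) \<Rightarrow> 'a set \<Rightarrow> ('a vertex \<times> 'a vertex \<Rightarrow> real) \<Rightarrow> bool" where
  "unit_flow v S \<theta> \<longleftrightarrow> \<theta> \<in> tree_edges v S \<rightarrow>\<^sub>E {0..}
     \<and> (\<forall>(a, b)\<in>tree_edges v S. \<theta> (a, b) = (\<Sum>c\<in>children v S b. \<theta> (b, c)))
     \<and> (\<Sum>b\<in>children v S (tree_root v). \<theta> (tree_root v, b)) = 1"

definition energy ::
    "('a::field \<Rightarrow> ereal) \<Rightarrow> 'a set \<Rightarrow> ('a vertex \<times> 'a vertex \<Rightarrow> real) \<Rightarrow> ennreal" where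
  "energy v S \<theta> = (\<Sum>\<^sub>\<infinity>e\<in>tree_edges v S. ennreal ((\<theta> e)\<^sup>2))"

definition min_energy_flow ::
    "('a::field \<Rightarrow> ereal) \<Rightarrow> 'a set \<Rightarrow> 'a vertex \<times> 'a vertex \<Rightarrow> real" where
  "min_energy_flow v S = (THE \<eta>. unit_flow v S \<eta> \<and> energy v S \<eta> < \<infinity>
     \<and> (\<forall>\<theta>. unit_flow v S \<theta> \<longrightarrow> energy v S \<eta> \<le> energy v S \<theta>))"

definition closure_topology :: "('a::field \<Rightarrow> ereal) \<Rightarrow> 'a set \<Rightarrow> 'a topology" where
  "closure_topology v S = subtopology (ring_topology v) (ring_closure v S)"

definition closure_borel :: "('a::field \<Rightarrow> ereal) \<Rightarrow> 'a set \<Rightarrow> 'a measure" where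
  "closure_borel v S = sigma (ring_closure v S) {U. openin (closure_topology v S) U}"

definition harmonic_measure :: "('a::field \<Rightarrow> ereal) \<Rightarrow> 'a set \<Rightarrow> 'a measure" where
  "harmonic_measure v S = (THE \<mu>. prob_space \<mu> \<and> sets \<mu> = sets (closure_borel v S)
     \<and> (\<forall>(a, b)\<in>tree_edges v S.
          measure \<mu> {x \<in> ring_closure v S. tree_vertex v (fst b) x = b} = min_energy_flow v S (a, b)))"

text \<open>Weak convergence of the measures \<open>1/n \<Sum>\<^bsub>j<n\<^esub> \<delta>\<^bsub>s j\<^esub>\<close> to \<open>\<mu>\<close>, with the integral against the
  empirical measure written as an average.\<close>

definition equidistributed ::
    "('a::field \<Rightarrow> ereal) \<Rightarrow> 'a set \<Rightarrow> (nat \<Rightarrow> 'a) \<Rightarrow> 'a measure \<Rightarrow> bool" where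
  "equidistributed v S s \<mu> \<longleftrightarrow>
     (\<forall>f. continuous_map (closure_topology v S) euclideanreal f \<and> bounded (f ` ring_closure v S) \<longrightarrow>
        (\<lambda>n. (\<Sum>j<n. f (s j)) / real n) \<longlonglongrightarrow> (\<integral>x. f x \<partial>\<mu>))"

end

theory Submission
  imports Defs
begin

text \<open>
  Give every edge of the adelic tree conductance 1. The effective conductance \<open>k\<^sub>0\<close> between an
  imagined parent of the root and infinity is positive iff the walk is transient, and the flow of
  minimal energy is the unit current of this network; its energy is \<open>H = 1 / k\<^sub>0 - 1\<close>. The current
  into the vertices along a branch sums to at most \<open>H\<close>, because voltages are nonnegative.

  For distinct \<open>x, y\<close> in \<open>R\<close>, \<open>val (x - y)\<close> is the number of levels \<open>h \<ge> 1\<close> at which \<open>x\<close> and \<open>y\<close> agree.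
  Averaging \<open>\<Sum>\<^bsub>j<n\<^esub> val (x - s\<^sub>j)\<close> with respect to the current therefore gives \<open>n!\<^sub>S \<le> n H\<close>.
  On the other hand \<open>\<Sum>\<^bsub>n<N\<^esub> n!\<^sub>S\<close> is, up to truncation at a finite level, half of \<open>N\<^sup>2\<close> times the energy of
  the flow of visit frequencies of \<open>s\<^sub>0, \<dots>, s\<^bsub>N-1\<^esub>\<close>. This energy is bounded below by the energy of the
  truncated network, which yields \<open>n!\<^sub>S / n \<longlonglongrightarrow> H\<close> as \<open>n!\<^sub>S\<close> is nondecreasing, and by the parallelogram
  identity the frequencies converge to the current. Conversely, if \<open>n!\<^sub>S = O(n)\<close>, then the truncated
  energies are bounded and \<open>k\<^sub>0 > 0\<close>.

  The potential of the harmonic measure is at most \<open>H\<close> everywhere and its mean is the energy \<open>H\<close>;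
  hence it equals \<open>H\<close> almost everywhere.
\<close>

section \<open>Averages and counting\<close>

text \<open>The imagined edge above the root lets every vertex, the root included, obey one
  recursion \<open>cond = s / (1 + s)\<close>; its own resistance 1 is what is subtracted in
  \<open>1 / k0 - 1\<close>. The lower bound for the factorials is available only after summing over
  \<open>n\<close>, because the energy of the visit frequencies involves all pairs of the first
  \<open>N\<close> points at once. Monotonicity and the bound \<open>H * n\<close> from above make
  this averaged bound sufficient, by a Tauberian argument. Depth and length are limits in a fixed
  order: \<open>N\<close> grows at fixed depth \<open>L\<close>, where coincident pairs cost only
  \<open>L / N\<close>, and \<open>L\<close> grows afterwards. That no voltage is left at infinity
  is never shown directly; the truncated energies of the current are squeezed between
  \<open>1 / cond L root\<close> and \<open>1 / k0\<close>. The harmonic measure is the law of the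
  end of a Markov chain that descends the tree in proportion to the current, so that one theory of
  chains serves both the random walk and the measure. The finite residue field enters through the
  finiteness of the levels, completeness through the end of a branch.\<close>

lemma divide_1_plus_mono: "0 \<le> s \<Longrightarrow> s \<le> t \<Longrightarrow> s / (1 + s) \<le> t / (1 + (t::real))"
  by (simp add: divide_simps) (simp add: algebra_simps)

text \<open>The deficits \<open>H * m - a m\<close> are nonnegative, and \<open>lower\<close> bounds
  their sum by half of \<open>\<epsilon>\<^sup>2 * n\<^sup>2\<close> plus a term linear in
  \<open>n\<close>. By monotonicity a deficit at \<open>n\<close> persists, up to
  \<open>H * k\<close>, on the \<open>k\<close> indices before \<open>n\<close>; with
  \<open>k\<close> about \<open>\<epsilon> * n\<close> it can only be of order
  \<open>\<epsilon> * n\<close>.\<close>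

lemma LIMSEQ_average_of_mono:
  fixes a :: "nat \<Rightarrow> real"
  assumes mono: "\<And>m n. m \<le> n \<Longrightarrow> a m \<le> a n"
    and upper: "\<And>n. a n \<le> H * real n"
    and lower: "\<And>L n. (R L * (real n)\<^sup>2 - C L * real n) / 2 \<le> (\<Sum>m<n. a m)"
    and R: "R \<longlonglongrightarrow> H" and H: "0 \<le> H"
  shows "(\<lambda>n. a n / real n) \<longlonglongrightarrow> H"
proof (rule LIMSEQ_I)
  fix r :: real assume "0 < r"
  \<comment> \<open>The window costs \<open>\<epsilon> * H * n\<close> and the summed deficit
    \<open>\<epsilon> * n / 2\<close>; half of \<open>r\<close> must cover both, the other half is
    kept for the bounded remainder \<open>D\<close>.\<close>
  define \<epsilon> where "\<epsilon> = min (1/2) (r / (2 * (H + 1)))"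
  have "\<epsilon> \<le> r / 2 / (H + 1)" by (simp add: \<epsilon>_def)
  then have "\<epsilon> * (H + 1) \<le> r / 2" using H by (simp add: pos_le_divide_eq algebra_simps)
  moreover have "0 < \<epsilon>" "\<epsilon> < 1" using \<open>0 < r\<close> H by (simp_all add: \<epsilon>_def)
  ultimately have \<epsilon>: "0 < \<epsilon>" "\<epsilon> < 1" "\<epsilon> * (H + 1) \<le> r / 2" by auto
  \<comment> \<open>The square compensates for dividing the summed deficit by the window length
    \<open>\<epsilon> * n\<close>.\<close>
  obtain L where L: "H - R L < \<epsilon>\<^sup>2"
    using LIMSEQ_D[OF R, of "\<epsilon>\<^sup>2"] \<epsilon> by (auto simp: abs_less_iff)
  define D where "D = H + \<bar>C L\<bar> / (2 * \<epsilon>)"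
  have D: "0 \<le> D" using H \<epsilon> by (simp add: D_def)
  \<comment> \<open>The first bound keeps the window inside \<open>{0..<n}\<close>, the second
    absorbs \<open>D\<close>, whose summand \<open>H\<close> comes from rounding \<open>k\<close>
    up.\<close>
  obtain N :: nat where N: "real N > max (1 / (1 - \<epsilon>)) (2 * D / r)" using reals_Archimedean2 by blast
  have "norm (a n / real n - H) < r" if n: "n \<ge> Suc N" for n
  proof -
    have n0: "0 < real n" using n by simp
    have nN: "1 / (1 - \<epsilon>) < real n" "2 * D / r < real n" using N n by auto
    define k where "k = nat \<lceil>\<epsilon> * real n\<rceil>"
    have k: "\<epsilon> * real n \<le> real k" "real k \<le> \<epsilon> * real n + 1"
      using \<epsilon> n0 unfolding k_def by (auto simp: of_nat_nat intro: less_imp_le[OF ceiling_correct[THEN conjunct1]])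
    have "\<epsilon> * real n + 1 < real n" using nN(1) \<epsilon> by (simp add: field_simps)
    then have kn: "k \<le> n" using k by linarith
    have k0: "0 < real k" using k \<epsilon> n0 by (smt (verit) mult_pos_pos)
    have "real k * (H * real (n - k) - a n) = (\<Sum>m\<in>{n-k..<n}. H * real (n - k) - a n)"
      using kn by simp
    also have "\<dots> \<le> (\<Sum>m\<in>{n-k..<n}. H * real m - a m)"
      using H mono by (intro sum_mono diff_mono mult_left_mono) auto
    also have "\<dots> \<le> (\<Sum>m<n. H * real m - a m)"
      using upper by (intro sum_mono2) (auto simp: algebra_simps)
    also have "\<dots> = H * (\<Sum>m<n. real m) - (\<Sum>m<n. a m)"
      by (simp add: sum_subtractf sum_distrib_left)
    also have "(\<Sum>m<n. real m) \<le> (real n)\<^sup>2 / 2"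
      by (induction n) (auto simp: power2_eq_square field_simps)
    then have "H * (\<Sum>m<n. real m) - (\<Sum>m<n. a m) \<le> H * ((real n)\<^sup>2 / 2) - (R L * (real n)\<^sup>2 - C L * real n) / 2"
      using lower[of L n] H by (intro diff_mono mult_left_mono)
    also have "\<dots> = ((H - R L) * (real n)\<^sup>2 + C L * real n) / 2" by (simp add: field_simps)
    also have "\<dots> \<le> (\<epsilon>\<^sup>2 * (real n)\<^sup>2 + \<bar>C L\<bar> * real n) / 2"
      using L n0 by (intro divide_right_mono add_mono mult_right_mono) auto
    finally have "real k * (H * real (n - k) - a n) \<le> (\<epsilon>\<^sup>2 * (real n)\<^sup>2 + \<bar>C L\<bar> * real n) / 2" .
    then have "H * real (n - k) - a n \<le> (\<epsilon>\<^sup>2 * (real n)\<^sup>2 + \<bar>C L\<bar> * real n) / 2 / real k"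
      using k0 by (simp add: field_simps)
    also have "\<dots> \<le> (\<epsilon>\<^sup>2 * (real n)\<^sup>2 + \<bar>C L\<bar> * real n) / 2 / (\<epsilon> * real n)"
      using k(1) \<epsilon> n0 by (intro divide_left_mono mult_pos_pos k0) auto
    also have "\<dots> = (\<epsilon> * real n) / 2 + \<bar>C L\<bar> / (2 * \<epsilon>)"
      using \<epsilon> n0 by (simp add: field_simps power2_eq_square)
    finally have 1: "H * real (n - k) - a n \<le> (\<epsilon> * real n) / 2 + \<bar>C L\<bar> / (2 * \<epsilon>)" .
    have "H * (real n - (\<epsilon> * real n + 1)) \<le> H * real (n - k)"
      using k kn H by (intro mult_left_mono) auto
    with 1 have "H * real n - a n \<le> \<epsilon> * H * real n + (\<epsilon> * real n) / 2 + D"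
      by (simp add: D_def algebra_simps)
    also have "\<dots> \<le> \<epsilon> * (H + 1) * real n + D" using \<epsilon> n0 by (simp add: algebra_simps)
    also have "\<dots> \<le> r / 2 * real n + D" using \<epsilon> n0 by (intro add_right_mono mult_right_mono) auto
    also have "\<dots> < r * real n" using nN(2) \<open>0 < r\<close> by (simp add: field_simps)
    finally have "H * real n - a n < r * real n" .
    then have "H - a n / real n < r" using n0 by (simp add: field_simps)
    moreover have "a n / real n \<le> H" using upper[of n] n0 by (simp add: field_simps)
    ultimately show ?thesis by simp
  qed
  then show "\<exists>N. \<forall>n\<ge>N. norm (a n / real n - H) < r" by blast
qed

text \<open>The squares count ordered pairs with equal values: the diagonal gives \<open>N\<close>,
  every pair \<open>j < n\<close> is counted twice.\<close>

lemma sum_square_counts: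
  fixes f :: "nat \<Rightarrow> 'b"
  assumes "finite B" "\<And>j. j < N \<Longrightarrow> f j \<in> B"
  shows "(\<Sum>b\<in>B. (real (card {j. j < N \<and> f j = b}))\<^sup>2)
    = real N + 2 * (\<Sum>n<N. \<Sum>j<n. if f n = f j then 1 else 0)"
  using assms(2)
proof (induction N)
  case (Suc N)
  let ?c = "\<lambda>N b. card {j. j < N \<and> f j = b}"
  have "?c (Suc N) b = ?c N b + (if f N = b then 1 else 0)" for b
  proof -
    have "{j. j < Suc N \<and> f j = b} = (if f N = b then insert N {j. j < N \<and> f j = b} else {j. j < N \<and> f j = b})"
      by (auto simp: less_Suc_eq)
    then show ?thesis by simp
  qed
  then have "(\<Sum>b\<in>B. (real (?c (Suc N) b))\<^sup>2)
      = (\<Sum>b\<in>B. (real (?c N b))\<^sup>2 + (if f N = b then 2 * real (?c N b) + 1 else 0))"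
    by (intro sum.cong refl) (simp add: power2_eq_square algebra_simps)
  also have "\<dots> = (\<Sum>b\<in>B. (real (?c N b))\<^sup>2) + (2 * real (?c N (f N)) + 1)"
    using assms(1) Suc.prems by (simp add: sum.distrib)
  also have "real (?c N (f N)) = (\<Sum>j<N. if f N = f j then 1 else 0)"
    by (auto simp: sum.If_cases intro!: arg_cong[where f=card])
  finally show ?case using Suc by (simp add: algebra_simps)
qed simp

section \<open>Markov chains with discrete transition kernels\<close>

text \<open>\<open>walk_step\<close> with arbitrary kernel and start. It serves the simple random
  walk and again the descending chain whose end is distributed by the harmonic measure.\<close>

definition chain_step :: "('s \<Rightarrow> 's pmf) \<Rightarrow> 's \<Rightarrow> nat \<Rightarrow> (nat \<Rightarrow> 's) \<Rightarrow> 's measure" where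
  "chain_step K x n \<omega> = measure_pmf (case n of 0 \<Rightarrow> return_pmf x | Suc k \<Rightarrow> K (\<omega> k))"

interpretation chain: Ionescu_Tulcea "chain_step K x" "\<lambda>_. count_space UNIV" for K x
proof (rule Ionescu_Tulcea.intro)
  fix i :: nat
  show "chain_step K x i \<in> measurable (PiM {0..<i} (\<lambda>_. count_space UNIV)) (subprob_algebra (count_space UNIV))"
  proof (cases i)
    case 0
    then show ?thesis
      unfolding chain_step_def[abs_def] by (simp add: measure_pmf_in_subprob_algebra)
  next
    case (Suc k)
    have "(\<lambda>\<omega>. \<omega> k) \<in> measurable (PiM {0..<i} (\<lambda>_. count_space UNIV)) (count_space UNIV)"
      using Suc by (intro measurable_component_singleton) auto
    moreover have "(\<lambda>a. measure_pmf (K a))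
        \<in> measurable (count_space UNIV) (subprob_algebra (count_space UNIV))"
      by (simp add: measure_pmf_in_subprob_algebra)
    ultimately have "(\<lambda>\<omega>. measure_pmf (K (\<omega> k)))
        \<in> measurable (PiM {0..<i} (\<lambda>_. count_space UNIV)) (subprob_algebra (count_space UNIV))"
      by (rule measurable_compose)
    then show ?thesis
      unfolding chain_step_def[abs_def] using Suc by simp
  qed
qed (simp add: chain_step_def prob_space_measure_pmf)

definition chain_law :: "('s \<Rightarrow> 's pmf) \<Rightarrow> 's \<Rightarrow> (nat \<Rightarrow> 's) measure" where
  "chain_law K x = chain.PF.lim K x"

lemma sets_chain_law [measurable_cong]:
  "sets (chain_law K x) = sets (PiM UNIV (\<lambda>_. count_space UNIV))"
  unfolding chain_law_def by (rule chain.PF.sets_lim)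

lemma space_chain_law [simp]: "space (chain_law K x) = UNIV"
  using sets_eq_imp_space_eq[OF sets_chain_law[of K x]] by (simp add: space_PiM)

lemma prob_space_chain_law: "prob_space (chain_law K x)"
proof
  have "emeasure (chain_law K x) (chain.PF.emb UNIV {} {\<lambda>_. undefined}) = emeasure (chain.CI K x {}) {\<lambda>_. undefined}"
    unfolding chain_law_def by (rule chain.lim) (auto simp: PiM_empty)
  also have "\<dots> = 1"
    using prob_space.emeasure_space_1[OF chain.PF.prob_space_P[of "{}" K x]]
    by (simp add: chain.CI_def space_PiM PiE_def)
  also have "chain.PF.emb UNIV {} {\<lambda>_. undefined} = (UNIV :: (nat \<Rightarrow> 'a) set)"
    by (auto simp: prod_emb_def space_PiM)
  finally show "emeasure (chain_law K x) (space (chain_law K x)) = 1" by simp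
qed

lemma nn_integral_chain_law_restrict:
  assumes F: "F \<in> borel_measurable (PiM {0..<n} (\<lambda>_. count_space UNIV))"
  shows "(\<integral>\<^sup>+\<omega>. F (restrict \<omega> {0..<n}) \<partial>chain_law K x)
       = (\<integral>\<^sup>+\<omega>. F \<omega> \<partial>chain.C K x 0 n (\<lambda>_. undefined))"
proof -
  have up: "chain.up_to {0..<n} \<le> n" by (subst chain.up_to_iff) auto
  have "chain.C K x 0 n (\<lambda>_. undefined) = distr (chain_law K x) (PiM {0..<n} (\<lambda>_. count_space UNIV)) (\<lambda>x. restrict x {0..<n})"
  proof -
    have "n \<le> chain.up_to {0..<n}"
      using chain.up_to_less[of "{0..<n}" "n - 1"] by (cases n) auto
    with up have "chain.up_to {0..<n} = n" by simp
    then have "chain.CI K x {0..<n} = distr (chain.C K x 0 n (\<lambda>_. undefined)) (PiM {0..<n} (\<lambda>_. count_space UNIV)) (\<lambda>f. restrict f {0..<0+n})"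
      by (simp add: chain.CI_def)
    also have "\<dots> = chain.C K x 0 n (\<lambda>_. undefined)"
      using chain.distr_C[of n n "\<lambda>_. undefined" 0 K x] by (simp add: space_PiM)
    finally show ?thesis
      unfolding chain_law_def using chain.distr_lim[of "{0..<n}" K x] by simp
  qed
  moreover have "(\<lambda>\<omega>. restrict \<omega> {0..<n}) \<in> measurable (chain_law K x) (PiM {0..<n} (\<lambda>_. count_space UNIV))"
    unfolding measurable_cong_sets[OF sets_chain_law refl] by (rule measurable_restrict_subset) simp
  ultimately show ?thesis
    using F by (simp add: nn_integral_distr)
qed

text \<open>The Markov property: under a weight that depends on the past up to time
  \<open>n\<close>, the next state may be averaged over the kernel at
  \<open>\<omega> n\<close>.\<close>

lemma nn_integral_chain_law_Suc:
  assumes F: "F \<in> borel_measurable (PiM {0..<Suc n} (\<lambda>_. count_space UNIV))"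
  shows "(\<integral>\<^sup>+\<omega>. F (restrict \<omega> {0..<Suc n}) * f (\<omega> (Suc n)) \<partial>chain_law K x)
       = (\<integral>\<^sup>+\<omega>. F (restrict \<omega> {0..<Suc n}) * (\<integral>\<^sup>+y. f y \<partial>K (\<omega> n)) \<partial>chain_law K x)"
proof -
  let ?P = "\<lambda>n. PiM {0..<n} (\<lambda>_::nat. count_space (UNIV :: 'a set))"
  let ?C = "\<lambda>n. chain.C K x 0 n (\<lambda>_. undefined)"
  let ?G = "\<lambda>\<omega>. F (restrict \<omega> {0..<Suc n}) * f (\<omega> (Suc n))"
  note F[measurable]
  have f[measurable]: "f \<in> borel_measurable (count_space UNIV)" by simp
  have G: "?G \<in> borel_measurable (?P (Suc (Suc n)))"
  proof (rule borel_measurable_times_ennreal)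
    show "(\<lambda>\<omega>. F (restrict \<omega> {0..<Suc n})) \<in> borel_measurable (?P (Suc (Suc n)))"
      by (rule measurable_compose[OF measurable_restrict_subset F]) auto
    show "(\<lambda>\<omega>. f (\<omega> (Suc n))) \<in> borel_measurable (?P (Suc (Suc n)))"
      by (rule measurable_compose[where f="\<lambda>\<omega>. \<omega> (Suc n)", OF _ f]) (rule measurable_component_singleton, simp)
  qed
  have Kf: "(\<lambda>\<omega>. \<integral>\<^sup>+y. f y \<partial>K (\<omega> n)) \<in> borel_measurable (?P (Suc n))"
    by (rule measurable_compose[OF measurable_component_singleton[of n "{0..<Suc n}"]]) auto
  have "(\<integral>\<^sup>+\<omega>. ?G \<omega> \<partial>chain_law K x) = (\<integral>\<^sup>+\<omega>. ?G (restrict \<omega> {0..<Suc (Suc n)}) \<partial>chain_law K x)"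
    by (intro nn_integral_cong) (simp add: restrict_def cong: if_cong)
  also have "\<dots> = (\<integral>\<^sup>+\<omega>. ?G \<omega> \<partial>?C (Suc (Suc n)))"
    by (rule nn_integral_chain_law_restrict[OF G])
  also have "\<dots> = (\<integral>\<^sup>+\<omega>. (\<integral>\<^sup>+\<omega>'. ?G \<omega>' \<partial>chain.eP K x (Suc n) \<omega>) \<partial>?C (Suc n))"
  proof -
    have "sets (?C (Suc n)) = sets (?P (Suc n))"
      using chain.sets_C[of "\<lambda>_. undefined" 0 K x "Suc n"] by (simp add: space_PiM)
    then have "chain.eP K x (Suc n) \<in> measurable (?C (Suc n)) (subprob_algebra (?P (Suc (Suc n))))"
      using chain.measurable_eP[of K x "Suc n"] measurable_cong_sets by blast
    from nn_integral_bind[OF G this] show ?thesis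
      by (subst chain.C.simps(2)) simp
  qed
  also have "\<dots> = (\<integral>\<^sup>+\<omega>. F \<omega> * (\<integral>\<^sup>+y. f y \<partial>K (\<omega> n)) \<partial>?C (Suc n))"
  proof (rule nn_integral_cong)
    fix \<omega> assume "\<omega> \<in> space (?C (Suc n))"
    then have \<omega>: "\<omega> \<in> space (?P (Suc n))" using chain.space_C[of "\<lambda>_. undefined" 0 K x "Suc n"] by (simp add: space_PiM)
    have r: "restrict (fun_upd \<omega> (Suc n) y) {0..<Suc n} = \<omega>" for y
      using \<omega> by (auto simp: space_PiM PiE_def extensional_def restrict_def fun_eq_iff)
    have "(\<integral>\<^sup>+\<omega>'. ?G \<omega>' \<partial>chain.eP K x (Suc n) \<omega>) = (\<integral>\<^sup>+y. ?G (fun_upd \<omega> (Suc n) y) \<partial>chain_step K x (Suc n) \<omega>)"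
      by (rule chain.nn_integral_eP[OF \<omega> G])
    also have "\<dots> = (\<integral>\<^sup>+y. F \<omega> * f y \<partial>K (\<omega> n))"
      by (simp add: r chain_step_def)
    also have "\<dots> = F \<omega> * (\<integral>\<^sup>+y. f y \<partial>K (\<omega> n))"
      by (rule nn_integral_cmult) simp
    finally show "(\<integral>\<^sup>+\<omega>'. ?G \<omega>' \<partial>chain.eP K x (Suc n) \<omega>) = F \<omega> * (\<integral>\<^sup>+y. f y \<partial>K (\<omega> n))" .
  qed
  also have "\<dots> = (\<integral>\<^sup>+\<omega>. F (restrict \<omega> {0..<Suc n}) * (\<integral>\<^sup>+y. f y \<partial>K (restrict \<omega> {0..<Suc n} n)) \<partial>chain_law K x)"
    using F Kf by (intro nn_integral_chain_law_restrict[symmetric]) measurable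
  finally show ?thesis by simp
qed

lemma nn_integral_chain_law_0: "(\<integral>\<^sup>+\<omega>. f (\<omega> 0) \<partial>chain_law K x) = f x"
proof -
  let ?P = "\<lambda>n. PiM {0..<n} (\<lambda>_::nat. count_space (UNIV :: 'a set))"
  have G: "(\<lambda>\<omega>. f (\<omega> 0)) \<in> borel_measurable (?P (Suc 0))"
    by (rule measurable_compose[OF measurable_component_singleton[of 0 "{0..<Suc 0}"]]) auto
  have u: "(\<lambda>_. undefined) \<in> space (?P 0)" by (simp add: space_PiM)
  have "(\<integral>\<^sup>+\<omega>. f (\<omega> 0) \<partial>chain_law K x) = (\<integral>\<^sup>+\<omega>. f (restrict \<omega> {0..<Suc 0} 0) \<partial>chain_law K x)"
    by simp
  also have "\<dots> = (\<integral>\<^sup>+\<omega>. f (\<omega> 0) \<partial>chain.C K x 0 (Suc 0) (\<lambda>_. undefined))"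
    by (rule nn_integral_chain_law_restrict[OF G])
  also have "chain.C K x 0 (Suc 0) (\<lambda>_. undefined) = chain.eP K x 0 (\<lambda>_. undefined)"
    using bind_return[OF chain.measurable_eP u] by simp
  also have "(\<integral>\<^sup>+\<omega>. f (\<omega> 0) \<partial>chain.eP K x 0 (\<lambda>_. undefined)) = f x"
    by (subst chain.nn_integral_eP[OF u G]) (simp add: chain_step_def)
  finally show ?thesis .
qed

lemma measurable_chain_law_component [measurable]:
  "(\<lambda>\<omega>. \<omega> n) \<in> measurable (chain_law K x) (count_space UNIV)"
  unfolding measurable_cong_sets[OF sets_chain_law refl] by (rule measurable_component_singleton) simp

lemma chain_law_component_measurable: "{\<omega>. P (\<omega> n)} \<in> sets (chain_law K x)"
  using measurable_sets[OF measurable_chain_law_component, of "Collect P" n K x]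
  by (simp add: vimage_def)

lemma chain_law_edge_measurable:
  assumes "countable E"
  shows "{\<omega>. (\<omega> m, \<omega> n) \<in> E} \<in> sets (chain_law K x)"
proof -
  have "{\<omega>. (\<omega> m, \<omega> n) \<in> E} = (\<Union>e\<in>E. {\<omega>. \<omega> m = fst e} \<inter> {\<omega>. \<omega> n = snd e})"
    by force
  also have "\<dots> \<in> sets (chain_law K x)"
    using assms chain_law_component_measurable by (intro sets.countable_UN' sets.Int) auto
  finally show ?thesis .
qed

lemma emeasure_chain_law_component:
  "emeasure (chain_law K x) {\<omega>. \<omega> n \<in> A} = (\<integral>\<^sup>+\<omega>. indicator A (\<omega> n) \<partial>chain_law K x)"
proof -
  have "indicator A (\<omega> n) = (indicator {\<omega>. \<omega> n \<in> A} \<omega> :: ennreal)" for \<omega> :: "nat \<Rightarrow> 'a"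
    by (simp add: indicator_def)
  then show ?thesis
    using chain_law_component_measurable[of "\<lambda>y. y \<in> A" n K x] by simp
qed

lemma AE_chain_law_0: "AE \<omega> in chain_law K x. \<omega> 0 = x"
proof -
  have "emeasure (chain_law K x) {\<omega>. \<omega> 0 \<in> - {x}} = 0"
    unfolding emeasure_chain_law_component nn_integral_chain_law_0 by simp
  then have "{\<omega>. \<omega> 0 \<noteq> x} \<in> null_sets (chain_law K x)"
    using chain_law_component_measurable[of "\<lambda>y. y \<noteq> x" 0 K x] by (simp add: null_sets_def)
  then show ?thesis by (rule AE_I') auto
qed

lemma AE_chain_law_invariant:
  assumes "x \<in> A" "\<And>y. y \<in> A \<Longrightarrow> set_pmf (K y) \<subseteq> A"
  shows "AE \<omega> in chain_law K x. \<forall>n. \<omega> n \<in> A"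
proof -
  have "AE \<omega> in chain_law K x. \<omega> n \<in> A" for n
  proof (induction n)
    case 0
    show ?case using AE_chain_law_0[where K=K and x=x] by eventually_elim (use assms in simp)
  next
    case (Suc n)
    have "emeasure (chain_law K x) {\<omega>. \<omega> (Suc n) \<in> - A} = (\<integral>\<^sup>+\<omega>. 1 * indicator (- A) (\<omega> (Suc n)) \<partial>chain_law K x)"
      unfolding emeasure_chain_law_component by simp
    also have "\<dots> = (\<integral>\<^sup>+\<omega>. 1 * (\<integral>\<^sup>+y. indicator (- A) y \<partial>K (\<omega> n)) \<partial>chain_law K x)"
      by (rule nn_integral_chain_law_Suc[where F="\<lambda>_. 1"]) simp
    also have "\<dots> = (\<integral>\<^sup>+\<omega>. 0 \<partial>chain_law K x)"
    proof (rule nn_integral_cong_AE)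
      show "AE \<omega> in chain_law K x. 1 * (\<integral>\<^sup>+y. indicator (- A) y \<partial>K (\<omega> n)) = 0"
        using Suc
      proof eventually_elim
        case (elim \<omega>)
        then have "measure (measure_pmf (K (\<omega> n))) (- A) = 0"
          using assms(2)[of "\<omega> n"] by (auto simp: measure_pmf_zero_iff)
        then show ?case by (simp add: measure_pmf.emeasure_eq_measure)
      qed
    qed
    finally have "{\<omega>. \<omega> (Suc n) \<notin> A} \<in> null_sets (chain_law K x)"
      using chain_law_component_measurable[of "\<lambda>y. y \<notin> A" "Suc n" K x] by (simp add: null_sets_def)
    then show ?case by (rule AE_I') auto
  qed
  then show ?thesis by (simp add: AE_all_countable)
qed

text \<open>\<open>avoid K r k y\<close> is the probability that the chain started at \<open>y\<close> does not visit \<open>r\<close> at the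
  times \<open>1, \<dots>, k\<close>.\<close>

primrec avoid :: "('s \<Rightarrow> 's pmf) \<Rightarrow> 's \<Rightarrow> nat \<Rightarrow> 's \<Rightarrow> ennreal" where
  "avoid K r 0 y = 1"
| "avoid K r (Suc k) y = (\<integral>\<^sup>+z. indicator (- {r}) z * avoid K r k z \<partial>K y)"

text \<open>Induction on \<open>j\<close> with \<open>k\<close> free: the Markov property absorbs
  the latest condition \<open>\<omega> (m + Suc j) \<noteq> r\<close> into \<open>avoid\<close> and
  raises its index by one.\<close>

lemma nn_integral_avoid:
  "(\<integral>\<^sup>+\<omega>. indicator {\<omega>. \<omega> m = r \<and> (\<forall>i\<in>{m<..m+j}. \<omega> i \<noteq> r)} \<omega> * avoid K r k (\<omega> (m + j)) \<partial>chain_law K x)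
    = emeasure (chain_law K x) {\<omega>. \<omega> m = r} * avoid K r (k + j) r"
proof (induction j arbitrary: k)
  case 0
  have "(\<integral>\<^sup>+\<omega>. indicator {\<omega>. \<omega> m = r} \<omega> * avoid K r k (\<omega> m) \<partial>chain_law K x)
      = (\<integral>\<^sup>+\<omega>. avoid K r k r * indicator {\<omega>. \<omega> m = r} \<omega> \<partial>chain_law K x)"
    by (intro nn_integral_cong) (auto split: split_indicator)
  also have "\<dots> = avoid K r k r * emeasure (chain_law K x) {\<omega>. \<omega> m = r}"
    by (rule nn_integral_cmult_indicator) (rule chain_law_component_measurable)
  finally show ?case by (simp add: mult.commute)
next
  case (Suc j)
  let ?P = "PiM {0..<Suc (m + j)} (\<lambda>_::nat. count_space (UNIV :: 'a set))"
  let ?A = "{\<omega>. \<omega> m = r \<and> (\<forall>i\<in>{m<..m+j}. \<omega> i \<noteq> r)}"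
  have comp: "{\<omega> \<in> space ?P. Q (\<omega> i)} \<in> sets ?P" if "i < Suc (m + j)" for i Q
    using measurable_sets[OF measurable_component_singleton[of i "{0..<Suc (m + j)}" "\<lambda>_. count_space (UNIV :: 'a set)"], of "Collect Q"] that
    by (simp add: vimage_def Int_def conj_commute)
  have "{\<omega> \<in> space ?P. \<omega> m = r \<and> (\<forall>i\<in>{m<..m+j}. \<omega> i \<noteq> r)} \<in> sets ?P"
    by (intro sets.sets_Collect_conj sets.sets_Collect_finite_All comp) auto
  moreover have "{\<omega> \<in> space ?P. \<omega> m = r \<and> (\<forall>i\<in>{m<..m+j}. \<omega> i \<noteq> r)} = ?A \<inter> space ?P" by auto
  ultimately have "?A \<inter> space ?P \<in> sets ?P" by simp
  then have meas: "(indicator ?A :: _ \<Rightarrow> ennreal) \<in> borel_measurable ?P"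
    by (simp add: borel_measurable_indicator_iff)
  have restr: "indicator ?A (restrict \<omega> {0..<Suc (m + j)}) = (indicator ?A \<omega> :: ennreal)" for \<omega> :: "nat \<Rightarrow> 'a"
    by (auto split: split_indicator)
  have "indicator {\<omega>. \<omega> m = r \<and> (\<forall>i\<in>{m<..m + Suc j}. \<omega> i \<noteq> r)} \<omega>
      = indicator ?A \<omega> * (indicator (- {r}) (\<omega> (Suc (m + j))) :: ennreal)" for \<omega> :: "nat \<Rightarrow> 'a"
    by (auto split: split_indicator simp: le_Suc_eq)
  then have "(\<integral>\<^sup>+\<omega>. indicator {\<omega>. \<omega> m = r \<and> (\<forall>i\<in>{m<..m + Suc j}. \<omega> i \<noteq> r)} \<omega> * avoid K r k (\<omega> (m + Suc j)) \<partial>chain_law K x)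
      = (\<integral>\<^sup>+\<omega>. indicator ?A (restrict \<omega> {0..<Suc (m + j)})
          * (indicator (- {r}) (\<omega> (Suc (m + j))) * avoid K r k (\<omega> (Suc (m + j)))) \<partial>chain_law K x)"
    by (simp only: restr mult.assoc add_Suc_right)
  also have "\<dots> = (\<integral>\<^sup>+\<omega>. indicator ?A (restrict \<omega> {0..<Suc (m + j)}) * avoid K r (Suc k) (\<omega> (m + j)) \<partial>chain_law K x)"
    using nn_integral_chain_law_Suc[OF meas, where f="\<lambda>z. indicator (- {r}) z * avoid K r k z" and K=K and x=x] by simp
  also have "\<dots> = (\<integral>\<^sup>+\<omega>. indicator ?A \<omega> * avoid K r (Suc k) (\<omega> (m + j)) \<partial>chain_law K x)"
    by (simp only: restr)
  also have "\<dots> = emeasure (chain_law K x) {\<omega>. \<omega> m = r} * avoid K r (k + Suc j) r"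
    unfolding Suc.IH by simp
  finally show ?case .
qed

text \<open>If the visits are finite in number, one of them is the last. That the last visit happens
  at time \<open>m\<close> has probability at most \<open>avoid K x j x\<close> for every
  \<open>j\<close>, hence zero, and there are only countably many \<open>m\<close>.\<close>

lemma AE_chain_law_recurrent:
  assumes avoid: "(\<lambda>k. avoid K x k x) \<longlonglongrightarrow> 0"
  shows "AE \<omega> in chain_law K x. infinite {n. \<omega> n = x}"
proof -
  have null: "AE \<omega> in chain_law K x. \<not> (\<omega> m = x \<and> (\<forall>i>m. \<omega> i \<noteq> x))" for m
  proof -
    let ?A = "\<lambda>j. {\<omega>. \<omega> m = x \<and> (\<forall>i\<in>{m<..m+j}. \<omega> i \<noteq> x)}"
    let ?B = "{\<omega>. \<omega> m = x \<and> (\<forall>i>m. \<omega> i \<noteq> x)}"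
    have A: "?A j \<in> sets (chain_law K x)" for j
    proof -
      have "{\<omega>\<in>space (chain_law K x). \<omega> m = x \<and> (\<forall>i\<in>{m<..m+j}. \<omega> i \<noteq> x)} \<in> sets (chain_law K x)"
        using chain_law_component_measurable[of "\<lambda>y. y = x"] chain_law_component_measurable[of "\<lambda>y. y \<noteq> x"]
        by (intro sets.sets_Collect_conj sets.sets_Collect_finite_All) auto
      then show ?thesis by simp
    qed
    have B: "?B = (\<Inter>j. ?A j)"
    proof -
      have "i \<in> {m<..m + (i - m)}" if "m < i" for i using that by simp
      then show ?thesis by fastforce
    qed
    have "emeasure (chain_law K x) ?B \<le> avoid K x j x" for j
    proof -
      have "emeasure (chain_law K x) ?B \<le> emeasure (chain_law K x) (?A j)"
        using A by (intro emeasure_mono) auto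
      also have "\<dots> = (\<integral>\<^sup>+\<omega>. indicator (?A j) \<omega> * avoid K x 0 (\<omega> (m + j)) \<partial>chain_law K x)"
        using A by simp
      also have "\<dots> = emeasure (chain_law K x) {\<omega>. \<omega> m = x} * avoid K x j x"
        using nn_integral_avoid[where m=m and r=x and j=j and K=K and k=0 and x=x] by simp
      also have "\<dots> \<le> 1 * avoid K x j x"
        using prob_space.measure_le_1[OF prob_space_chain_law] by (intro mult_right_mono) auto
      finally show ?thesis by simp
    qed
    then have "emeasure (chain_law K x) ?B \<le> 0"
      by (intro LIMSEQ_le_const[OF avoid]) auto
    moreover have "?B \<in> sets (chain_law K x)"
      unfolding B using A by (intro sets.countable_INT) auto
    ultimately have "?B \<in> null_sets (chain_law K x)"
      by (simp add: null_sets_def)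
    then show ?thesis by (rule AE_I') auto
  qed
  have "AE \<omega> in chain_law K x. \<forall>m. \<not> (\<omega> m = x \<and> (\<forall>i>m. \<omega> i \<noteq> x))"
    using null by (simp add: AE_all_countable)
  then show ?thesis
    using AE_chain_law_0[where K=K and x=x]
  proof eventually_elim
    case (elim \<omega>)
    show ?case
    proof
      assume fin: "finite {n. \<omega> n = x}"
      moreover have "{n. \<omega> n = x} \<noteq> {}" using elim(2) by auto
      ultimately have "\<omega> (Max {n. \<omega> n = x}) = x" using Max_in by blast
      moreover have "\<omega> i \<noteq> x" if "Max {n. \<omega> n = x} < i" for i
        using Max_ge[OF fin, of i] that by auto
      ultimately show False using elim(1) by blast
    qed
  qed
qed

text \<open>A nonnegative superharmonic function with a strict drop at \<open>r\<close> bounds the expected number of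
  visits to \<open>r\<close>.\<close>

lemma AE_chain_law_transient:
  assumes x: "x \<in> A" "\<And>y. y \<in> A \<Longrightarrow> set_pmf (K y) \<subseteq> A"
    and g: "\<And>y. y \<in> A \<Longrightarrow> (\<integral>\<^sup>+z. g z \<partial>K y) + \<delta> * indicator {r} y \<le> g y"
    and "0 < \<delta>" "g x < \<infinity>"
  shows "AE \<omega> in chain_law K x. finite {n. \<omega> n = r}"
proof -
  let ?V = "\<lambda>n. {\<omega>. \<omega> n = r}" and ?M = "chain_law K x"
  interpret prob_space ?M by (rule prob_space_chain_law)
  have inv: "AE \<omega> in ?M. \<forall>n. \<omega> n \<in> A"
    by (rule AE_chain_law_invariant) (fact x)+
  have step: "(\<integral>\<^sup>+\<omega>. g (\<omega> (Suc n)) \<partial>?M) + \<delta> * emeasure ?M (?V n) \<le> (\<integral>\<^sup>+\<omega>. g (\<omega> n) \<partial>?M)" for n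
  proof -
    have "(\<integral>\<^sup>+\<omega>. g (\<omega> (Suc n)) \<partial>?M) = (\<integral>\<^sup>+\<omega>. 1 * g (\<omega> (Suc n)) \<partial>?M)" by simp
    also have "\<dots> = (\<integral>\<^sup>+\<omega>. 1 * (\<integral>\<^sup>+z. g z \<partial>K (\<omega> n)) \<partial>?M)"
      by (rule nn_integral_chain_law_Suc[where F="\<lambda>_. 1"]) simp
    finally have 1: "(\<integral>\<^sup>+\<omega>. g (\<omega> (Suc n)) \<partial>?M) = (\<integral>\<^sup>+\<omega>. (\<integral>\<^sup>+z. g z \<partial>K (\<omega> n)) \<partial>?M)" by simp
    have "\<delta> * emeasure ?M (?V n) = (\<integral>\<^sup>+\<omega>. \<delta> * indicator (?V n) \<omega> \<partial>?M)"
      using chain_law_component_measurable[of "\<lambda>y. y = r" n K x] by (simp add: nn_integral_cmult_indicator)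
    then have "(\<integral>\<^sup>+\<omega>. g (\<omega> (Suc n)) \<partial>?M) + \<delta> * emeasure ?M (?V n)
        = (\<integral>\<^sup>+\<omega>. (\<integral>\<^sup>+z. g z \<partial>K (\<omega> n)) + \<delta> * indicator (?V n) \<omega> \<partial>?M)"
      unfolding 1 using chain_law_component_measurable[of "\<lambda>y. y = r" n K x]
      by (subst nn_integral_add)
        (auto intro!: borel_measurable_times_ennreal borel_measurable_indicator
          measurable_compose[OF measurable_chain_law_component, of "\<lambda>y. \<integral>\<^sup>+z. g z \<partial>K y"])
    also have "\<dots> \<le> (\<integral>\<^sup>+\<omega>. g (\<omega> n) \<partial>?M)"
    proof (rule nn_integral_mono_AE)
      show "AE \<omega> in ?M. (\<integral>\<^sup>+z. g z \<partial>K (\<omega> n)) + \<delta> * indicator (?V n) \<omega> \<le> g (\<omega> n)"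
        using inv
      proof eventually_elim
        case (elim \<omega>)
        show ?case using g[of "\<omega> n"] elim by (simp add: indicator_def)
      qed
    qed
    finally show ?thesis .
  qed
  \<comment> \<open>Telescoping \<open>step\<close>: the mean of \<open>g\<close> starts at
    \<open>g x\<close> and pays \<open>\<delta>\<close> for every expected visit.\<close>
  have bound: "(\<integral>\<^sup>+\<omega>. g (\<omega> N) \<partial>?M) + \<delta> * (\<Sum>n<N. emeasure ?M (?V n)) \<le> g x" for N
  proof (induction N)
    case 0
    then show ?case by (simp add: nn_integral_chain_law_0)
  next
    case (Suc N)
    have "(\<integral>\<^sup>+\<omega>. g (\<omega> (Suc N)) \<partial>?M) + \<delta> * (\<Sum>n<Suc N. emeasure ?M (?V n))
       = ((\<integral>\<^sup>+\<omega>. g (\<omega> (Suc N)) \<partial>?M) + \<delta> * emeasure ?M (?V N)) + \<delta> * (\<Sum>n<N. emeasure ?M (?V n))"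
      by (simp add: distrib_left add_ac)
    also have "\<dots> \<le> (\<integral>\<^sup>+\<omega>. g (\<omega> N) \<partial>?M) + \<delta> * (\<Sum>n<N. emeasure ?M (?V n))"
      by (intro add_right_mono step)
    also have "\<dots> \<le> g x" by (rule Suc)
    finally show ?case .
  qed
  have "\<delta> * (\<Sum>n<N. emeasure ?M (?V n)) \<le> g x" for N
    by (rule order_trans[OF _ bound[of N]]) simp
  then have "(\<Sum>n<N. \<delta> * emeasure ?M (?V n)) \<le> g x" for N
    by (simp add: sum_distrib_left)
  then have "(\<Sum>n. \<delta> * emeasure ?M (?V n)) \<le> g x"
    by (intro suminf_le_const) auto
  then have "\<delta> * (\<Sum>n. emeasure ?M (?V n)) < \<infinity>"
    using assms(5) by (simp add: le_less_trans)
  then have "(\<Sum>n. emeasure ?M (?V n)) < \<infinity>"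
    using assms(4) by (auto simp: ennreal_mult_less_top)
  then have "(\<Sum>n. ennreal (measure ?M (?V n))) \<noteq> \<infinity>"
    by (simp add: emeasure_eq_measure)
  then have "summable (\<lambda>n. measure ?M (?V n))"
    using summable_suminf_not_top[of "\<lambda>n. measure ?M (?V n)"] by simp
  then have "AE \<omega> in ?M. \<forall>\<^sub>F n in sequentially. \<omega> \<in> space ?M - ?V n"
    using chain_law_component_measurable[of "\<lambda>y. y = r" _ K x]
    by (intro borel_cantelli_AE1) (auto simp: less_top[symmetric])
  then show ?thesis
  proof eventually_elim
    case (elim \<omega>)
    then have "\<forall>\<^sub>F n in cofinite. \<omega> n \<noteq> r" by (simp add: cofinite_eq_sequentially)
    then show ?case by (simp add: eventually_cofinite)
  qed
qed

text \<open>Conditioning on \<open>\<omega> n = a\<close> treats one state at a time; countability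
  of \<open>A\<close> permits the union of these null sets.\<close>

lemma AE_chain_law_step:
  assumes inv: "x \<in> A" "\<And>y. y \<in> A \<Longrightarrow> set_pmf (K y) \<subseteq> A" and A: "countable A"
  shows "AE \<omega> in chain_law K x. \<forall>n. \<omega> (Suc n) \<in> set_pmf (K (\<omega> n))"
proof -
  have null: "AE \<omega> in chain_law K x. \<omega> n = a \<longrightarrow> \<omega> (Suc n) \<in> set_pmf (K a)" for n a
  proof -
    let ?P = "PiM {0..<Suc n} (\<lambda>_::nat. count_space (UNIV :: 'a set))"
    let ?A = "{\<omega>. \<omega> n = a} :: (nat \<Rightarrow> 'a) set"
    let ?B = "{\<omega>. \<omega> n = a \<and> \<omega> (Suc n) \<notin> set_pmf (K a)}"
    have "?A \<inter> space ?P \<in> sets ?P"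
      using measurable_sets[OF measurable_component_singleton[of n "{0..<Suc n}" "\<lambda>_. count_space (UNIV :: 'a set)"], of "{a}"]
      by (simp add: vimage_def)
    then have meas: "(indicator ?A :: _ \<Rightarrow> ennreal) \<in> borel_measurable ?P"
      by (simp add: borel_measurable_indicator_iff)
    have restr: "indicator ?A (restrict \<omega> {0..<Suc n}) = (indicator ?A \<omega> :: ennreal)" for \<omega> :: "nat \<Rightarrow> 'a"
      by (simp add: indicator_def)
    have B: "?B \<in> sets (chain_law K x)"
      using sets.Int[OF chain_law_component_measurable[of "\<lambda>y. y = a" n K x]
          chain_law_component_measurable[of "\<lambda>y. y \<notin> set_pmf (K a)" "Suc n" K x]]
      by (simp add: Int_def)
    have "emeasure (chain_law K x) ?B = (\<integral>\<^sup>+\<omega>. indicator ?B \<omega> \<partial>chain_law K x)"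
      using B by simp
    also have "\<dots> = (\<integral>\<^sup>+\<omega>. indicator ?A (restrict \<omega> {0..<Suc n}) * indicator (- set_pmf (K a)) (\<omega> (Suc n)) \<partial>chain_law K x)"
      unfolding restr by (intro nn_integral_cong) (simp add: indicator_def)
    also have "\<dots> = (\<integral>\<^sup>+\<omega>. indicator ?A (restrict \<omega> {0..<Suc n}) * (\<integral>\<^sup>+y. indicator (- set_pmf (K a)) y \<partial>K (\<omega> n)) \<partial>chain_law K x)"
      by (rule nn_integral_chain_law_Suc[OF meas])
    also have "\<dots> = (\<integral>\<^sup>+\<omega>. 0 \<partial>chain_law K x)"
    proof (rule nn_integral_cong)
      fix \<omega> :: "nat \<Rightarrow> 'a"
      have "measure (measure_pmf (K a)) (- set_pmf (K a)) = 0" by (simp add: measure_pmf_zero_iff)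
      then have "emeasure (measure_pmf (K a)) (- set_pmf (K a)) = 0" by (simp add: measure_pmf.emeasure_eq_measure)
      then show "indicator ?A (restrict \<omega> {0..<Suc n}) * (\<integral>\<^sup>+y. indicator (- set_pmf (K a)) y \<partial>K (\<omega> n)) = 0"
        unfolding restr by (cases "\<omega> n = a") simp_all
    qed
    finally have "?B \<in> null_sets (chain_law K x)" using B by (simp add: null_sets_def)
    then show ?thesis by (rule AE_I') auto
  qed
  have "AE \<omega> in chain_law K x. \<forall>n. \<forall>a\<in>A. \<omega> n = a \<longrightarrow> \<omega> (Suc n) \<in> set_pmf (K a)"
    unfolding AE_all_countable AE_ball_countable[OF A] using null by blast
  moreover have "AE \<omega> in chain_law K x. \<forall>n. \<omega> n \<in> A"
    by (rule AE_chain_law_invariant) (fact inv)+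
  ultimately show ?thesis
    by eventually_elim blast
qed

lemma emeasure_chain_law_Suc:
  "emeasure (chain_law K x) {\<omega>. \<omega> (Suc n) = c} = (\<integral>\<^sup>+\<omega>. ennreal (pmf (K (\<omega> n)) c) \<partial>chain_law K x)"
proof -
  have "emeasure (chain_law K x) {\<omega>. \<omega> (Suc n) \<in> {c}} = (\<integral>\<^sup>+\<omega>. 1 * indicator {c} (\<omega> (Suc n)) \<partial>chain_law K x)"
    unfolding emeasure_chain_law_component by simp
  also have "\<dots> = (\<integral>\<^sup>+\<omega>. 1 * (\<integral>\<^sup>+y. indicator {c} y \<partial>K (\<omega> n)) \<partial>chain_law K x)"
    by (rule nn_integral_chain_law_Suc[where F="\<lambda>_. 1"]) simp
  finally show ?thesis by (simp add: emeasure_pmf_single)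
qed

section \<open>The adelic tree\<close>

context discrete_valuation
begin

lemma val_diff_commute: "v (x - y) = v (y - x)"
  using val_minus[of "x - y"] by simp

lemma val_diff_trans: "c \<le> v (x - y) \<Longrightarrow> c \<le> v (y - z) \<Longrightarrow> c \<le> v (x - z)"
  using val_add[of "x - y" "y - z"] by (simp add: min_def split: if_splits)

lemma val_ring_diff: "x \<in> val_ring v \<Longrightarrow> y \<in> val_ring v \<Longrightarrow> 0 \<le> v (x - y)"
  using val_diff_trans[of 0 x 0 y] by (simp add: val_ring_def val_minus)

lemma val_diff_nat:
  assumes "x \<in> val_ring v" "y \<in> val_ring v" "x \<noteq> y"
  obtains n :: nat where "v (x - y) = ereal (real n)"
proof -
  obtain k :: int where k: "v (x - y) = ereal (of_int k)"
    using val_int[of "x - y"] assms by auto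
  with val_ring_diff[OF assms(1,2)] have "0 \<le> k" by simp
  then have "v (x - y) = ereal (real (nat k))" using k by simp
  then show ?thesis by (rule that)
qed

lemma mem_residue_class: "y \<in> residue_class v h x \<longleftrightarrow> ereal (real h) \<le> v (x - y)"
proof -
  have "y \<in> residue_class v h x \<longleftrightarrow> y - x \<in> max_ideal_pow v h"
    unfolding residue_class_def by (auto simp: image_iff intro: bexI[of _ "y - x"])
  then show ?thesis
    by (simp add: max_ideal_pow_eq val_diff_commute)
qed

text \<open>By the ultrametric inequality \<open>h \<le> v (x - y)\<close> is an equivalence
  relation, so cosets that meet coincide.\<close>

lemma tree_vertex_eq_iff:
  "tree_vertex v h x = tree_vertex v k y \<longleftrightarrow> h = k \<and> ereal (real h) \<le> v (x - y)"
proof -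
  have "residue_class v h x = residue_class v h y \<longleftrightarrow> ereal (real h) \<le> v (x - y)"
  proof
    assume "residue_class v h x = residue_class v h y"
    then show "ereal (real h) \<le> v (x - y)"
      using mem_residue_class[of y h x] mem_residue_class[of y h y] by (simp add: val_zero)
  next
    assume xy: "ereal (real h) \<le> v (x - y)"
    then have yx: "ereal (real h) \<le> v (y - x)" by (simp add: val_diff_commute)
    show "residue_class v h x = residue_class v h y"
      using val_diff_trans[OF xy] val_diff_trans[OF yx] by (auto simp: mem_residue_class)
  qed
  then show ?thesis by (auto simp: tree_vertex_def)
qed

lemma tree_vertex_mono: "tree_vertex v h x = tree_vertex v h y \<Longrightarrow> k \<le> h \<Longrightarrow> tree_vertex v k x = tree_vertex v k y"
  unfolding tree_vertex_eq_iff using order_trans[of "ereal (real k)" "ereal (real h)" "v (x - y)"] by simp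

text \<open>Justifies defining functions of a vertex through an arbitrary element of its coset, as
  \<open>voltage\<close>, \<open>current\<close>, \<open>parent\<close> and \<open>anc\<close>
  do.\<close>

lemma tree_vertex_SOME: "tree_vertex v h (SOME y. y \<in> snd (tree_vertex v h x)) = tree_vertex v h x"
proof -
  have "x \<in> snd (tree_vertex v h x)" by (simp add: tree_vertex_def mem_residue_class val_zero)
  then have "(SOME y. y \<in> snd (tree_vertex v h x)) \<in> snd (tree_vertex v h x)" by (rule someI)
  then show ?thesis
    unfolding tree_vertex_eq_iff by (simp add: tree_vertex_def mem_residue_class val_diff_commute)
qed

lemma tree_vertex_root: "x \<in> val_ring v \<Longrightarrow> tree_vertex v 0 x = tree_root v"
proof -
  assume "x \<in> val_ring v"
  then have "residue_class v 0 x = residue_class v 0 0"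
    using tree_vertex_eq_iff[of 0 x 0 0] by (simp add: tree_vertex_def val_ring_def zero_ereal_def)
  then show ?thesis
    by (simp add: tree_vertex_def tree_root_def residue_class_def)
qed

lemma agree_levels:
  assumes "v (x - y) = ereal (real n)"
  shows "{h\<in>{1..L}. tree_vertex v h x = tree_vertex v h y} = {1..min L n}"
  using assms by (auto simp: tree_vertex_eq_iff)

lemma val_prod: "finite A \<Longrightarrow> v (\<Prod>i\<in>A. f i) = (\<Sum>i\<in>A. v (f i))"
  by (induction A rule: finite_induct) (simp_all add: val_one val_mult)

end

text \<open>With \<open>p\<close> a uniformizer and \<open>z\<close> the chosen representative of
  \<open>x\<close> modulo the maximal ideal, the vertex of \<open>x\<close> at level
  \<open>Suc h\<close> is determined by the residue class of \<open>x\<close> and the vertex of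
  \<open>(x - z) / p\<close> at level \<open>h\<close>. The finite residue field enters
  here.\<close>

lemma (in nonarch_local_field) finite_levels: "finite (tree_vertex v h ` val_ring v)"
proof (induction h)
  case 0
  have "tree_vertex v 0 ` val_ring v \<subseteq> {tree_root v}" using tree_vertex_root by auto
  then show ?case by (rule finite_subset) simp
next
  case (Suc h)
  have "(1::ereal) \<in> ereal ` \<int>" by (metis Ints_1 image_eqI one_ereal_def)
  with val_range obtain p where p: "p \<noteq> 0" "v p = 1" by (metis ComplD imageE insertI1)
  let ?f = "\<lambda>x. (residue_class v 1 x, tree_vertex v h ((x - (SOME y. y \<in> residue_class v 1 x)) / p))"
  have quot: "(x - y) / p \<in> val_ring v" if "x \<in> val_ring v" "y \<in> residue_class v 1 x" for x y
  proof -
    have "1 \<le> v (x - y)" using that(2) by (simp add: mem_residue_class one_ereal_def)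
    also have "v (x - y) = 1 + v ((x - y) / p)" using val_mult[of p "(x - y) / p"] p by simp
    finally show ?thesis unfolding val_ring_def by (cases "v ((x - y) / p)") (auto simp: one_ereal_def)
  qed
  have inr: "(SOME y. y \<in> residue_class v 1 x) \<in> residue_class v 1 x" for x
    by (rule someI[of _ x]) (simp add: mem_residue_class val_zero)
  have "?f ` val_ring v \<subseteq> residue_class v 1 ` val_ring v \<times> tree_vertex v h ` val_ring v"
    using quot inr by auto
  then have fin: "finite (?f ` val_ring v)"
    using Suc.IH finite_residue_field by (meson finite_SigmaI finite_subset)
  have *: "tree_vertex v (Suc h) x = tree_vertex v (Suc h) y" if "?f x = ?f y" for x y
  proof -
    define z where "z = (SOME y. y \<in> residue_class v 1 x)"
    have "tree_vertex v h ((x - z) / p) = tree_vertex v h ((y - z) / p)"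
      unfolding z_def using that by (metis prod.inject)
    then have "ereal (real h) \<le> v ((x - y) / p)"
      by (simp add: tree_vertex_eq_iff diff_divide_distrib[symmetric])
    then have "1 + ereal (real h) \<le> v p + v ((x - y) / p)" using p by (intro add_mono) auto
    also have "\<dots> = v (x - y)" using val_mult[of p "(x - y) / p"] p by simp
    finally show ?thesis by (simp add: tree_vertex_eq_iff one_ereal_def)
  qed
  have "tree_vertex v (Suc h) x = tree_vertex v (Suc h) (inv_into (val_ring v) ?f (?f x))"
    if "x \<in> val_ring v" for x
    by (rule *, rule f_inv_into_f[symmetric], rule imageI, rule that)
  then have "tree_vertex v (Suc h) ` val_ring v
      \<subseteq> (\<lambda>c. tree_vertex v (Suc h) (inv_into (val_ring v) ?f c)) ` ?f ` val_ring v"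
    by blast
  then show ?case using fin by (meson finite_imageI finite_subset)
qed

context discrete_valuation
begin

text \<open>Metric balls and the sets \<open>h \<le> v (x - y)\<close> refine each other, so
  openness can be handled without the metric and its arbitrary base.\<close>

lemma openin_mtopology_iff:
  "openin (Metric_space.mtopology UNIV (val_dist v)) U
    \<longleftrightarrow> (\<forall>x\<in>U. \<exists>h. \<forall>y. ereal (real h) \<le> v (x - y) \<longrightarrow> y \<in> U)"
proof -
  interpret M: Metric_space UNIV "val_dist v" by (rule Metric_space_val_dist)
  have dist: "val_dist v x y < r" if "ereal (real h) \<le> v (x - y)" "2 powr - real h < r" for x y h r
  proof (cases "x = y")
    case True
    have "(0::real) < 2 powr - real h" by simp
    then have "0 < r" using that(2) by linarith
    then show ?thesis using True by (simp add: val_dist_def)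
  next
    case False
    then obtain k :: int where k: "v (x - y) = ereal (of_int k)" using val_int[of "x - y"] by auto
    then have "2 powr - real_of_int k \<le> 2 powr - real h" using that(1) by simp
    moreover have "val_dist v x y = 2 powr - real_of_int k" using False by (simp add: val_dist_def k)
    ultimately show ?thesis using that(2) by linarith
  qed
  have val: "ereal (real h) \<le> v (x - y)" if "val_dist v x y < 2 powr - real h" for x y h
  proof (cases "x = y")
    case False
    then obtain k :: int where k: "v (x - y) = ereal (of_int k)" using val_int[of "x - y"] by auto
    then have "2 powr - real_of_int k < 2 powr - real h" using that False by (simp add: val_dist_def)
    then show ?thesis by (simp add: k)
  qed (simp add: val_zero)
  show ?thesis
    unfolding M.openin_mtopology
  proof safe
    fix x assume "\<forall>x. x \<in> U \<longrightarrow> (\<exists>r>0. M.mball x r \<subseteq> U)" "x \<in> U"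
    then obtain r where r: "0 < r" "M.mball x r \<subseteq> U" by blast
    obtain h :: nat where h: "(1/2) ^ h < r" using real_arch_pow_inv[OF r(1), of "1/2"] by auto
    then have "2 powr - real h < r" by (simp add: powr_minus powr_realpow power_one_over inverse_eq_divide)
    then show "\<exists>h. \<forall>y. ereal (real h) \<le> v (x - y) \<longrightarrow> y \<in> U"
      using dist[of h x _ r] r(2) by (intro exI[of _ h]) auto
  next
    fix x assume "\<forall>x\<in>U. \<exists>h. \<forall>y. ereal (real h) \<le> v (x - y) \<longrightarrow> y \<in> U" "x \<in> U"
    then obtain h :: nat where h: "\<And>y. ereal (real h) \<le> v (x - y) \<Longrightarrow> y \<in> U" by blast
    show "\<exists>r>0. M.mball x r \<subseteq> U"
      using h val[of x _ h] by (intro exI[of _ "2 powr - real h"]) auto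
  qed simp
qed

end

text \<open>Representatives of a branch form a Cauchy sequence, and completeness gives a limit
  \<open>z\<close>. Its vertex at level \<open>n\<close> is the right one because the coset of
  \<open>z\<close> is open and so contains some \<open>x k\<close> with
  \<open>k \<ge> n\<close>.\<close>

lemma (in nonarch_local_field) convergent_branch:
  assumes "\<And>m n. m \<le> n \<Longrightarrow> tree_vertex v m (x n) = tree_vertex v m (x m)"
  obtains z where "\<And>n. tree_vertex v n z = tree_vertex v n (x n)"
proof -
  interpret M: Metric_space UNIV "val_dist v" by (rule Metric_space_val_dist)
  have "M.MCauchy x"
    unfolding M.MCauchy_def
  proof (intro conjI allI impI)
    fix \<epsilon> :: real assume "0 < \<epsilon>"
    then obtain N :: nat where N: "(1/2) ^ N < \<epsilon>" using real_arch_pow_inv[of \<epsilon> "1/2"] by auto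
    have "val_dist v (x n) (x n') < \<epsilon>" if "N \<le> n" "N \<le> n'" for n n'
    proof (cases "x n = x n'")
      case False
      then obtain k :: int where k: "v (x n - x n') = ereal (of_int k)" using val_int[of "x n - x n'"] by auto
      have "tree_vertex v N (x n) = tree_vertex v N (x n')" using assms that by metis
      then have "real N \<le> real_of_int k" by (simp add: tree_vertex_eq_iff k)
      then have "2 powr - real_of_int k \<le> 2 powr - real N" by simp
      also have "\<dots> < \<epsilon>" using N by (simp add: powr_minus powr_realpow power_one_over inverse_eq_divide)
      finally have "2 powr - real_of_int k < \<epsilon>" .
      moreover have "val_dist v (x n) (x n') = 2 powr - real_of_int k" using False by (simp add: val_dist_def k)
      ultimately show ?thesis by linarith
    qed (use \<open>0 < \<epsilon>\<close> in \<open>simp add: val_dist_def\<close>)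
    then show "\<exists>N. \<forall>n n'. N \<le> n \<longrightarrow> N \<le> n' \<longrightarrow> val_dist v (x n) (x n') < \<epsilon>" by blast
  qed simp
  then obtain z where z: "limitin M.mtopology x z sequentially"
    using complete unfolding M.mcomplete_def by blast
  have "tree_vertex v n z = tree_vertex v n (x n)" for n
  proof -
    let ?U = "{y. ereal (real n) \<le> v (z - y)}"
    have "openin M.mtopology ?U"
      unfolding openin_mtopology_iff using val_diff_trans by blast
    moreover have "z \<in> ?U" by (simp add: val_zero)
    ultimately have "\<forall>\<^sub>F k in sequentially. x k \<in> ?U" using z unfolding limitin_def by blast
    then obtain k where "k \<ge> n" "x k \<in> ?U" by (auto simp: eventually_sequentially) (metis nat_le_linear)
    then have "tree_vertex v n z = tree_vertex v n (x k)" by (simp add: tree_vertex_eq_iff)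
    then show ?thesis using assms[OF \<open>k \<ge> n\<close>] by simp
  qed
  then show ?thesis by (rule that)
qed

locale adelic_tree = nonarch_local_field v for v :: "'a::field \<Rightarrow> ereal" +
  fixes S :: "'a set"
  assumes S_subset: "S \<subseteq> val_ring v" and S_infinite: "infinite S"
begin

abbreviation tv :: "nat \<Rightarrow> 'a \<Rightarrow> 'a vertex" where "tv \<equiv> tree_vertex v"
abbreviation ch :: "'a vertex \<Rightarrow> 'a vertex set" where "ch \<equiv> children v S"
abbreviation root :: "'a vertex" where "root \<equiv> tree_root v"

definition level :: "nat \<Rightarrow> 'a vertex set" where "level h = tv h ` S"

lemma S_nonempty: "S \<noteq> {}" using S_infinite by auto

lemma finite_level: "finite (level h)"
  unfolding level_def by (rule finite_subset[OF image_mono[OF S_subset] finite_levels])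

lemma tv_root: "x \<in> S \<Longrightarrow> tv 0 x = root"
  using tree_vertex_root[of x] S_subset by blast

lemma level_0: "level 0 = {root}"
proof -
  have "level 0 = (\<lambda>_. root) ` S"
    unfolding level_def by (intro image_cong refl tv_root)
  then show ?thesis
    using S_nonempty by (simp only: image_constant_conv) simp
qed

lemma children_tv: "x \<in> S \<Longrightarrow> ch (tv h x) = {tv (Suc h) y |y. y \<in> S \<and> tv h y = tv h x}"
proof -
  assume "x \<in> S"
  have "(tv h x, b) \<in> tree_edges v S \<longleftrightarrow> (\<exists>y\<in>S. tv h y = tv h x \<and> b = tv (Suc h) y)" for b
    unfolding tree_edges_def by (auto simp: tree_vertex_def)
  then show ?thesis
    unfolding children_def by (simp only:) blast
qed

lemma level_Suc: "level (Suc h) = (\<Union>b\<in>level h. ch b)"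
proof -
  have "(\<Union>b\<in>level h. ch b) = (\<Union>x\<in>S. {tv (Suc h) y |y. y \<in> S \<and> tv h y = tv h x})"
    unfolding level_def by (simp add: children_tv)
  then show ?thesis
    unfolding level_def by blast
qed

lemma children_subset: "b \<in> level h \<Longrightarrow> ch b \<subseteq> level (Suc h)"
  unfolding level_Suc by blast

lemma finite_children: "b \<in> level h \<Longrightarrow> finite (ch b)"
  by (rule finite_subset[OF children_subset finite_level])

lemma children_nonempty: "b \<in> level h \<Longrightarrow> ch b \<noteq> {}"
  unfolding level_def by (fastforce simp: children_tv)

lemma children_disjoint:
  assumes "b \<in> level h" "b' \<in> level h" "b \<noteq> b'"
  shows "ch b \<inter> ch b' = {}"
proof -
  obtain x x' where x: "x \<in> S" "b = tv h x" "x' \<in> S" "b' = tv h x'"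
    using assms by (auto simp: level_def)
  then have "tv (Suc h) y \<noteq> tv (Suc h) y'" if "tv h y = tv h x" "tv h y' = tv h x'" for y y'
    using that assms tree_vertex_mono[of "Suc h" y y' h] by auto
  then show ?thesis
    using x by (simp add: children_tv) blast
qed

lemma sum_level_Suc: "(\<Sum>c\<in>level (Suc h). f c) = (\<Sum>b\<in>level h. \<Sum>c\<in>ch b. f c)"
  unfolding level_Suc
  by (rule sum.UNION_disjoint) (simp_all add: finite_level finite_children children_disjoint)

subsection \<open>Conductances\<close>

text \<open>\<open>cond d b\<close> is the effective conductance between the parent of \<open>b\<close> and the vertices \<open>d\<close> levels
  below \<open>b\<close>, every edge having conductance 1. For the root, a parent is imagined.\<close>

primrec cond :: "nat \<Rightarrow> 'a vertex \<Rightarrow> real" where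
  "cond 0 b = 1"
| "cond (Suc d) b = (\<Sum>c\<in>ch b. cond d c) / (1 + (\<Sum>c\<in>ch b. cond d c))"

lemma cond_pos: "b \<in> level h \<Longrightarrow> 0 < cond d b"
proof (induction d arbitrary: b h)
  case (Suc d)
  then have "0 < (\<Sum>c\<in>ch b. cond d c)"
    using Suc.IH children_subset[OF Suc.prems] finite_children[OF Suc.prems] children_nonempty[OF Suc.prems]
    by (intro sum_pos) blast+
  then show ?case by simp
qed simp

lemma cond_le_1: "b \<in> level h \<Longrightarrow> cond d b \<le> 1"
proof (cases d)
  case (Suc d)
  assume "b \<in> level h"
  then have "0 \<le> (\<Sum>c\<in>ch b. cond d c)"
    using children_subset[of b h] cond_pos by (intro sum_nonneg) (meson less_imp_le subsetD)
  then show ?thesis using Suc by (simp add: divide_le_eq)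
qed simp

text \<open>Grounding one level deeper cannot raise the conductance. The induction rests on
  monotonicity of \<open>s / (1 + s)\<close>; it makes the limits \<open>cond_inf\<close>
  exist.\<close>

lemma cond_Suc_le: "b \<in> level h \<Longrightarrow> cond (Suc d) b \<le> cond d b"
proof (induction d arbitrary: b h)
  case 0
  then show ?case using cond_le_1[of b h "Suc 0"] by simp
next
  case (Suc d)
  have "(\<Sum>c\<in>ch b. cond (Suc d) c) \<le> (\<Sum>c\<in>ch b. cond d c)"
    using Suc.IH children_subset[OF Suc.prems] by (intro sum_mono) blast
  moreover have "0 \<le> (\<Sum>c\<in>ch b. cond (Suc d) c)"
    using children_subset[OF Suc.prems] cond_pos by (intro sum_nonneg) (meson less_imp_le subsetD)
  ultimately show ?case
    unfolding cond.simps(2)[of "Suc d"] cond.simps(2)[of d b] by (intro divide_1_plus_mono)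
qed

lemma decseq_cond: "b \<in> level h \<Longrightarrow> decseq (\<lambda>d. cond d b)"
  by (rule decseq_SucI) (rule cond_Suc_le)

definition cond_inf :: "'a vertex \<Rightarrow> real" where
  "cond_inf b = lim (\<lambda>d. cond d b)"

lemma cond_LIMSEQ: "b \<in> level h \<Longrightarrow> (\<lambda>d. cond d b) \<longlonglongrightarrow> cond_inf b"
  unfolding cond_inf_def convergent_LIMSEQ_iff[symmetric]
  using decseq_convergent[OF decseq_cond, of b h 0] cond_pos
  by (metis convergentI less_imp_le)

lemma cond_inf_nonneg: "b \<in> level h \<Longrightarrow> 0 \<le> cond_inf b"
  using LIMSEQ_le_const[OF cond_LIMSEQ] cond_pos by (meson less_imp_le)

lemma cond_inf_le: "b \<in> level h \<Longrightarrow> cond_inf b \<le> cond d b"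
  using decseq_ge[OF decseq_cond cond_LIMSEQ] by blast

lemma cond_inf_le_1: "b \<in> level h \<Longrightarrow> cond_inf b \<le> 1"
  using cond_inf_le[of b h 0] by simp

text \<open>The limit \<open>cond_inf b = s / (1 + s)\<close> of the recursion, cleared of its
  denominator. In this form it is the conservation law for \<open>current\<close>: the factor
  \<open>1 - cond_inf b\<close> is the share of the voltage that remains below the edge into
  \<open>b\<close>.\<close>

lemma cond_inf_children:
  assumes b: "b \<in> level h"
  shows "(1 - cond_inf b) * (\<Sum>c\<in>ch b. cond_inf c) = cond_inf b"
proof -
  let ?s = "\<Sum>c\<in>ch b. cond_inf c"
  have s: "0 \<le> ?s"
    using children_subset[OF b] cond_inf_nonneg by (intro sum_nonneg) blast
  have "(\<lambda>d. \<Sum>c\<in>ch b. cond d c) \<longlonglongrightarrow> ?s"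
    using children_subset[OF b] cond_LIMSEQ by (intro tendsto_sum) blast
  then have "(\<lambda>d. cond (Suc d) b) \<longlonglongrightarrow> ?s / (1 + ?s)"
    unfolding cond.simps using s by (intro tendsto_divide tendsto_add tendsto_const) auto
  moreover have "(\<lambda>d. cond (Suc d) b) \<longlonglongrightarrow> cond_inf b"
    using cond_LIMSEQ[OF b] by (rule LIMSEQ_Suc)
  ultimately have "cond_inf b = ?s / (1 + ?s)" by (rule LIMSEQ_unique[symmetric])
  then show ?thesis using s by (simp add: field_simps)
qed

subsection \<open>Flows on the vertices\<close>

text \<open>Flow through the edge into each vertex, the root being fed with one unit.\<close>

definition vertex_flow :: "('a vertex \<Rightarrow> real) \<Rightarrow> bool" where
  "vertex_flow \<theta> \<longleftrightarrow> \<theta> root = 1 \<and> (\<forall>h. \<forall>b\<in>level h. \<theta> b = (\<Sum>c\<in>ch b. \<theta> c))"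

text \<open>The root contributes the energy 1 of the imagined edge, which \<open>energy_SUP\<close>
  subtracts again.\<close>

definition energy_upto :: "nat \<Rightarrow> ('a vertex \<Rightarrow> real) \<Rightarrow> real" where
  "energy_upto L \<theta> = (\<Sum>h\<le>L. \<Sum>b\<in>level h. (\<theta> b)\<^sup>2)"

lemma vertex_flow_children: "vertex_flow \<theta> \<Longrightarrow> b \<in> level h \<Longrightarrow> (\<Sum>c\<in>ch b. \<theta> c) = \<theta> b"
  unfolding vertex_flow_def by metis

lemma sum_level_vertex_flow: "vertex_flow \<theta> \<Longrightarrow> (\<Sum>b\<in>level h. \<theta> b) = 1"
proof (induction h)
  case 0
  then show ?case by (simp add: level_0 vertex_flow_def)
next
  case (Suc h)
  then have "(\<Sum>c\<in>level (Suc h). \<theta> c) = (\<Sum>b\<in>level h. \<theta> b)"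
    unfolding sum_level_Suc vertex_flow_def by (intro sum.cong) auto
  with Suc show ?case by simp
qed

text \<open>The edge into \<open>b\<close> is in series with the parallel branches below it:
  \<open>1 / cond (Suc d) b = 1 + 1 / s\<close>, with \<open>s\<close> the sum of the conductances
  of the children. Cauchy-Schwarz bounds \<open>(\<theta> b)\<^sup>2 / s\<close> however the flow
  divides.\<close>

lemma flow_through_vertex:
  assumes \<theta>: "vertex_flow \<theta>" and b: "b \<in> level h"
  shows "(\<theta> b)\<^sup>2 / cond (Suc d) b \<le> (\<theta> b)\<^sup>2 + (\<Sum>c\<in>ch b. (\<theta> c)\<^sup>2 / cond d c)"
proof -
  let ?s = "\<Sum>c\<in>ch b. cond d c"
  have pos: "0 < cond d c" if "c \<in> ch b" for c
    using that children_subset[OF b] cond_pos by blast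
  have s: "0 < ?s"
    using pos finite_children[OF b] children_nonempty[OF b] by (intro sum_pos) auto
  have "\<theta> b = (\<Sum>c\<in>ch b. \<theta> c)"
    using \<theta> b unfolding vertex_flow_def by blast
  also have "\<dots> = (\<Sum>c\<in>ch b. (\<theta> c / sqrt (cond d c)) * sqrt (cond d c))"
    using pos by (intro sum.cong) (auto dest!: less_imp_neq[OF pos])
  finally have "\<theta> b = (\<Sum>c\<in>ch b. (\<theta> c / sqrt (cond d c)) * sqrt (cond d c))" .
  then have "(\<theta> b)\<^sup>2 \<le> (\<Sum>c\<in>ch b. (\<theta> c / sqrt (cond d c))\<^sup>2) * (\<Sum>c\<in>ch b. (sqrt (cond d c))\<^sup>2)"
    using Cauchy_Schwarz_ineq_sum[of "\<lambda>c. \<theta> c / sqrt (cond d c)" "\<lambda>c. sqrt (cond d c)" "ch b"] by simp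
  also have "\<dots> = (\<Sum>c\<in>ch b. (\<theta> c)\<^sup>2 / cond d c) * ?s"
    using pos by (intro arg_cong2[where f="(*)"] sum.cong) (auto simp: power_divide dest: less_imp_le)
  finally have "(\<theta> b)\<^sup>2 / ?s \<le> (\<Sum>c\<in>ch b. (\<theta> c)\<^sup>2 / cond d c)"
    using s by (simp add: divide_le_eq)
  moreover have "(\<theta> b)\<^sup>2 / cond (Suc d) b = (\<theta> b)\<^sup>2 + (\<theta> b)\<^sup>2 / ?s"
    using s by (simp add: field_simps)
  ultimately show ?thesis by simp
qed

text \<open>Thomson's principle, \<open>1 / cond L root\<close> being the effective resistance down
  to level \<open>L\<close>. Each application of \<open>flow_through_vertex\<close> trades one level
  of \<open>cond\<close> for one level of actual energy.\<close>

lemma energy_upto_ge: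
  assumes "vertex_flow \<theta>"
  shows "1 / cond L root \<le> energy_upto L \<theta>"
proof -
  have main: "(\<Sum>b\<in>level l. (\<theta> b)\<^sup>2 / cond d b) \<le> (\<Sum>h=l..l+d. \<Sum>b\<in>level h. (\<theta> b)\<^sup>2)" for l d
  proof (induction d arbitrary: l)
    case (Suc d)
    have "(\<Sum>b\<in>level l. (\<theta> b)\<^sup>2 / cond (Suc d) b)
        \<le> (\<Sum>b\<in>level l. (\<theta> b)\<^sup>2 + (\<Sum>c\<in>ch b. (\<theta> c)\<^sup>2 / cond d c))"
      using flow_through_vertex[OF assms] by (rule sum_mono)
    also have "\<dots> = (\<Sum>b\<in>level l. (\<theta> b)\<^sup>2) + (\<Sum>c\<in>level (Suc l). (\<theta> c)\<^sup>2 / cond d c)"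
      by (simp only: sum.distrib sum_level_Suc)
    also have "\<dots> \<le> (\<Sum>b\<in>level l. (\<theta> b)\<^sup>2) + (\<Sum>h=Suc l..l+Suc d. \<Sum>b\<in>level h. (\<theta> b)\<^sup>2)"
      using Suc[of "Suc l"] by simp
    also have "\<dots> = (\<Sum>h=l..l+Suc d. \<Sum>b\<in>level h. (\<theta> b)\<^sup>2)"
      by (subst sum.atLeast_Suc_atMost[of l]) simp_all
    finally show ?case .
  qed simp
  have "(\<Sum>b\<in>level 0. (\<theta> b)\<^sup>2 / cond L b) = 1 / cond L root"
    using assms by (simp add: level_0 vertex_flow_def)
  moreover have "(\<Sum>h=0..0+L. \<Sum>b\<in>level h. (\<theta> b)\<^sup>2) = energy_upto L \<theta>"
    by (simp add: energy_upto_def atLeast0AtMost)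
  ultimately show ?thesis
    using main[of L 0] by linarith
qed

text \<open>By the parallelogram identity for the energy.\<close>

lemma vertex_flow_close:
  assumes \<theta>: "vertex_flow \<theta>" "vertex_flow \<eta>" and b: "b \<in> level h" "h \<le> L"
  shows "(\<theta> b - \<eta> b)\<^sup>2 \<le> 2 * energy_upto L \<theta> + 2 * energy_upto L \<eta> - 4 / cond L root"
proof -
  have "vertex_flow (\<lambda>b. (\<theta> b + \<eta> b) / 2)"
    using \<theta> unfolding vertex_flow_def by (auto simp: sum.distrib sum_divide_distrib[symmetric])
  from energy_upto_ge[OF this, of L]
  have "4 / cond L root \<le> 4 * energy_upto L (\<lambda>b. (\<theta> b + \<eta> b) / 2)" by simp
  also have "\<dots> = (\<Sum>h\<le>L. \<Sum>b\<in>level h. (\<theta> b + \<eta> b)\<^sup>2)"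
    by (simp add: energy_upto_def sum_distrib_left power_divide)
  finally have 1: "4 / cond L root \<le> (\<Sum>h\<le>L. \<Sum>b\<in>level h. (\<theta> b + \<eta> b)\<^sup>2)" .
  have "(\<theta> b - \<eta> b)\<^sup>2 \<le> (\<Sum>b\<in>level h. (\<theta> b - \<eta> b)\<^sup>2)"
    using b finite_level by (intro member_le_sum) auto
  also have "\<dots> \<le> (\<Sum>h\<le>L. \<Sum>b\<in>level h. (\<theta> b - \<eta> b)\<^sup>2)"
    using b by (intro member_le_sum[of h "{..L}" "\<lambda>h. \<Sum>b\<in>level h. (\<theta> b - \<eta> b)\<^sup>2"]) (auto intro: sum_nonneg)
  also have "\<dots> = 2 * energy_upto L \<theta> + 2 * energy_upto L \<eta> - (\<Sum>h\<le>L. \<Sum>b\<in>level h. (\<theta> b + \<eta> b)\<^sup>2)"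
    by (simp add: energy_upto_def sum_distrib_left sum.distrib[symmetric] sum_subtractf[symmetric] power2_eq_square
        algebra_simps)
  finally show ?thesis using 1 by simp
qed

subsection \<open>The flow of minimal energy\<close>

abbreviation k0 :: real where "k0 \<equiv> cond_inf root"

text \<open>The current and the voltage of the infinite network when a unit current enters at the parent
  of the root and the boundary is grounded.\<close>

definition voltage :: "'a vertex \<Rightarrow> real" where
  "voltage b = (\<Prod>i\<le>fst b. 1 - cond_inf (tv i (SOME x. x \<in> snd b))) / k0"

text \<open>Ohm's law: the voltage of the parent, \<open>1 / k0\<close> for the imagined one, times
  the conductance into \<open>b\<close>. Each edge on the way multiplies the voltage by
  \<open>1 - cond_inf\<close>, whence the product.\<close>

definition current :: "'a vertex \<Rightarrow> real" where
  "current b = (\<Prod>i<fst b. 1 - cond_inf (tv i (SOME x. x \<in> snd b))) / k0 * cond_inf b"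

lemma prod_tv_SOME:
  assumes "\<And>i. i \<in> A \<Longrightarrow> i \<le> h"
  shows "(\<Prod>i\<in>A. f (tv i (SOME y. y \<in> snd (tv h x)))) = (\<Prod>i\<in>A. f (tv i x))"
proof (rule prod.cong)
  fix i assume "i \<in> A"
  then have "tv i (SOME y. y \<in> snd (tv h x)) = tv i x"
    using assms tree_vertex_mono[OF tree_vertex_SOME, of i h x] by simp
  then show "f (tv i (SOME y. y \<in> snd (tv h x))) = f (tv i x)" by simp
qed simp

lemma fst_tv [simp]: "fst (tv h x) = h"
  by (simp add: tree_vertex_def)

lemma voltage_tv: "voltage (tv h x) = (\<Prod>i\<le>h. 1 - cond_inf (tv i x)) / k0"
  unfolding voltage_def fst_tv by (subst prod_tv_SOME[where f="\<lambda>b. 1 - cond_inf b"]) auto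

lemma current_tv: "current (tv h x) = (\<Prod>i<h. 1 - cond_inf (tv i x)) / k0 * cond_inf (tv h x)"
  unfolding current_def fst_tv by (subst prod_tv_SOME[where f="\<lambda>b. 1 - cond_inf b"]) auto

lemma current_Suc: "current (tv (Suc h) x) = voltage (tv h x) * cond_inf (tv (Suc h) x)"
  by (simp add: current_tv voltage_tv lessThan_Suc_atMost)

lemma voltage_Suc: "voltage (tv (Suc h) x) = voltage (tv h x) * (1 - cond_inf (tv (Suc h) x))"
  by (simp add: voltage_tv)

lemma tv_in_level: "x \<in> S \<Longrightarrow> tv h x \<in> level h"
  by (simp add: level_def)

lemma level_childE:
  assumes "b \<in> level h" "c \<in> ch b"
  obtains x where "x \<in> S" "b = tv h x" "c = tv (Suc h) x"
proof -
  obtain y where "y \<in> S" "b = tv h y" using assms by (auto simp: level_def)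
  then show ?thesis using assms that by (auto simp: children_tv)
qed

lemma current_child: "b \<in> level h \<Longrightarrow> c \<in> ch b \<Longrightarrow> current c = voltage b * cond_inf c"
  by (metis level_childE current_Suc)

lemma voltage_child:
  assumes "b \<in> level h" "c \<in> ch b"
  shows "voltage c = voltage b - current c"
proof -
  have "voltage c = voltage b * (1 - cond_inf c)" using assms by (metis level_childE voltage_Suc)
  then show ?thesis using current_child[OF assms] by (simp add: algebra_simps)
qed

text \<open>On an edge of conductance 1 the current equals the drop of the voltage, so the sum
  telescopes from the value \<open>1 / k0\<close> at the imagined parent.\<close>

lemma sum_current:
  assumes "x \<in> S" "0 < k0"
  shows "(\<Sum>i\<le>h. current (tv i x)) = 1 / k0 - voltage (tv h x)"
proof (induction h)
  case 0
  have "current (tv 0 x) + voltage (tv 0 x) = 1 / k0"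
    using current_tv[of 0 x] voltage_tv[of 0 x] assms(2) tv_root[OF assms(1)]
    by (simp add: diff_divide_distrib)
  then show ?case by simp
next
  case (Suc h)
  then show ?case by (simp add: current_Suc voltage_Suc algebra_simps)
qed

lemma current_root:
  assumes "0 < k0"
  shows "current root = 1"
proof -
  obtain x where "x \<in> S" using S_nonempty by blast
  then show ?thesis
    using current_tv[of 0 x] assms by (simp add: tv_root)
qed

lemma voltage_root:
  assumes "0 < k0"
  shows "voltage root = 1 / k0 - 1"
proof -
  obtain x where "x \<in> S" using S_nonempty by blast
  then show ?thesis
    using sum_current[of x 0] assms by (simp add: tv_root current_root)
qed

lemma prod_cond_nonneg: "x \<in> S \<Longrightarrow> 0 \<le> (\<Prod>i\<in>A. 1 - cond_inf (tv i x))"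
  using cond_inf_le_1[OF tv_in_level] by (intro prod_nonneg) simp

lemma voltage_nonneg: "b \<in> level h \<Longrightarrow> 0 \<le> voltage b"
  unfolding level_def using prod_cond_nonneg cond_inf_nonneg[of root 0]
  by (auto simp: voltage_tv level_0)

lemma current_nonneg: "b \<in> level h \<Longrightarrow> 0 \<le> current b"
  unfolding level_def using prod_cond_nonneg cond_inf_nonneg[of root 0] cond_inf_nonneg[OF tv_in_level]
  by (auto simp: current_tv level_0 simp del: times_divide_eq_left)

lemma voltage_cond_inf:
  assumes "b \<in> level h" "0 < k0"
  shows "voltage b * (\<Sum>c\<in>ch b. cond_inf c) = current b"
proof -
  obtain x where x: "x \<in> S" "b = tv h x" using assms by (auto simp: level_def)
  have "voltage b = (\<Prod>i<h. 1 - cond_inf (tv i x)) / k0 * (1 - cond_inf b)"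
    unfolding x(2) voltage_tv by (simp add: lessThan_Suc_atMost[symmetric])
  then have "voltage b * (\<Sum>c\<in>ch b. cond_inf c)
      = (\<Prod>i<h. 1 - cond_inf (tv i x)) / k0 * ((1 - cond_inf b) * (\<Sum>c\<in>ch b. cond_inf c))"
    by (simp only: mult.assoc)
  also have "\<dots> = current b"
    unfolding cond_inf_children[OF assms(1)] unfolding x(2) current_tv ..
  finally show ?thesis .
qed

lemma vertex_flow_current: "0 < k0 \<Longrightarrow> vertex_flow current"
  unfolding vertex_flow_def
  by (auto simp: current_root current_child voltage_cond_inf[symmetric] sum_distrib_left)

text \<open>Conservation of power: \<open>1 / k0\<close> is fed in, and the sum is what is not yet
  dissipated at level \<open>L\<close>. The step combines
  \<open>current c = voltage b - voltage c\<close> on each edge with conservation at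
  \<open>b\<close>.\<close>

lemma energy_upto_current:
  assumes "0 < k0"
  shows "energy_upto L current = 1 / k0 - (\<Sum>b\<in>level L. current b * voltage b)"
proof (induction L)
  case 0
  then show ?case
    using assms by (simp add: energy_upto_def level_0 current_root voltage_root)
next
  case (Suc L)
  have "(\<Sum>c\<in>level (Suc L). (current c)\<^sup>2) + (\<Sum>c\<in>level (Suc L). current c * voltage c)
      = (\<Sum>b\<in>level L. \<Sum>c\<in>ch b. current c * voltage b)"
    unfolding sum_level_Suc sum.distrib[symmetric]
    by (intro sum.cong refl) (simp add: voltage_child power2_eq_square algebra_simps)
  also have "\<dots> = (\<Sum>b\<in>level L. current b * voltage b)"
    unfolding sum_distrib_right[symmetric]
    using vertex_flow_current[OF assms] by (intro sum.cong refl) (simp add: vertex_flow_def)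
  finally show ?case using Suc by (simp add: energy_upto_def)
qed

lemma energy_upto_current_le: "0 < k0 \<Longrightarrow> energy_upto L current \<le> 1 / k0"
  using energy_upto_current[of L] sum_nonneg[of "level L" "\<lambda>b. current b * voltage b"]
    current_nonneg voltage_nonneg by (simp add: mult_nonneg_nonneg)

lemma root_level: "root \<in> level 0" by (simp add: level_0)

lemma inverse_cond_root_LIMSEQ: "0 < k0 \<Longrightarrow> (\<lambda>L. 1 / cond L root) \<longlonglongrightarrow> 1 / k0"
  using cond_LIMSEQ[OF root_level] by (intro tendsto_divide) auto

text \<open>Thomson's principle gives the lower bound, and nonnegativity of the undissipated power
  the upper one.\<close>

lemma energy_upto_current_LIMSEQ:
  assumes "0 < k0"
  shows "(\<lambda>L. energy_upto L current) \<longlonglongrightarrow> 1 / k0"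
  by (rule tendsto_sandwich[OF _ _ inverse_cond_root_LIMSEQ[OF assms] tendsto_const])
    (auto intro!: always_eventually energy_upto_ge vertex_flow_current energy_upto_current_le assms)

text \<open>Quantitative uniqueness of the minimizer. It is used with \<open>\<epsilon> = 0\<close>
  for the minimal flow and with \<open>\<epsilon> = L / N\<close> for visit frequencies.\<close>

lemma vertex_flow_close_current:
  assumes "0 < k0" "vertex_flow \<theta>" "b \<in> level h" "h \<le> L" "energy_upto L \<theta> \<le> 1 / k0 + \<epsilon>"
  shows "(\<theta> b - current b)\<^sup>2 \<le> 4 * (1 / k0 - 1 / cond L root) + 2 * \<epsilon>"
  using vertex_flow_close[OF assms(2) vertex_flow_current[OF assms(1)] assms(3,4)]
    energy_upto_current_le[OF assms(1), of L] assms(5) by argo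

lemma vertex_flow_eq_current:
  assumes k0: "0 < k0" and \<theta>: "vertex_flow \<theta>" and b: "b \<in> level h"
    and le: "\<And>L. energy_upto L \<theta> \<le> 1 / k0"
  shows "\<theta> b = current b"
proof -
  have "(\<lambda>L. 4 * (1 / k0 - 1 / cond L root) + 2 * 0) \<longlonglongrightarrow> 4 * (1 / k0 - 1 / k0) + 2 * 0"
    by (intro tendsto_intros inverse_cond_root_LIMSEQ k0)
  moreover have "\<forall>\<^sub>F L in sequentially. (\<theta> b - current b)\<^sup>2 \<le> 4 * (1 / k0 - 1 / cond L root) + 2 * 0"
    using vertex_flow_close_current[OF k0 \<theta> b, of _ 0] le
    by (auto simp: eventually_sequentially intro!: exI[of _ h])
  ultimately have "(\<theta> b - current b)\<^sup>2 \<le> 4 * (1 / k0 - 1 / k0) + 2 * 0"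
    by (rule tendsto_lowerbound) simp
  then show ?thesis by simp
qed

section \<open>Translation between flows on edges and flows on vertices\<close>

definition parent :: "'a vertex \<Rightarrow> 'a vertex" where
  "parent b = tv (fst b - 1) (SOME x. x \<in> snd b)"

lemma parent_tv: "parent (tv (Suc h) x) = tv h x"
  unfolding parent_def using tree_vertex_mono[OF tree_vertex_SOME, of h "Suc h" x] by simp

lemma parent_child: "b \<in> level h \<Longrightarrow> c \<in> ch b \<Longrightarrow> parent c = b"
  by (metis level_childE parent_tv)

lemma child_iff_edge: "c \<in> ch b \<longleftrightarrow> (b, c) \<in> tree_edges v S"
  by (simp add: children_def)

lemma tree_edges_eq: "tree_edges v S = (\<Union>h. (\<lambda>b. (parent b, b)) ` level (Suc h))"
  unfolding tree_edges_def level_def by (auto simp: parent_tv image_iff; blast)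

text \<open>A finite exhaustion of the edges, which turns the unordered sum in \<open>energy\<close>
  into a supremum over \<open>L\<close>.\<close>

definition edges_upto :: "nat \<Rightarrow> ('a vertex \<times> 'a vertex) set" where
  "edges_upto L = (\<Union>h<L. (\<lambda>b. (parent b, b)) ` level (Suc h))"

lemma finite_edges_upto: "finite (edges_upto L)"
  unfolding edges_upto_def by (intro finite_UN_I finite_imageI finite_level) simp

lemma edges_upto_subset: "edges_upto L \<subseteq> tree_edges v S"
  unfolding edges_upto_def tree_edges_eq by auto

lemma finite_subset_edges_upto:
  assumes "finite F" "F \<subseteq> tree_edges v S"
  shows "\<exists>L. F \<subseteq> edges_upto L"
  using assms
proof (induction F)
  case (insert e F)
  then obtain L where L: "F \<subseteq> edges_upto L" by auto
  obtain h where "e \<in> (\<lambda>b. (parent b, b)) ` level (Suc h)" using insert.prems by (auto simp: tree_edges_eq)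
  then have "e \<in> edges_upto (max L (Suc h))" unfolding edges_upto_def by (meson UN_I lessThan_iff less_max_iff_disj lessI)
  moreover have "edges_upto L \<subseteq> edges_upto (max L (Suc h))"
    unfolding edges_upto_def by (intro UN_mono) auto
  ultimately show ?case using L by blast
qed simp

lemma countable_edges: "countable (tree_edges v S)"
  unfolding tree_edges_eq by (intro countable_UN countableI_type countable_finite[OF finite_imageI[OF finite_level]])

definition flow_at :: "('a vertex \<times> 'a vertex \<Rightarrow> real) \<Rightarrow> 'a vertex \<Rightarrow> real" where
  "flow_at \<theta> b = (if b = root then 1 else \<theta> (parent b, b))"

lemma level_inj: "b \<in> level h \<Longrightarrow> b \<in> level k \<Longrightarrow> h = k"
  unfolding level_def by (auto simp: tree_vertex_eq_iff)

lemma level_Suc_not_root: "b \<in> level (Suc h) \<Longrightarrow> b \<noteq> root"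
  using level_inj[OF root_level, of "Suc h"] by auto

lemma level_fst: "b \<in> level h \<Longrightarrow> fst b = h"
  unfolding level_def by auto

lemma energy_upto_flow_at: "energy_upto L (flow_at \<theta>) = 1 + (\<Sum>e\<in>edges_upto L. (\<theta> e)\<^sup>2)"
proof -
  have "(\<Sum>e\<in>edges_upto L. (\<theta> e)\<^sup>2) = (\<Sum>h<L. \<Sum>e\<in>(\<lambda>b. (parent b, b)) ` level (Suc h). (\<theta> e)\<^sup>2)"
    unfolding edges_upto_def
  proof (intro sum.UNION_disjoint ballI impI finite_imageI finite_level)
    show "(\<lambda>b. (parent b, b)) ` level (Suc h) \<inter> (\<lambda>b. (parent b, b)) ` level (Suc k) = {}" if "h \<noteq> k" for h k
      using that level_inj[of _ "Suc h" "Suc k"] by auto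
  qed simp
  also have "\<dots> = (\<Sum>h<L. \<Sum>b\<in>level (Suc h). (flow_at \<theta> b)\<^sup>2)"
    using level_Suc_not_root
    by (intro sum.cong refl, subst sum.reindex) (auto simp: inj_on_def flow_at_def intro!: sum.cong)
  finally show ?thesis
    by (simp add: energy_upto_def sum.atMost_shift level_0 flow_at_def)
qed

lemma vertex_flow_at:
  assumes "unit_flow v S \<theta>"
  shows "vertex_flow (flow_at \<theta>)"
  unfolding vertex_flow_def
proof (intro conjI allI ballI)
  fix h b assume b: "b \<in> level h"
  have ch: "(\<Sum>c\<in>ch b. flow_at \<theta> c) = (\<Sum>c\<in>ch b. \<theta> (b, c))"
  proof (rule sum.cong)
    fix c assume c: "c \<in> ch b"
    then have "c \<noteq> root" using children_subset[OF b] level_Suc_not_root[of c h] by blast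
    then show "flow_at \<theta> c = \<theta> (b, c)" using parent_child[OF b c] by (simp add: flow_at_def)
  qed simp
  show "flow_at \<theta> b = (\<Sum>c\<in>ch b. flow_at \<theta> c)"
  proof (cases h)
    case 0
    then show ?thesis
      using assms b ch unfolding unit_flow_def by (simp add: level_0 flow_at_def)
  next
    case (Suc k)
    then have "(parent b, b) \<in> tree_edges v S" using b unfolding tree_edges_eq by blast
    then show ?thesis
      using assms b ch level_Suc_not_root[of b k] Suc unfolding unit_flow_def by (auto simp: flow_at_def)
  qed
qed (simp add: flow_at_def)

text \<open>Restricted because \<open>unit_flow\<close> asks for an extensional function; agreement
  on the edges is then equality, as the definite description in \<open>min_energy_flow\<close>
  requires.\<close>

definition current_edges :: "'a vertex \<times> 'a vertex \<Rightarrow> real" where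
  "current_edges = restrict (\<lambda>e. current (snd e)) (tree_edges v S)"

lemma unit_flow_current:
  assumes "0 < k0"
  shows "unit_flow v S current_edges"
  unfolding unit_flow_def
proof (intro conjI ballI)
  show "current_edges \<in> tree_edges v S \<rightarrow>\<^sub>E {0..}"
  proof -
    have "0 \<le> current (snd e)" if "e \<in> tree_edges v S" for e
    proof -
      from that obtain h b where "b \<in> level (Suc h)" "e = (parent b, b)" unfolding tree_edges_eq by blast
      then show ?thesis using current_nonneg[of b "Suc h"] by simp
    qed
    then show ?thesis unfolding current_edges_def by (simp add: PiE_iff)
  qed
  have sum: "(\<Sum>c\<in>ch b. current_edges (b, c)) = current b" if "b \<in> level h" for b h
  proof -
    have "(\<Sum>c\<in>ch b. current_edges (b, c)) = (\<Sum>c\<in>ch b. current c)"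
      by (intro sum.cong refl) (simp add: current_edges_def child_iff_edge)
    then show ?thesis
      using that vertex_flow_current[OF assms] by (simp add: vertex_flow_def)
  qed
  show "case e of (a, b) \<Rightarrow> current_edges (a, b) = (\<Sum>c\<in>ch b. current_edges (b, c))"
    if e: "e \<in> tree_edges v S" for e
  proof -
    obtain a b where ab: "e = (a, b)" by (rule prod.exhaust)
    with e obtain h where "b \<in> level (Suc h)" unfolding tree_edges_eq by blast
    from sum[OF this] show ?thesis using e ab by (simp add: current_edges_def)
  qed
  show "(\<Sum>b\<in>ch root. current_edges (root, b)) = 1"
    using sum[OF root_level] current_root[OF assms] by simp
qed

lemma flow_at_current_edges: "0 < k0 \<Longrightarrow> b \<in> level h \<Longrightarrow> flow_at current_edges b = current b"
proof (cases h)
  case (Suc k)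
  assume "b \<in> level h"
  then have "(parent b, b) \<in> tree_edges v S" using Suc unfolding tree_edges_eq by blast
  then show ?thesis
    using \<open>b \<in> level h\<close> Suc level_Suc_not_root[of b k] by (simp add: flow_at_def current_edges_def)
qed (auto simp: level_0 flow_at_def current_root)

lemma energy_upto_cong: "(\<And>h b. b \<in> level h \<Longrightarrow> \<theta> b = \<theta>' b) \<Longrightarrow> energy_upto L \<theta> = energy_upto L \<theta>'"
  by (simp add: energy_upto_def)

lemma energy_SUP:
  "energy v S \<theta> = (SUP L. ennreal (energy_upto L (flow_at \<theta>) - 1))"
proof -
  have *: "(\<Sum>e\<in>F. ennreal ((\<theta> e)\<^sup>2)) = ennreal (\<Sum>e\<in>F. (\<theta> e)\<^sup>2)" for F
    by (rule sum_ennreal) simp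
  have "energy v S \<theta> = (SUP F\<in>{F. finite F \<and> F \<subseteq> tree_edges v S}. ennreal (\<Sum>e\<in>F. (\<theta> e)\<^sup>2))"
    unfolding energy_def by (subst nonneg_infsum_complete) (simp_all add: *)
  also have "\<dots> = (SUP L. ennreal (\<Sum>e\<in>edges_upto L. (\<theta> e)\<^sup>2))"
  proof (rule antisym)
    show "(SUP F\<in>{F. finite F \<and> F \<subseteq> tree_edges v S}. ennreal (\<Sum>e\<in>F. (\<theta> e)\<^sup>2))
        \<le> (SUP L. ennreal (\<Sum>e\<in>edges_upto L. (\<theta> e)\<^sup>2))"
    proof (rule SUP_mono)
      fix F assume "F \<in> {F. finite F \<and> F \<subseteq> tree_edges v S}"
      then obtain L where "F \<subseteq> edges_upto L" using finite_subset_edges_upto[of F] by blast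
      then have "(\<Sum>e\<in>F. (\<theta> e)\<^sup>2) \<le> (\<Sum>e\<in>edges_upto L. (\<theta> e)\<^sup>2)"
        using finite_edges_upto by (intro sum_mono2) auto
      then show "\<exists>L\<in>UNIV. ennreal (\<Sum>e\<in>F. (\<theta> e)\<^sup>2) \<le> ennreal (\<Sum>e\<in>edges_upto L. (\<theta> e)\<^sup>2)"
        by (auto intro: ennreal_leI)
    qed
    show "(SUP L. ennreal (\<Sum>e\<in>edges_upto L. (\<theta> e)\<^sup>2))
        \<le> (SUP F\<in>{F. finite F \<and> F \<subseteq> tree_edges v S}. ennreal (\<Sum>e\<in>F. (\<theta> e)\<^sup>2))"
      using finite_edges_upto edges_upto_subset by (intro SUP_least SUP_upper) auto
  qed
  finally show ?thesis by (simp add: energy_upto_flow_at)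
qed

lemma k0_le_1: "k0 \<le> 1"
  by (rule cond_inf_le_1[OF root_level])

lemma energy_current: "0 < k0 \<Longrightarrow> energy v S current_edges = ennreal (1 / k0 - 1)"
proof -
  assume k0: "0 < k0"
  have "energy_upto L (flow_at current_edges) = energy_upto L current" for L
    using flow_at_current_edges[OF k0] by (rule energy_upto_cong)
  then have "energy v S current_edges = (SUP L. ennreal (energy_upto L current - 1))"
    by (simp add: energy_SUP)
  also have "\<dots> = ennreal (1 / k0 - 1)"
  proof (rule LIMSEQ_unique[OF LIMSEQ_SUP])
    show "incseq (\<lambda>L. ennreal (energy_upto L current - 1))"
      by (rule incseq_SucI) (auto simp: energy_upto_def intro!: ennreal_leI sum_nonneg)
    show "(\<lambda>L. ennreal (energy_upto L current - 1)) \<longlonglongrightarrow> ennreal (1 / k0 - 1)"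
      using energy_upto_current_LIMSEQ[OF k0] by (intro tendsto_ennrealI tendsto_diff tendsto_const)
  qed
  finally show ?thesis .
qed

lemma energy_ge:
  assumes "0 < k0" "unit_flow v S \<theta>"
  shows "ennreal (1 / k0 - 1) \<le> energy v S \<theta>"
proof (rule LIMSEQ_le_const2)
  show "(\<lambda>L. ennreal (1 / cond L root - 1)) \<longlonglongrightarrow> ennreal (1 / k0 - 1)"
    using inverse_cond_root_LIMSEQ[OF assms(1)] by (intro tendsto_ennrealI tendsto_diff tendsto_const)
  have "ennreal (1 / cond L root - 1) \<le> energy v S \<theta>" for L
    unfolding energy_SUP using energy_upto_ge[OF vertex_flow_at[OF assms(2)], of L]
    by (intro SUP_upper2[of L]) (auto intro!: ennreal_leI)
  then show "\<exists>N. \<forall>L\<ge>N. ennreal (1 / cond L root - 1) \<le> energy v S \<theta>" by blast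
qed

text \<open>Minimality is \<open>energy_ge\<close>. A second minimizer has no more energy than the
  current, so its truncated energies are at most \<open>1 / k0\<close>, and
  \<open>vertex_flow_eq_current\<close> identifies it.\<close>

lemma min_energy_flow_eq:
  assumes k0: "0 < k0"
  shows "min_energy_flow v S = current_edges"
  unfolding min_energy_flow_def
proof (rule the_equality)
  show "unit_flow v S current_edges \<and> energy v S current_edges < \<infinity>
      \<and> (\<forall>\<theta>. unit_flow v S \<theta> \<longrightarrow> energy v S current_edges \<le> energy v S \<theta>)"
    using unit_flow_current[OF k0] energy_ge[OF k0] by (simp add: energy_current[OF k0])
next
  fix \<eta> assume \<eta>: "unit_flow v S \<eta> \<and> energy v S \<eta> < \<infinity>
      \<and> (\<forall>\<theta>. unit_flow v S \<theta> \<longrightarrow> energy v S \<eta> \<le> energy v S \<theta>)"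
  then have "energy v S \<eta> \<le> ennreal (1 / k0 - 1)"
    using unit_flow_current[OF k0] energy_current[OF k0] by metis
  then have "ennreal (energy_upto L (flow_at \<eta>) - 1) \<le> ennreal (1 / k0 - 1)" for L
    unfolding energy_SUP by (rule order_trans[OF SUP_upper, rotated]) simp
  then have "energy_upto L (flow_at \<eta>) \<le> 1 / k0" for L
    using k0 k0_le_1 by (subst (asm) ennreal_le_iff) (auto simp: field_simps)
  then have eq: "flow_at \<eta> b = current b" if "b \<in> level h" for b h
    using vertex_flow_eq_current[OF k0 vertex_flow_at that] \<eta> by blast
  show "\<eta> = current_edges"
  proof
    fix e show "\<eta> e = current_edges e"
    proof (cases "e \<in> tree_edges v S")
      case True
      then obtain h b where "b \<in> level (Suc h)" "e = (parent b, b)" unfolding tree_edges_eq by blast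
      then show ?thesis
        using eq[of b "Suc h"] level_Suc_not_root[of b h] True by (auto simp: flow_at_def current_edges_def)
    next
      case False
      moreover have "\<eta> \<in> tree_edges v S \<rightarrow>\<^sub>E {0..}" using \<eta> by (simp add: unit_flow_def)
      ultimately show ?thesis
        using PiE_arb[of \<eta> "tree_edges v S"] by (simp add: current_edges_def)
    qed
  qed
qed

subsection \<open>The random walk\<close>

abbreviation walk_kernel :: "'a vertex \<Rightarrow> 'a vertex pmf" where
  "walk_kernel b \<equiv> pmf_of_set (neighbours v S b)"

lemma walk_law_eq: "walk_law v S = chain_law walk_kernel root"
proof -
  have "walk_step v S = chain_step walk_kernel root"
    by (intro ext) (simp add: walk_step_def chain_step_def split: nat.split)
  then show ?thesis by (simp add: walk_law_def chain_law_def)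
qed

lemma edge_to: "(a, c) \<in> tree_edges v S \<longleftrightarrow> (\<exists>h. c \<in> level (Suc h)) \<and> a = parent c"
  unfolding tree_edges_eq by blast

lemma neighbours_root: "neighbours v S root = ch root"
  using level_Suc_not_root[of root] by (auto simp: neighbours_def child_iff_edge edge_to)

lemma neighbours_level_Suc: "b \<in> level (Suc h) \<Longrightarrow> neighbours v S b = insert (parent b) (ch b)"
  by (auto simp: neighbours_def child_iff_edge edge_to)

lemma parent_level: "b \<in> level (Suc h) \<Longrightarrow> parent b \<in> level h"
  unfolding level_def using parent_tv by auto

lemma parent_notin_children: "b \<in> level (Suc h) \<Longrightarrow> parent b \<notin> ch b"
  using children_subset[of b "Suc h"] parent_level[of b h] level_inj[of "parent b" h "Suc (Suc h)"] by auto

definition vertices :: "'a vertex set" where "vertices = (\<Union>h. level h)"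

lemma finite_neighbours: "b \<in> vertices \<Longrightarrow> finite (neighbours v S b)"
  and neighbours_nonempty: "b \<in> vertices \<Longrightarrow> neighbours v S b \<noteq> {}"
  and neighbours_subset: "b \<in> vertices \<Longrightarrow> neighbours v S b \<subseteq> vertices"
proof -
  have "finite (neighbours v S b) \<and> neighbours v S b \<noteq> {} \<and> neighbours v S b \<subseteq> vertices"
    if b: "b \<in> level h" for h b
  proof (cases h)
    case 0
    then have "b = root" using b by (simp add: level_0)
    then show ?thesis
      using finite_children[OF root_level] children_nonempty[OF root_level] children_subset[OF root_level]
      by (auto simp: neighbours_root vertices_def)
  next
    case (Suc k)
    then show ?thesis
      using finite_children[OF b] children_subset[OF b] parent_level[of b k] b
      by (auto simp: neighbours_level_Suc vertices_def)
  qed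
  then show "b \<in> vertices \<Longrightarrow> finite (neighbours v S b)"
    and "b \<in> vertices \<Longrightarrow> neighbours v S b \<noteq> {}"
    and "b \<in> vertices \<Longrightarrow> neighbours v S b \<subseteq> vertices"
    unfolding vertices_def by blast+
qed

lemma root_vertex: "root \<in> vertices"
  using root_level unfolding vertices_def by blast

lemma nn_integral_walk_kernel:
  assumes "b \<in> vertices" "\<And>c. c \<in> neighbours v S b \<Longrightarrow> 0 \<le> f c"
  shows "(\<integral>\<^sup>+c. ennreal (f c) \<partial>walk_kernel b) = ennreal ((\<Sum>c\<in>neighbours v S b. f c) / card (neighbours v S b))"
proof -
  have "0 < card (neighbours v S b)"
    using assms finite_neighbours neighbours_nonempty by (simp add: card_gt_0_iff)
  then show ?thesis
    using assms finite_neighbours[of b] neighbours_nonempty[of b]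
    by (simp add: nn_integral_pmf_of_set sum_ennreal sum_nonneg divide_ennreal[symmetric] ennreal_of_nat_eq_real_of_nat)
qed

lemma set_walk_kernel: "b \<in> vertices \<Longrightarrow> set_pmf (walk_kernel b) \<subseteq> vertices"
  using finite_neighbours[of b] neighbours_nonempty[of b] neighbours_subset[of b] by simp

text \<open>Kirchhoff's law makes \<open>voltage\<close> harmonic for the walk off the root. At the
  root the equation is short by the unit current from the imagined parent, which is not a
  neighbour.\<close>

lemma voltage_superharmonic:
  assumes k0: "0 < k0" and b: "b \<in> vertices"
  shows "(\<Sum>c\<in>neighbours v S b. voltage c) + (if b = root then 1 else 0) = card (neighbours v S b) * voltage b"
proof -
  obtain h where h: "b \<in> level h" using b by (auto simp: vertices_def)
  have "(\<Sum>c\<in>ch b. voltage c) = (\<Sum>c\<in>ch b. voltage b - current c)"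
    using voltage_child[OF h] by (rule sum.cong[OF refl])
  also have "\<dots> = card (ch b) * voltage b - current b"
    using vertex_flow_current[OF k0] h by (simp add: sum_subtractf vertex_flow_def)
  finally have ch: "(\<Sum>c\<in>ch b. voltage c) = card (ch b) * voltage b - current b" .
  show ?thesis
  proof (cases h)
    case 0
    then have "b = root" using h by (simp add: level_0)
    then show ?thesis using ch by (simp add: neighbours_root current_root[OF k0])
  next
    case (Suc k)
    then have p: "parent b \<in> level k" "b \<in> ch (parent b)" "b \<noteq> root"
      using h parent_level level_Suc_not_root[of b k] by (auto simp: child_iff_edge edge_to)
    then show ?thesis
      using voltage_child[OF p(1,2)] ch h Suc finite_children[OF h] parent_notin_children[of b k]
      by (simp add: neighbours_level_Suc algebra_simps)
  qed
qed

text \<open>\<open>voltage\<close> is nonnegative and harmonic except for a drop at the root, 1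
  divided by the degree; \<open>AE_chain_law_transient\<close> applies to it.\<close>

lemma transient_if_cond:
  assumes k0: "0 < k0"
  shows "transient v S"
proof -
  let ?n = "card (neighbours v S root)"
  have pos: "0 < card (neighbours v S b)" if "b \<in> vertices" for b
    using that finite_neighbours[of b] neighbours_nonempty[of b] by (simp add: card_gt_0_iff)
  have nonneg: "0 \<le> voltage b" if "b \<in> vertices" for b
    using that voltage_nonneg unfolding vertices_def by blast
  show ?thesis
    unfolding transient_def walk_law_eq
  proof (rule AE_chain_law_transient)
    show "root \<in> vertices" by (rule root_vertex)
    show "set_pmf (walk_kernel b) \<subseteq> vertices" if "b \<in> vertices" for b
      using that by (rule set_walk_kernel)
    show "(\<integral>\<^sup>+c. ennreal (voltage c) \<partial>walk_kernel b) + ennreal (1 / real ?n) * indicator {root} b \<le> ennreal (voltage b)"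
      if b: "b \<in> vertices" for b
    proof -
      have "(\<integral>\<^sup>+c. ennreal (voltage c) \<partial>walk_kernel b) + ennreal (1 / real ?n) * indicator {root} b
          = ennreal ((\<Sum>c\<in>neighbours v S b. voltage c) / card (neighbours v S b))
            + ennreal ((if b = root then 1 else 0) / real (card (neighbours v S b)))"
        using nn_integral_walk_kernel[OF b, of voltage] neighbours_subset[OF b] nonneg
        by (auto simp: subset_iff)
      also have "\<dots> = ennreal (((\<Sum>c\<in>neighbours v S b. voltage c) + (if b = root then 1 else 0)) / card (neighbours v S b))"
        using neighbours_subset[OF b] nonneg unfolding add_divide_distrib
        by (intro ennreal_plus[symmetric] divide_nonneg_nonneg sum_nonneg) (auto simp: subset_iff)
      also have "\<dots> = ennreal (voltage b)"
        unfolding voltage_superharmonic[OF k0 b] using pos[OF b] by simp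
      finally show ?thesis by simp
    qed
    show "0 < ennreal (1 / real ?n)" using pos[OF root_vertex] by simp
    show "ennreal (voltage root) < \<infinity>" by simp
  qed
qed

section \<open>Recurrence when the conductance vanishes\<close>

primrec esc :: "nat \<Rightarrow> 'a vertex \<Rightarrow> real" where
  "esc 0 b = 1"
| "esc (Suc k) b = (\<Sum>c\<in>neighbours v S b. if c = root then 0 else esc k c) / card (neighbours v S b)"

lemma esc_nonneg: "0 \<le> esc k b"
  by (induction k arbitrary: b) (auto intro!: divide_nonneg_nonneg sum_nonneg)

lemma esc_le_1: "esc k b \<le> 1"
proof (induction k arbitrary: b)
  case (Suc k)
  have "(\<Sum>c\<in>neighbours v S b. if c = root then 0 else esc k c) \<le> (\<Sum>c\<in>neighbours v S b. 1)"
    using Suc by (intro sum_mono) simp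
  then show ?case
    by (cases "card (neighbours v S b) = 0") (simp_all add: divide_le_eq)
qed simp

lemma esc_Suc_le: "esc (Suc k) b \<le> esc k b"
proof (induction k arbitrary: b)
  case 0
  show ?case using esc_le_1[of "Suc 0" b] by simp
next
  case (Suc k)
  show ?case
    unfolding esc.simps(2)[of "Suc k"] esc.simps(2)[of k b]
    using Suc by (intro divide_right_mono sum_mono) (simp_all del: esc.simps)
qed

text \<open>Moves the escape probabilities from \<open>ennreal\<close> to the reals, where
  differences such as \<open>1 - u b\<close> behave well.\<close>

lemma avoid_eq_esc: "b \<in> vertices \<Longrightarrow> avoid walk_kernel root k b = ennreal (esc k b)"
proof (induction k arbitrary: b)
  case (Suc k)
  have "avoid walk_kernel root (Suc k) b = (\<integral>\<^sup>+c. ennreal (if c = root then 0 else esc k c) \<partial>walk_kernel b)"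
    unfolding avoid.simps
  proof (rule nn_integral_cong_AE)
    show "AE c in walk_kernel b. indicator (- {root}) c * avoid walk_kernel root k c
        = ennreal (if c = root then 0 else esc k c)"
      using Suc.IH set_walk_kernel[OF Suc.prems]
      by (auto simp: AE_measure_pmf_iff indicator_def subset_iff)
  qed
  also have "\<dots> = ennreal (esc (Suc k) b)"
    using nn_integral_walk_kernel[OF Suc.prems, of "\<lambda>c. if c = root then 0 else esc k c"]
    by (simp add: esc_nonneg)
  finally show ?case .
qed simp

text \<open>The limits \<open>q\<close> of the escape probabilities are averages of
  \<open>u\<close>, which is \<open>q\<close> set to 0 at the root. Comparing \<open>1 - u\<close>
  with voltages of truncated networks, whose conductances into the children of the root tend to 0,
  forces \<open>u\<close> to vanish next to the root. Return is then certain.\<close>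

lemma not_transient_if_cond:
  assumes k0: "k0 = 0"
  shows "\<not> transient v S"
proof -
  define q where "q b = lim (\<lambda>k. esc k b)" for b
  have lim: "(\<lambda>k. esc k b) \<longlonglongrightarrow> q b" for b
    unfolding q_def convergent_LIMSEQ_iff[symmetric]
    using decseq_convergent[OF decseq_SucI[of "\<lambda>k. esc k b", OF esc_Suc_le], of 0] esc_nonneg
    by (metis convergentI)
  have q01: "0 \<le> q b" "q b \<le> 1" for b
    using LIMSEQ_le_const[OF lim[of b], of 0] LIMSEQ_le_const2[OF lim[of b], of 1] esc_nonneg esc_le_1 by auto
  define u where "u b = (if b = root then 0 else q b)" for b
  have q_avg: "q b = (\<Sum>c\<in>neighbours v S b. u c) / card (neighbours v S b)" if "b \<in> vertices" for b
  proof (rule LIMSEQ_unique)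
    show "(\<lambda>k. esc (Suc k) b) \<longlonglongrightarrow> q b" using lim by (rule LIMSEQ_Suc)
    have "(\<lambda>k. if c = root then 0 else esc k c) \<longlonglongrightarrow> u c" for c
      using lim by (auto simp: u_def)
    then show "(\<lambda>k. esc (Suc k) b) \<longlonglongrightarrow> (\<Sum>c\<in>neighbours v S b. u c) / card (neighbours v S b)"
      unfolding esc.simps using that finite_neighbours[of b] neighbours_nonempty[of b]
      by (intro tendsto_divide tendsto_sum tendsto_const) (auto simp: card_gt_0_iff)
  qed
  \<comment> \<open>\<open>1 - cond d b\<close> is the voltage at \<open>b\<close> when its parent
    has voltage 1 and the vertices \<open>d\<close> levels below \<open>b\<close> are grounded. As
    \<open>1 - u\<close> is nonnegative and harmonic off the root, it dominates this voltage scaled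
    by its own value at the parent.\<close>
  have w: "(1 - cond d b) * (1 - u (parent b)) \<le> 1 - u b" if "b \<in> level (Suc h)" for d b h
    using that
  proof (induction d arbitrary: b h)
    case 0
    then show ?case using q01 by (simp add: u_def)
  next
    case (Suc d)
    note b = Suc.prems
    let ?s = "\<Sum>c\<in>ch b. cond d c"
    have s: "0 \<le> ?s"
      using children_subset[OF b] cond_pos by (intro sum_nonneg) (meson less_imp_le subsetD)
    have bv: "b \<in> vertices" using b by (auto simp: vertices_def)
    have fin: "finite (ch b)" and notin: "parent b \<notin> ch b"
      using finite_children[OF b] parent_notin_children[OF b] .
    have "u b = (u (parent b) + (\<Sum>c\<in>ch b. u c)) / (1 + card (ch b))"
      using q_avg[OF bv] level_Suc_not_root[OF b] fin notin
      by (simp add: u_def[of b] neighbours_level_Suc[OF b])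
    then have "u b * (1 + card (ch b)) = u (parent b) + (\<Sum>c\<in>ch b. u c)"
      by (simp add: field_simps)
    then have harm: "(1 - u b) * (1 + card (ch b)) = (1 - u (parent b)) + (\<Sum>c\<in>ch b. 1 - u c)"
      by (simp add: sum_subtractf algebra_simps)
    have "(\<Sum>c\<in>ch b. (1 - cond d c) * (1 - u b)) \<le> (\<Sum>c\<in>ch b. 1 - u c)"
    proof (rule sum_mono)
      fix c assume "c \<in> ch b"
      then show "(1 - cond d c) * (1 - u b) \<le> 1 - u c"
        using Suc.IH[of c "Suc h"] children_subset[OF b] parent_child[OF b] by auto
    qed
    then have "(1 - u (parent b)) + (card (ch b) - ?s) * (1 - u b) \<le> (1 - u b) * (1 + card (ch b))"
      unfolding harm by (simp add: sum_distrib_right[symmetric] sum_subtractf)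
    then have "1 - u (parent b) \<le> (1 - u b) * (1 + ?s)"
      by (simp add: algebra_simps)
    then have "(1 - u (parent b)) / (1 + ?s) \<le> 1 - u b"
      using s by (simp add: pos_divide_le_eq)
    also have "(1 - u (parent b)) / (1 + ?s) = (1 - cond (Suc d) b) * (1 - u (parent b))"
      using s by (simp add: field_simps)
    finally show ?case .
  qed
  have "u c = 0" if c: "c \<in> ch root" for c
  proof -
    have c1: "c \<in> level (Suc 0)" using children_subset[OF root_level] c by blast
    have "(\<Sum>c\<in>ch root. cond_inf c) = 0"
      using cond_inf_children[OF root_level] k0 by simp
    then have "cond_inf c = 0"
      using c finite_children[OF root_level] children_subset[OF root_level] cond_inf_nonneg[of _ "Suc 0"]
      by (subst (asm) sum_nonneg_eq_0_iff) auto
    then have "(\<lambda>d. (1 - cond d c) * (1 - u (parent c))) \<longlonglongrightarrow> (1 - 0) * (1 - u (parent c))"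
      using cond_LIMSEQ[OF c1] by (intro tendsto_intros) simp
    then have "(1 - 0) * (1 - u (parent c)) \<le> 1 - u c"
      by (rule LIMSEQ_le_const2) (use w[OF c1] in blast)
    moreover have "u (parent c) = 0" using parent_child[OF root_level c] by (simp add: u_def)
    ultimately show "u c = 0" using q01(1)[of c] by (simp add: u_def split: if_splits)
  qed
  then have "q root = 0"
    using q_avg[OF root_vertex] by (simp add: neighbours_root)
  then have "(\<lambda>k. ennreal (esc k root)) \<longlonglongrightarrow> ennreal 0"
    using lim[of root] by (intro tendsto_ennrealI) simp
  then have "(\<lambda>k. avoid walk_kernel root k root) \<longlonglongrightarrow> 0"
    by (simp add: avoid_eq_esc[OF root_vertex])
  then have inf: "AE \<omega> in chain_law walk_kernel root. infinite {n. \<omega> n = root}"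
    by (rule AE_chain_law_recurrent)
  show ?thesis
  proof
    assume "transient v S"
    then have "AE \<omega> in chain_law walk_kernel root. finite {n. \<omega> n = root}"
      unfolding transient_def walk_law_eq .
    with inf have "AE \<omega> in chain_law walk_kernel root. False" by eventually_elim simp
    then show False
      using prob_space.AE_False[OF prob_space_chain_law[of walk_kernel root]] by blast
  qed
qed

lemma transient_iff: "transient v S \<longleftrightarrow> 0 < k0"
  using transient_if_cond not_transient_if_cond cond_inf_nonneg[OF root_level] by force

section \<open>Growth of the factorials\<close>

text \<open>For \<open>x = y\<close> no such \<open>n\<close> exists and the value is unspecified,
  which is why distinctness is carried along below.\<close>

definition nval :: "'a \<Rightarrow> 'a \<Rightarrow> nat" where
  "nval x y = (THE n. v (x - y) = ereal (real n))"

lemma val_eq_nval: "x \<in> S \<Longrightarrow> y \<in> S \<Longrightarrow> x \<noteq> y \<Longrightarrow> v (x - y) = ereal (real (nval x y))"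
proof -
  assume "x \<in> S" "y \<in> S" "x \<noteq> y"
  then obtain n where n: "v (x - y) = ereal (real n)" using val_diff_nat S_subset by (metis subsetD)
  then have "nval x y = n" unfolding nval_def by (intro the_equality) auto
  then show ?thesis using n by simp
qed

lemma val_prod_diff:
  fixes n :: nat
  assumes "x \<in> S" "\<And>j. j < n \<Longrightarrow> s j \<in> S \<and> x \<noteq> s j"
  shows "v (\<Prod>j<n. x - s j) = ereal (real (\<Sum>j<n. nval x (s j)))"
proof -
  have "v (\<Prod>j<n. x - s j) = (\<Sum>j<n. ereal (real (nval x (s j))))"
    unfolding val_prod[OF finite_lessThan] using assms val_eq_nval by (intro sum.cong) auto
  then show ?thesis by simp
qed

lemma val_prod_diff_infinite: "x \<in> s ` {..<n::nat} \<Longrightarrow> v (\<Prod>j<n. x - s j) = \<infinity>"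
proof -
  assume "x \<in> s ` {..<n}"
  then have "(\<Prod>j<n. x - s j) = 0" by auto
  then show ?thesis by (simp only: val_zero)
qed

lemma exists_new: "\<exists>x\<in>S. x \<notin> s ` {..<n::nat}"
  using S_infinite by (meson finite_imageI finite_lessThan finite_subset subsetI)

text \<open>Points not yet used give natural numbers, which have a minimum, and repeated points give
  infinity, so each greedy choice is possible. This gives meaning to the \<open>SOME\<close> in
  \<open>log_factorial\<close>.\<close>

lemma exists_factorial_determining: "\<exists>s. factorial_determining v S s"
proof -
  have "\<exists>s. \<forall>n::nat. s n \<in> S \<and> (\<forall>t\<in>S. v (\<Prod>j<n. s n - s j) \<le> v (\<Prod>j<n. t - s j))"
  proof (rule dependent_wellorder_choice[where
        P="\<lambda>s n r. r \<in> S \<and> (\<forall>t\<in>S. v (\<Prod>j<n. r - s j) \<le> v (\<Prod>j<n. t - s j))"])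
    fix n :: nat and s :: "nat \<Rightarrow> 'a"
    assume "\<And>j. j < n \<Longrightarrow> s j \<in> S \<and> (\<forall>t\<in>S. v (\<Prod>i<j. s j - s i) \<le> v (\<Prod>i<j. t - s i))"
    then have s: "s j \<in> S" if "j < n" for j using that by blast
    let ?f = "\<lambda>x. \<Sum>j<n. nval x (s j)"
    obtain x where x: "x \<in> S" "x \<notin> s ` {..<n}" "\<And>y. y \<in> S \<Longrightarrow> y \<notin> s ` {..<n} \<Longrightarrow> ?f x \<le> ?f y"
      using arg_min_nat_lemma[of "\<lambda>x. x \<in> S \<and> x \<notin> s ` {..<n}" _ ?f] exists_new[of s n] by blast
    have "v (\<Prod>j<n. x - s j) \<le> v (\<Prod>j<n. t - s j)" if "t \<in> S" for t
    proof (cases "t \<in> s ` {..<n}")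
      case False
      have "v (\<Prod>j<n. x - s j) = ereal (real (?f x))" "v (\<Prod>j<n. t - s j) = ereal (real (?f t))"
        using x(1,2) that s False by (intro val_prod_diff; force)+
      then show ?thesis using x(3)[OF that False] by (simp del: of_nat_sum)
    qed (simp only: val_prod_diff_infinite, simp)
    then show "\<exists>x. x \<in> S \<and> (\<forall>t\<in>S. v (\<Prod>j<n. x - s j) \<le> v (\<Prod>j<n. t - s j))"
      using x(1) by blast
  next
    fix r :: 'a and s g :: "nat \<Rightarrow> 'a" and n :: nat
    assume "\<And>j. j < n \<Longrightarrow> s j = g j"
    then have "(\<Prod>j<n. t - s j) = (\<Prod>j<n. t - g j)" for t by (intro prod.cong) auto
    then show "(r \<in> S \<and> (\<forall>t\<in>S. v (\<Prod>j<n. r - s j) \<le> v (\<Prod>j<n. t - s j)))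
        = (r \<in> S \<and> (\<forall>t\<in>S. v (\<Prod>j<n. r - g j) \<le> v (\<Prod>j<n. t - g j)))"
      by (simp only:)
  qed
  then show ?thesis by (simp add: factorial_determining_def)
qed

section \<open>Averaging potentials against the current\<close>

definition anc :: "nat \<Rightarrow> 'a vertex \<Rightarrow> 'a vertex" where
  "anc h c = tv h (SOME x. x \<in> snd c)"

lemma anc_tv: "h \<le> L \<Longrightarrow> anc h (tv L x) = tv h x"
  unfolding anc_def by (rule tree_vertex_mono[OF tree_vertex_SOME])

lemma anc_child:
  assumes "b \<in> level L" "c \<in> ch b" "h \<le> L"
  shows "anc h c = anc h b"
proof -
  obtain x where "b = tv L x" "c = tv (Suc L) x" using level_childE[OF assms(1,2)] by metis
  then show ?thesis using assms(3) by (simp add: anc_tv)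
qed

text \<open>Iterated conservation: what enters \<open>b\<close> is spread without loss over its
  descendants.\<close>

lemma sum_descendants:
  assumes \<theta>: "vertex_flow \<theta>" and b: "b \<in> level h" and "h \<le> L"
  shows "(\<Sum>c | c \<in> level L \<and> anc h c = b. \<theta> c) = \<theta> b"
  using \<open>h \<le> L\<close>
proof (induction L rule: dec_induct)
  case base
  have "{c. c \<in> level h \<and> anc h c = b} = {b}" using b anc_tv[of h h] by (auto simp: level_def)
  then show ?case by simp
next
  case (step L)
  have "{c. c \<in> level (Suc L) \<and> anc h c = b} = (\<Union>a\<in>{a. a \<in> level L \<and> anc h a = b}. ch a)"
  proof (rule set_eqI)
    fix c
    have "(\<exists>a\<in>level L. c \<in> ch a \<and> anc h c = b) \<longleftrightarrow> (\<exists>a\<in>level L. c \<in> ch a \<and> anc h a = b)"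
      using anc_child[OF _ _ step(1), of _ c] by (intro bex_cong refl conj_cong) simp_all
    then show "c \<in> {c. c \<in> level (Suc L) \<and> anc h c = b} \<longleftrightarrow> c \<in> (\<Union>a\<in>{a. a \<in> level L \<and> anc h a = b}. ch a)"
      unfolding level_Suc by blast
  qed
  then have "(\<Sum>c | c \<in> level (Suc L) \<and> anc h c = b. \<theta> c) = (\<Sum>a | a \<in> level L \<and> anc h a = b. \<Sum>c\<in>ch a. \<theta> c)"
    using finite_children[of _ L] children_disjoint[of _ L]
    by (simp only:) (rule sum.UNION_disjoint, simp add: finite_level, blast+)
  also have "\<dots> = (\<Sum>a | a \<in> level L \<and> anc h a = b. \<theta> a)"
    using vertex_flow_children[OF \<theta>] by (intro sum.cong refl) blast
  finally show ?case using step by simp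
qed

lemma agree_eq_nval:
  assumes "x \<in> S" "y \<in> S" "x \<noteq> y"
  shows "card {h\<in>{1..L}. tv h x = tv h y} = min L (nval x y)"
  unfolding agree_levels[OF val_eq_nval[OF assms]] by simp

text \<open>The average of the potential of \<open>s 0, \<dots>, s (n - 1)\<close> over a deep level, with the weights
  \<open>current\<close>, is at most \<open>n\<close> times the voltage \<open>1 / k0 - 1\<close> at the root.\<close>

lemma exists_small_potential:
  assumes k0: "0 < k0" and s: "\<And>j. j < n \<Longrightarrow> s j \<in> S"
  shows "\<exists>x\<in>S. x \<notin> s ` {..<n} \<and> real (\<Sum>j<n. nval x (s j)) \<le> (1 / k0 - 1) * real n"
proof -
  define H where "H = 1 / k0 - 1"
  have H: "0 \<le> H" using k0 k0_le_1 by (simp add: H_def field_simps)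
  \<comment> \<open>Deeper than the bound to be proved: a total agreement of at most
    \<open>H * n\<close> leaves each single agreement below \<open>L\<close>, so that truncation at
    \<open>L\<close> changes nothing and \<open>x\<close> differs from every
    \<open>s j\<close>.\<close>
  obtain L :: nat where L: "H * real n < real L" using reals_Archimedean2 by blast
  define g where "g c = (\<Sum>j<n. \<Sum>h\<in>{1..L}. if anc h c = tv h (s j) then 1 else (0::real))" for c
  have "(\<Sum>c\<in>level L. current c * g c) = (\<Sum>j<n. \<Sum>h\<in>{1..L}. \<Sum>c\<in>level L. if anc h c = tv h (s j) then current c else 0)"
    unfolding g_def sum_distrib_left
    by (subst sum.swap, rule sum.cong[OF refl], subst sum.swap) (auto intro!: sum.cong)
  also have "\<dots> = (\<Sum>j<n. \<Sum>h\<in>{1..L}. current (tv h (s j)))"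
  proof (intro sum.cong refl)
    fix j h assume "j \<in> {..<n}" "h \<in> {1..L}"
    then show "(\<Sum>c\<in>level L. if anc h c = tv h (s j) then current c else 0) = current (tv h (s j))"
      using sum_descendants[OF vertex_flow_current[OF k0], of "tv h (s j)" h L] s tv_in_level finite_level
      by (simp add: sum.inter_filter[symmetric])
  qed
  also have "\<dots> \<le> (\<Sum>j<n. H)"
  proof (rule sum_mono)
    fix j assume "j \<in> {..<n}"
    then have j: "s j \<in> S" using s by simp
    have "(\<Sum>h\<in>{1..L}. current (tv h (s j))) = (\<Sum>h\<le>L. current (tv h (s j))) - 1"
      using current_root[OF k0] tv_root[OF j]
      by (simp add: atMost_atLeast0 sum.atLeast_Suc_atMost)
    also have "\<dots> \<le> H"
      using sum_current[OF j k0] voltage_nonneg[OF tv_in_level[OF j]] by (simp add: H_def)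
    finally show "(\<Sum>h\<in>{1..L}. current (tv h (s j))) \<le> H" .
  qed
  finally have avg: "(\<Sum>c\<in>level L. current c * g c) \<le> H * real n" by (simp add: mult.commute)
  \<comment> \<open>The weights are nonnegative with sum 1, so some value does not exceed the
    mean.\<close>
  have "\<exists>c\<in>level L. g c \<le> H * real n"
  proof (rule ccontr)
    assume "\<not> ?thesis"
    then have gt: "H * real n < g c" if "c \<in> level L" for c using that by force
    have sum1: "(\<Sum>c\<in>level L. current c) = 1" using sum_level_vertex_flow[OF vertex_flow_current[OF k0]] .
    have "(\<Sum>c\<in>level L. current c * (g c - H * real n)) \<le> 0"
      using avg sum1 by (simp add: right_diff_distrib sum_subtractf sum_distrib_right[symmetric])
    moreover have nn: "0 \<le> current c * (g c - H * real n)" if "c \<in> level L" for c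
      using gt[OF that] current_nonneg[OF that] by simp
    ultimately have "(\<Sum>c\<in>level L. current c * (g c - H * real n)) = 0"
      by (meson antisym sum_nonneg)
    then have "\<forall>c\<in>level L. current c * (g c - H * real n) = 0"
      using nn by (subst (asm) sum_nonneg_eq_0_iff[OF finite_level]) blast+
    then have "\<forall>c\<in>level L. current c = 0" using gt by force
    then show False using sum1 by simp
  qed
  then obtain x where x: "x \<in> S" "g (tv L x) \<le> H * real n" by (auto simp: level_def)
  define m where "m j = card {h\<in>{1..L}. tv h x = tv h (s j)}" for j
  have "g (tv L x) = real (\<Sum>j<n. m j)"
    unfolding g_def m_def by (simp add: anc_tv sum.If_cases Int_def)
  then have m: "real (\<Sum>j<n. m j) \<le> H * real n" using x by simp
  have mj: "m j < L" if "j < n" for j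
  proof -
    have "m j \<le> (\<Sum>j<n. m j)" using that by (intro member_le_sum) auto
    then show ?thesis using m L by linarith
  qed
  have neq: "x \<noteq> s j" if "j < n" for j
  proof
    assume "x = s j"
    then have "{h\<in>{1..L}. tv h x = tv h (s j)} = {1..L}" by auto
    then show False using mj[OF that] unfolding m_def by (simp only: card_atLeastAtMost)
  qed
  have "m j = nval x (s j)" if "j < n" for j
    using mj[OF that] agree_eq_nval[OF x(1) s[OF that] neq[OF that], of L] by (simp add: m_def)
  then have "real (\<Sum>j<n. nval x (s j)) \<le> H * real n" using m by simp
  then show ?thesis using x(1) neq unfolding H_def by auto
qed

section \<open>Visit frequencies as a flow\<close>

definition freq :: "(nat \<Rightarrow> 'a) \<Rightarrow> nat \<Rightarrow> 'a vertex \<Rightarrow> real" where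
  "freq s N b = real (card {j. j < N \<and> tv (fst b) (s j) = b}) / real N"

lemma tv_Suc_in_children: "x \<in> S \<Longrightarrow> tv (Suc h) x \<in> ch b \<longleftrightarrow> tv h x = b"
  unfolding child_iff_edge edge_to parent_tv using tv_in_level[of x "Suc h"] by blast

lemma vertex_flow_freq:
  assumes s: "\<And>j. s j \<in> S" and N: "0 < N"
  shows "vertex_flow (freq s N)"
  unfolding vertex_flow_def
proof (intro conjI allI ballI)
  have "fst root = 0" by (simp add: tree_root_def)
  then have "{j. j < N \<and> tv (fst root) (s j) = root} = {..<N}" using s tv_root by auto
  then show "freq s N root = 1" using N by (simp only: freq_def) simp
next
  fix h b assume b: "b \<in> level h"
  have "{j. j < N \<and> tv h (s j) = b} = (\<Union>c\<in>ch b. {j. j < N \<and> tv (Suc h) (s j) = c})"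
  proof -
    have "tv h (s j) = b \<longleftrightarrow> tv (Suc h) (s j) \<in> ch b" for j
      using tv_Suc_in_children[OF s] by blast
    then show ?thesis by blast
  qed
  then have "card {j. j < N \<and> tv h (s j) = b} = (\<Sum>c\<in>ch b. card {j. j < N \<and> tv (Suc h) (s j) = c})"
    using finite_children[OF b] by (simp only:) (rule card_UN_disjoint, assumption, simp, blast)
  also have "\<dots> = (\<Sum>c\<in>ch b. card {j. j < N \<and> tv (fst c) (s j) = c})"
  proof (rule sum.cong)
    fix c assume "c \<in> ch b"
    then have "fst c = Suc h" using children_subset[OF b] by (intro level_fst) blast
    then show "card {j. j < N \<and> tv (Suc h) (s j) = c} = card {j. j < N \<and> tv (fst c) (s j) = c}" by simp
  qed simp
  finally show "freq s N b = (\<Sum>c\<in>ch b. freq s N c)"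
    by (simp add: freq_def level_fst[OF b] sum_divide_distrib)
qed

text \<open>At a level the squared counts add up to \<open>N\<close> plus twice the number of pairs
  that agree there. Over the levels \<open>1..L\<close> the diagonal gives \<open>L / N\<close>, and
  a pair agrees at no more levels than its \<open>nval\<close>; the leading 1 is level 0.\<close>

lemma energy_upto_freq:
  assumes s: "\<And>j. s j \<in> S" "\<And>n j. j < n \<Longrightarrow> s n \<noteq> s j" and N: "0 < N"
  shows "energy_upto L (freq s N) \<le> 1 + real L / real N + 2 * real (\<Sum>n<N. \<Sum>j<n. nval (s n) (s j)) / (real N)\<^sup>2"
proof -
  let ?p = "\<lambda>h. \<Sum>n<N. \<Sum>j<n. if tv h (s n) = tv h (s j) then 1 else (0::real)"
  have level: "(\<Sum>b\<in>level h. (freq s N b)\<^sup>2) = (real N + 2 * ?p h) / (real N)\<^sup>2" for h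
  proof -
    have "(\<Sum>b\<in>level h. (freq s N b)\<^sup>2) = (\<Sum>b\<in>level h. (real (card {j. j < N \<and> tv h (s j) = b}))\<^sup>2) / (real N)\<^sup>2"
      by (simp add: freq_def level_fst power_divide sum_divide_distrib)
    also have "\<dots> = (real N + 2 * ?p h) / (real N)\<^sup>2"
      using sum_square_counts[of "level h" N "\<lambda>j. tv h (s j)"] finite_level tv_in_level s by simp
    finally show ?thesis .
  qed
  have "freq s N root = 1"
    using vertex_flow_freq[of s N] s(1) N unfolding vertex_flow_def by blast
  then have "(\<Sum>b\<in>level 0. (freq s N b)\<^sup>2) = 1" by (simp only: level_0) simp
  then have "energy_upto L (freq s N) = 1 + (\<Sum>h\<in>{1..L}. (real N + 2 * ?p h) / (real N)\<^sup>2)"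
    unfolding energy_upto_def atMost_atLeast0 by (subst sum.atLeast_Suc_atMost, simp, simp only: level[symmetric] One_nat_def)
  also have "\<dots> = 1 + real L / real N + 2 * (\<Sum>h\<in>{1..L}. ?p h) / (real N)\<^sup>2"
    using N by (simp add: sum_divide_distrib[symmetric] sum.distrib sum_distrib_left[symmetric] field_simps power2_eq_square)
  also have "(\<Sum>h\<in>{1..L}. ?p h) = (\<Sum>n<N. \<Sum>j<n. \<Sum>h\<in>{1..L}. if tv h (s n) = tv h (s j) then 1 else (0::real))"
    by (subst sum.swap, rule sum.cong[OF refl], rule sum.swap)
  also have "\<dots> \<le> (\<Sum>n<N. \<Sum>j<n. real (nval (s n) (s j)))"
  proof (intro sum_mono)
    fix n j :: nat assume "j \<in> {..<n}"
    then have "s n \<noteq> s j" using s by simp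
    then have "card {h\<in>{1..L}. tv h (s n) = tv h (s j)} \<le> nval (s n) (s j)"
      using agree_eq_nval[OF s(1) s(1), of n j L] by simp
    then show "(\<Sum>h\<in>{1..L}. if tv h (s n) = tv h (s j) then 1 else (0::real)) \<le> real (nval (s n) (s j))"
      by (simp add: sum.If_cases Int_def)
  qed
  finally show ?thesis using N by (simp add: divide_right_mono)
qed

text \<open>\<open>k0 = 1\<close> contradicts \<open>cond_inf_children\<close> at the root. The
  strict inequality makes the limit \<open>H\<close> positive.\<close>

lemma k0_less_1: "k0 < 1"
  using cond_inf_children[OF root_level] k0_le_1 by (cases "k0 = 1") auto

section \<open>Factorials along a fixed factorial-determining sequence\<close>

context
  fixes s assumes fd: "factorial_determining v S s"
begin

definition fact_exp :: "nat \<Rightarrow> nat" where "fact_exp n = (\<Sum>j<n. nval (s n) (s j))"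

lemma fd_in_S: "s n \<in> S"
  using fd by (simp add: factorial_determining_def)

text \<open>A point not yet used gives a finite valuation and a repeated one an infinite one, so a
  minimizer never repeats.\<close>

lemma fd_distinct: "j < n \<Longrightarrow> s n \<noteq> s j"
proof
  assume "j < n" "s n = s j"
  obtain x where x: "x \<in> S" "x \<notin> s ` {..<n}" using exists_new by blast
  have "v (\<Prod>j<n. s n - s j) = \<infinity>"
    using \<open>j < n\<close> \<open>s n = s j\<close> by (intro val_prod_diff_infinite) auto
  moreover have "v (\<Prod>j<n. x - s j) = ereal (real (\<Sum>j<n. nval x (s j)))"
    using x fd_in_S by (intro val_prod_diff) auto
  ultimately show False
    using fd x(1) unfolding factorial_determining_def by (metis PInfty_neq_ereal(1) ereal_infty_less_eq(1))
qed

lemma val_fact_exp: "v (\<Prod>j<n. s n - s j) = ereal (real (fact_exp n))"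
  unfolding fact_exp_def using fd_in_S fd_distinct by (intro val_prod_diff) auto

lemma fact_exp_le:
  assumes "x \<in> S" "x \<notin> s ` {..<n}"
  shows "fact_exp n \<le> (\<Sum>j<n. nval x (s j))"
proof -
  have "v (\<Prod>j<n. x - s j) = ereal (real (\<Sum>j<n. nval x (s j)))"
    using assms fd_in_S by (intro val_prod_diff) auto
  moreover have "v (\<Prod>j<n. s n - s j) \<le> v (\<Prod>j<n. x - s j)"
    using fd assms(1) by (simp add: factorial_determining_def)
  ultimately show ?thesis by (simp add: val_fact_exp del: of_nat_sum)
qed

text \<open>\<open>s (Suc n)\<close> was a competitor when \<open>s n\<close> was chosen, and its
  additional term \<open>nval (s (Suc n)) (s n)\<close> is a natural number.\<close>

lemma fact_exp_mono: "m \<le> n \<Longrightarrow> fact_exp m \<le> fact_exp n"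
proof -
  have step: "fact_exp n \<le> fact_exp (Suc n)" for n
  proof -
  have "fact_exp n \<le> (\<Sum>j<n. nval (s (Suc n)) (s j))"
    using fd_in_S by (intro fact_exp_le) (metis, metis fd_distinct imageE lessThan_iff less_SucI)
  also have "\<dots> \<le> fact_exp (Suc n)" by (simp add: fact_exp_def)
  finally show ?thesis .
  qed
  show "m \<le> n \<Longrightarrow> fact_exp m \<le> fact_exp n" by (rule lift_Suc_mono_le[of fact_exp, OF step])
qed

lemma fact_exp_upper:
  assumes "0 < k0"
  shows "real (fact_exp n) \<le> (1 / k0 - 1) * real n"
proof -
  obtain x where "x \<in> S" "x \<notin> s ` {..<n}" "real (\<Sum>j<n. nval x (s j)) \<le> (1 / k0 - 1) * real n"
    using exists_small_potential[OF assms, of n s] fd_in_S by blast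
  then show ?thesis using fact_exp_le[of x n] by linarith
qed

lemma energy_freq_fact_exp:
  "0 < N \<Longrightarrow> energy_upto L (freq s N) \<le> 1 + real L / real N + 2 * (\<Sum>n<N. real (fact_exp n)) / (real N)\<^sup>2"
  using energy_upto_freq[of s N L] fd_in_S fd_distinct by (simp add: fact_exp_def)

lemma sum_fact_exp_le:
  assumes "\<And>n. real (fact_exp n) \<le> C * real n" "0 \<le> C"
  shows "2 * (\<Sum>n<N. real (fact_exp n)) / (real N)\<^sup>2 \<le> C"
proof -
  have "(\<Sum>n<N. real (fact_exp n)) \<le> C * (\<Sum>n<N. real n)"
    unfolding sum_distrib_left using assms by (intro sum_mono) auto
  also have "(\<Sum>n<N. real n) \<le> (real N)\<^sup>2 / 2"
    by (induction N) (auto simp: power2_eq_square field_simps)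
  then have "C * (\<Sum>n<N. real n) \<le> C * ((real N)\<^sup>2 / 2)" using assms by (intro mult_left_mono)
  finally show ?thesis using assms(2) by (cases "N = 0") (simp_all add: divide_le_eq)
qed

text \<open>Thomson's principle for the frequency flow, multiplied by \<open>N\<^sup>2\<close>. The
  shape is that of \<open>lower\<close> in \<open>LIMSEQ_average_of_mono\<close>, with
  \<open>R L = 1 / cond L root - 1\<close> and \<open>C L = L\<close>.\<close>

lemma sum_fact_exp_lower:
  "((1 / cond L root - 1) * (real N)\<^sup>2 - real L * real N) / 2 \<le> (\<Sum>n<N. real (fact_exp n))"
proof (cases "N = 0")
  case False
  then have N: "0 < real N" by simp
  have "1 / cond L root \<le> 1 + real L / real N + 2 * (\<Sum>n<N. real (fact_exp n)) / (real N)\<^sup>2"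
    using order_trans[OF energy_upto_ge[OF vertex_flow_freq[of s N]] energy_freq_fact_exp[of N L]] fd_in_S False by simp
  then have "(1 / cond L root - 1) * (real N)\<^sup>2
      \<le> (real L / real N + 2 * (\<Sum>n<N. real (fact_exp n)) / (real N)\<^sup>2) * (real N)\<^sup>2"
    by (intro mult_right_mono) auto
  also have "\<dots> = real L * real N + 2 * (\<Sum>n<N. real (fact_exp n))"
    using N by (simp add: field_simps power2_eq_square)
  finally show ?thesis by simp
qed simp

lemma fact_exp_LIMSEQ:
  assumes k0: "0 < k0"
  shows "(\<lambda>n. real (fact_exp n) / real n) \<longlonglongrightarrow> 1 / k0 - 1"
proof (rule LIMSEQ_average_of_mono)
  show "(\<lambda>L. 1 / cond L root - 1) \<longlonglongrightarrow> 1 / k0 - 1"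
    by (intro tendsto_intros inverse_cond_root_LIMSEQ k0)
  show "((1 / cond L root - 1) * (real n)\<^sup>2 - real L * real n) / 2 \<le> (\<Sum>m<n. real (fact_exp m))" for L n
    by (rule sum_fact_exp_lower)
qed (use fact_exp_mono fact_exp_upper[OF k0] k0 k0_le_1 in \<open>auto simp: field_simps\<close>)

text \<open>At fixed \<open>L\<close> the term \<open>L / N\<close> vanishes as \<open>N\<close>
  grows, which leaves the bound \<open>1 + C\<close> for the resistance, independent of
  \<open>L\<close>.\<close>

lemma cond_pos_if_fact_exp_linear:
  assumes C: "\<And>n. real (fact_exp n) \<le> C * real n" "0 \<le> C"
  shows "0 < k0"
proof -
  have "1 / (1 + C) \<le> cond L root" for L
  proof -
    have "1 / cond L root \<le> 1 + C + real L / real (Suc N)" for N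
      using order_trans[OF energy_upto_ge[OF vertex_flow_freq[of s "Suc N"]] energy_freq_fact_exp[of "Suc N" L]]
        sum_fact_exp_le[OF C, of "Suc N"] fd_in_S by simp
    moreover have "(\<lambda>N. 1 + C + real L / real (Suc N)) \<longlonglongrightarrow> 1 + C + 0"
      by (intro tendsto_add tendsto_const) (rule LIMSEQ_Suc[OF lim_const_over_n])
    ultimately have "1 / cond L root \<le> 1 + C + 0" by (intro LIMSEQ_le_const) auto
    then show ?thesis using cond_pos[OF root_level] C(2) by (simp add: field_simps)
  qed
  then have "1 / (1 + C) \<le> k0" by (intro LIMSEQ_le_const[OF cond_LIMSEQ[OF root_level]]) auto
  moreover have "0 < 1 / (1 + C)" using C(2) by simp
  ultimately show ?thesis by linarith
qed

text \<open>\<open>L\<close> is fixed first, to bring \<open>1 / cond L root\<close> near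
  \<open>1 / k0\<close>; then \<open>N\<close> is taken large against \<open>L\<close>, so that the
  frequency flow has nearly minimal energy. Each of the two errors gets
  \<open>r\<^sup>2 / 2\<close>.\<close>

lemma freq_LIMSEQ:
  assumes k0: "0 < k0" and b: "b \<in> level h"
  shows "(\<lambda>N. freq s N b) \<longlonglongrightarrow> current b"
proof (rule LIMSEQ_I)
  fix r :: real assume r: "0 < r"
  have "(\<lambda>L. 4 * (1 / k0 - 1 / cond L root)) \<longlonglongrightarrow> 4 * (1 / k0 - 1 / k0)"
    by (intro tendsto_intros inverse_cond_root_LIMSEQ k0)
  then have "\<forall>\<^sub>F L in sequentially. 4 * (1 / k0 - 1 / cond L root) < r\<^sup>2 / 2"
    by (rule order_tendstoD) (use r in simp)
  then have "\<forall>\<^sub>F L in sequentially. 4 * (1 / k0 - 1 / cond L root) < r\<^sup>2 / 2 \<and> h \<le> L"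
    using eventually_ge_at_top by (rule eventually_conj)
  then obtain L where L: "4 * (1 / k0 - 1 / cond L root) < r\<^sup>2 / 2" "h \<le> L"
    by (auto simp: eventually_sequentially)
  obtain M :: nat where M: "4 * real L / r\<^sup>2 < real M" using reals_Archimedean2 by blast
  have "norm (freq s N b - current b) < r" if N: "N \<ge> Suc M" for N
  proof -
    have "energy_upto L (freq s N) \<le> 1 / k0 + real L / real N"
    proof -
      have "0 \<le> 1 / k0 - 1" using k0 k0_le_1 by (simp add: field_simps)
      then show ?thesis
        using energy_freq_fact_exp[of N L] sum_fact_exp_le[OF fact_exp_upper[OF k0], of N] N by linarith
    qed
    then have "(freq s N b - current b)\<^sup>2 \<le> 4 * (1 / k0 - 1 / cond L root) + 2 * (real L / real N)"
      using N fd_in_S by (intro vertex_flow_close_current[OF k0 vertex_flow_freq b L(2)]) auto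
    also have "2 * (real L / real N) \<le> r\<^sup>2 / 2"
    proof -
      have "4 * real L / r\<^sup>2 < real N" using M N by linarith
      then show ?thesis using r N by (simp add: field_simps)
    qed
    finally have "(freq s N b - current b)\<^sup>2 < r\<^sup>2" using L by simp
    then have "\<bar>freq s N b - current b\<bar>\<^sup>2 < r\<^sup>2" by simp
    then show ?thesis unfolding real_norm_def by (rule power2_less_imp_less) (use r in simp)
  qed
  then show "\<exists>M. \<forall>N\<ge>M. norm (freq s N b - current b) < r" by blast
qed

end

section \<open>The harmonic measure\<close>

abbreviation cl :: "'a set" where "cl \<equiv> ring_closure v S"

text \<open>Cosets form a neighbourhood base, so closure means that every coset of the point meets
  \<open>S\<close>. Together with \<open>convergent_branch\<close> this identifies the closure with
  the infinite paths.\<close>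

lemma mem_closure_iff: "x \<in> cl \<longleftrightarrow> (\<forall>h. tv h x \<in> level h)"
proof
  assume x: "x \<in> cl"
  show "\<forall>h. tv h x \<in> level h"
  proof
    fix h
    let ?U = "{y. ereal (real h) \<le> v (x - y)}"
    have "openin (Metric_space.mtopology UNIV (val_dist v)) ?U"
      unfolding openin_mtopology_iff using val_diff_trans by blast
    then have "openin (ring_topology v) (?U \<inter> val_ring v)"
      unfolding ring_topology_def openin_subtopology by blast
    moreover have "x \<in> ?U \<inter> val_ring v"
      using x unfolding ring_closure_def ring_topology_def in_closure_of by (auto simp: val_zero)
    moreover have "\<And>T. x \<in> T \<and> openin (ring_topology v) T \<Longrightarrow> \<exists>y. y \<in> S \<and> y \<in> T"
      using x unfolding ring_closure_def in_closure_of by (elim conjE) metis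
    ultimately have "\<exists>y. y \<in> S \<and> y \<in> ?U \<inter> val_ring v" by metis
    then obtain y where "y \<in> S" "ereal (real h) \<le> v (x - y)" by auto
    then have "tv h x = tv h y" by (simp add: tree_vertex_eq_iff)
    then show "tv h x \<in> level h" using \<open>y \<in> S\<close> tv_in_level by simp
  qed
next
  assume x: "\<forall>h. tv h x \<in> level h"
  have ex: "\<exists>y\<in>S. ereal (real h) \<le> v (x - y)" for h
  proof -
    obtain y where "y \<in> S" "tv h x = tv h y" using x[rule_format, of h] unfolding level_def by blast
    then show ?thesis by (auto simp: tree_vertex_eq_iff)
  qed
  have xR: "x \<in> val_ring v"
  proof -
    obtain y where y: "y \<in> S" "ereal (real 0) \<le> v (x - y)" using ex by blast
    then have "0 \<le> v (y - 0)" using S_subset by (auto simp: val_ring_def)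
    then show ?thesis using val_diff_trans[of 0 x y 0] y(2) by (simp add: val_ring_def zero_ereal_def)
  qed
  show "x \<in> cl"
    unfolding ring_closure_def in_closure_of
  proof (intro conjI allI impI)
    interpret M: Metric_space UNIV "val_dist v" by (rule Metric_space_val_dist)
    show "x \<in> topspace (ring_topology v)" using xR by (simp add: ring_topology_def)
    fix T assume "x \<in> T \<and> openin (ring_topology v) T"
    then obtain U where "openin M.mtopology U" "T = U \<inter> val_ring v" "x \<in> U"
      unfolding ring_topology_def openin_subtopology by blast
    then show "\<exists>y. y \<in> S \<and> y \<in> T"
      using ex S_subset unfolding openin_mtopology_iff by blast
  qed
qed

lemma S_subset_closure: "S \<subseteq> cl"
  using tv_in_level by (auto simp: mem_closure_iff)

lemma closure_subset: "cl \<subseteq> val_ring v"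
  unfolding ring_closure_def ring_topology_def
  using closure_of_subset_topspace[of "subtopology (Metric_space.mtopology UNIV (val_dist v)) (val_ring v)" S]
  by auto

lemma openin_closure_topology_iff:
  "openin (closure_topology v S) U \<longleftrightarrow> U \<subseteq> cl \<and> (\<forall>x\<in>U. \<exists>h. \<forall>y\<in>cl. tv h y = tv h x \<longrightarrow> y \<in> U)"
proof -
  have top: "closure_topology v S = subtopology (Metric_space.mtopology UNIV (val_dist v)) cl"
    unfolding closure_topology_def ring_topology_def subtopology_subtopology
    using closure_subset by (simp add: Int_absorb1)
  show ?thesis
  proof
    assume "openin (closure_topology v S) U"
    then obtain T where T: "openin (Metric_space.mtopology UNIV (val_dist v)) T" "U = T \<inter> cl"
      unfolding top openin_subtopology by blast
    show "U \<subseteq> cl \<and> (\<forall>x\<in>U. \<exists>h. \<forall>y\<in>cl. tv h y = tv h x \<longrightarrow> y \<in> U)"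
    proof (intro conjI ballI)
      fix x assume "x \<in> U"
      then obtain h :: nat where "\<And>y. ereal (real h) \<le> v (x - y) \<Longrightarrow> y \<in> T"
        using T unfolding openin_mtopology_iff by blast
      then show "\<exists>h. \<forall>y\<in>cl. tv h y = tv h x \<longrightarrow> y \<in> U"
        using T(2) by (intro exI[of _ h]) (auto simp: tree_vertex_eq_iff val_diff_commute[of _ x])
    qed (use T in blast)
  next
    assume U: "U \<subseteq> cl \<and> (\<forall>x\<in>U. \<exists>h. \<forall>y\<in>cl. tv h y = tv h x \<longrightarrow> y \<in> U)"
    let ?T = "{y. \<exists>x\<in>U. \<exists>h. ereal (real h) \<le> v (x - y) \<and> (\<forall>y\<in>cl. tv h y = tv h x \<longrightarrow> y \<in> U)}"
    have "openin (Metric_space.mtopology UNIV (val_dist v)) ?T"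
      unfolding openin_mtopology_iff using val_diff_trans by blast
    moreover have "U = ?T \<inter> cl"
    proof
      show "U \<subseteq> ?T \<inter> cl"
      proof
        fix x assume "x \<in> U"
        moreover have "ereal (real h) \<le> v (x - x)" for h by (simp add: val_zero)
        ultimately show "x \<in> ?T \<inter> cl" using U by blast
      qed
      show "?T \<inter> cl \<subseteq> U"
        by (auto simp: tree_vertex_eq_iff val_diff_commute)
    qed
    ultimately show "openin (closure_topology v S) U"
      unfolding top openin_subtopology by blast
  qed
qed

definition cyl :: "'a vertex \<Rightarrow> 'a set" where
  "cyl b = {x \<in> cl. tv (fst b) x = b}"

lemma mem_cyl_tv: "y \<in> cyl (tv h x) \<longleftrightarrow> y \<in> cl \<and> tv h y = tv h x"
  by (simp add: cyl_def)

lemma cyl_root: "cyl root = cl"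
  using closure_subset tree_vertex_root by (auto simp: cyl_def tree_root_def)

lemma openin_cyl: "openin (closure_topology v S) (cyl b)"
  unfolding openin_closure_topology_iff cyl_def by (intro conjI ballI exI[of _ "fst b"]) auto

text \<open>Ultrametric balls that meet are nested. Cylinders together with the empty set are
  therefore stable under intersection.\<close>

lemma cyl_Int: "cyl b \<inter> cyl c \<in> {{}, cyl b, cyl c}"
proof (cases "cyl b \<inter> cyl c = {}")
  case False
  then obtain x where x: "x \<in> cl" "tv (fst b) x = b" "tv (fst c) x = c" by (auto simp: cyl_def)
  have sub: "cyl (tv h x) \<subseteq> cyl (tv k x)" if "k \<le> h" for h k
  proof
    fix y assume "y \<in> cyl (tv h x)"
    then show "y \<in> cyl (tv k x)" unfolding mem_cyl_tv using tree_vertex_mono[OF _ that] by blast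
  qed
  have "cyl c \<subseteq> cyl b \<or> cyl b \<subseteq> cyl c"
    using sub[of "fst b" "fst c"] sub[of "fst c" "fst b"] nat_le_linear[of "fst b" "fst c"] unfolding x(2,3) by blast
  then show ?thesis by blast
qed simp

lemma countable_vertices: "countable vertices"
  unfolding vertices_def using finite_level by (intro countable_UN) (auto intro: countable_finite)

lemma tv_vertex: "x \<in> cl \<Longrightarrow> tv h x \<in> vertices"
  unfolding vertices_def mem_closure_iff by blast

text \<open>There are only countably many vertices, so this union is countable and the cylinders
  generate the Borel sets.\<close>

lemma open_eq_Union_cyl:
  assumes "openin (closure_topology v S) U"
  shows "U = (\<Union>b\<in>{b\<in>vertices. cyl b \<subseteq> U}. cyl b)"
proof
  show "U \<subseteq> (\<Union>b\<in>{b\<in>vertices. cyl b \<subseteq> U}. cyl b)"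
  proof
    fix x assume x: "x \<in> U"
    then obtain h where "\<forall>y\<in>cl. tv h y = tv h x \<longrightarrow> y \<in> U" "x \<in> cl"
      using assms unfolding openin_closure_topology_iff by blast
    then show "x \<in> (\<Union>b\<in>{b\<in>vertices. cyl b \<subseteq> U}. cyl b)"
      using tv_vertex[of x h] by (intro UN_I[of "tv h x"]) (auto simp: mem_cyl_tv)
  qed
qed blast

lemma space_closure_borel: "space (closure_borel v S) = cl"
  unfolding closure_borel_def by (rule space_measure_of) (auto simp: openin_closure_topology_iff)

lemma sets_closure_borel: "sets (closure_borel v S) = sigma_sets cl {U. openin (closure_topology v S) U}"
  unfolding closure_borel_def by (rule sets_measure_of) (auto simp: openin_closure_topology_iff)

lemma sets_cyl: "cyl b \<in> sets (closure_borel v S)"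
  unfolding sets_closure_borel using openin_cyl by (intro sigma_sets.Basic) simp

lemma sets_closure_borel_cyl: "sets (closure_borel v S) = sigma_sets cl (insert {} (cyl ` vertices))"
proof
  have sa: "sigma_algebra cl (sigma_sets cl (insert {} (cyl ` vertices)))"
    by (rule sigma_algebra_sigma_sets) (auto simp: cyl_def)
  have "U \<in> sigma_sets cl (insert {} (cyl ` vertices))" if "openin (closure_topology v S) U" for U
  proof -
    have "(\<Union>b\<in>{b\<in>vertices. cyl b \<subseteq> U}. cyl b) \<in> sigma_sets cl (insert {} (cyl ` vertices))"
      by (rule sigma_algebra.countable_UN''[OF sa])
        (auto intro: countable_subset[OF _ countable_vertices])
    then show ?thesis using open_eq_Union_cyl[OF that] by simp
  qed
  then show "sets (closure_borel v S) \<subseteq> sigma_sets cl (insert {} (cyl ` vertices))"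
    unfolding sets_closure_borel by (intro sigma_sets_mono) auto
  show "sigma_sets cl (insert {} (cyl ` vertices)) \<subseteq> sets (closure_borel v S)"
    unfolding sets_closure_borel
    using openin_cyl by (intro sigma_sets_mono) (blast intro: sigma_sets.Basic sigma_sets.Empty)
qed

text \<open>The pi-lambda theorem for cylinders; the cylinder of the root is the whole space and
  serves as exhausting sequence.\<close>

lemma closure_measure_eqI:
  assumes "prob_space M" "prob_space N" "sets M = sets (closure_borel v S)" "sets N = sets (closure_borel v S)"
    and eq: "\<And>b. b \<in> vertices \<Longrightarrow> measure M (cyl b) = measure N (cyl b)"
  shows "M = N"
proof (rule measure_eqI_generator_eq[where E="insert {} (cyl ` vertices)" and \<Omega>=cl and A="\<lambda>_. cl"])
  interpret M: prob_space M by fact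
  interpret N: prob_space N by fact
  show "Int_stable (insert {} (cyl ` vertices))"
    unfolding Int_stable_def
  proof (intro ballI)
    fix X Y assume "X \<in> insert {} (cyl ` vertices)" "Y \<in> insert {} (cyl ` vertices)"
    then show "X \<inter> Y \<in> insert {} (cyl ` vertices)"
      using cyl_Int by (elim insertE imageE) (simp, simp, simp, metis insert_iff image_eqI empty_iff)
  qed
  show "insert {} (cyl ` vertices) \<subseteq> Pow cl" by (auto simp: cyl_def)
  show "emeasure M X = emeasure N X" if "X \<in> insert {} (cyl ` vertices)" for X
    using that eq by (auto simp: M.emeasure_eq_measure N.emeasure_eq_measure)
  show "range (\<lambda>_::nat. cl) \<subseteq> insert {} (cyl ` vertices)"
    using root_vertex cyl_root by blast
  show "emeasure M cl \<noteq> \<infinity>" by simp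
qed (use assms sets_closure_borel_cyl in auto)

section \<open>Construction of the harmonic measure\<close>

lemma flow_kernel_exists:
  assumes k0: "0 < k0"
  shows "\<exists>K. \<forall>b\<in>vertices. set_pmf (K b) \<subseteq> ch b \<and> (\<forall>c\<in>ch b. current c = current b * pmf (K b) c)"
proof -
  have "\<exists>p. set_pmf p \<subseteq> ch b \<and> (\<forall>c\<in>ch b. current c = current b * pmf p c)" if "b \<in> vertices" for b
  proof -
    obtain h where b: "b \<in> level h" using \<open>b \<in> vertices\<close> unfolding vertices_def by blast
    have fin: "finite (ch b)" "ch b \<noteq> {}" using finite_children[OF b] children_nonempty[OF b] .
    have nn: "0 \<le> current c" if "c \<in> ch b" for c
      using current_nonneg[of c "Suc h"] children_subset[OF b] that by blast
    have sum: "(\<Sum>c\<in>ch b. current c) = current b"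
      using vertex_flow_children[OF vertex_flow_current[OF k0] b] .
    show ?thesis
    \<comment> \<open>Without current into \<open>b\<close> its children carry none either, and
      every distribution on them satisfies the equation.\<close>
    proof (cases "current b = 0")
      case True
      then have "\<forall>c\<in>ch b. current c = 0" using sum sum_nonneg_eq_0_iff[OF fin(1), of current] nn by simp
      then show ?thesis using fin True by (intro exI[of _ "pmf_of_set (ch b)"]) simp
    next
      case False
      then have pos: "0 < current b" using current_nonneg[OF b] by simp
      define f where "f c = (if c \<in> ch b then current c / current b else 0)" for c
      have f0: "0 \<le> f c" for c using nn pos by (simp add: f_def)
      have "(\<integral>\<^sup>+c. ennreal (f c) \<partial>count_space UNIV) = (\<Sum>c\<in>ch b. ennreal (f c))"
        using fin by (intro nn_integral_count_space'[of "ch b"]) (auto simp: f_def)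
      also have "\<dots> = ennreal (\<Sum>c\<in>ch b. f c)" using f0 by (intro sum_ennreal)
      also have "(\<Sum>c\<in>ch b. f c) = 1"
        using sum False by (simp add: f_def sum_divide_distrib[symmetric])
      finally have f1: "(\<integral>\<^sup>+c. ennreal (f c) \<partial>count_space UNIV) = 1" by simp
      have "set_pmf (embed_pmf f) \<subseteq> ch b"
        unfolding set_embed_pmf[OF f0 f1] by (auto simp: f_def)
      moreover have "current c = current b * pmf (embed_pmf f) c" if "c \<in> ch b" for c
        unfolding pmf_embed_pmf[OF f0 f1] using that pos by (simp add: f_def)
      ultimately show ?thesis by blast
    qed
  qed
  then show ?thesis by (rule bchoice[OF ballI])
qed

text \<open>The chain that descends from the root with the kernel of
  \<open>flow_kernel_exists\<close> passes through \<open>b\<close> with probability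
  \<open>current b\<close>. The measure is the law of its end, a pushforward that inherits countable
  additivity from the path space.\<close>

lemma exists_harmonic_measure:
  assumes k0: "0 < k0"
  shows "\<exists>\<mu>. prob_space \<mu> \<and> sets \<mu> = sets (closure_borel v S) \<and> (\<forall>b\<in>vertices. measure \<mu> (cyl b) = current b)"
proof -
  obtain K where K: "\<And>b. b \<in> vertices \<Longrightarrow> set_pmf (K b) \<subseteq> ch b"
    "\<And>b c. b \<in> vertices \<Longrightarrow> c \<in> ch b \<Longrightarrow> current c = current b * pmf (K b) c"
    using flow_kernel_exists[OF k0] by metis
  let ?M = "chain_law K root"
  interpret prob_space ?M by (rule prob_space_chain_law)
  have ch_vertices: "ch b \<subseteq> vertices" if "b \<in> vertices" for b
    using that children_subset unfolding vertices_def by blast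
  have Kv: "set_pmf (K b) \<subseteq> vertices" if "b \<in> vertices" for b
    using K(1)[OF that] ch_vertices[OF that] by blast
  \<comment> \<open>Paths that descend edge by edge from the root; they have full measure, and each
    has an end in the closure.\<close>
  define good where "good = {\<omega>. \<omega> 0 = root \<and> (\<forall>n. (\<omega> n, \<omega> (Suc n)) \<in> tree_edges v S)}"
  have good_sets: "good \<in> sets ?M"
  proof -
    have "good = {\<omega>. \<omega> 0 = root} \<inter> (\<Inter>n. {\<omega>. (\<omega> n, \<omega> (Suc n)) \<in> tree_edges v S})"
      by (auto simp: good_def)
    also have "\<dots> \<in> sets ?M"
      using chain_law_edge_measurable[OF countable_edges, of _ _ K root]
      by (intro sets.Int sets.countable_INT chain_law_component_measurable) auto
    finally show ?thesis .
  qed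
  have inv: "AE \<omega> in ?M. \<forall>n. \<omega> n \<in> vertices"
    by (rule AE_chain_law_invariant[OF root_vertex Kv])
  have step: "AE \<omega> in ?M. \<forall>n. \<omega> (Suc n) \<in> set_pmf (K (\<omega> n))"
    by (rule AE_chain_law_step[OF root_vertex Kv countable_vertices])
  have good_AE: "AE \<omega> in ?M. \<omega> \<in> good"
    using inv AE_chain_law_0[where K=K and x=root] step
  proof eventually_elim
    case (elim \<omega>)
    then have "(\<omega> n, \<omega> (Suc n)) \<in> tree_edges v S" for n
      using K(1)[of "\<omega> n"] unfolding child_iff_edge[symmetric] by blast
    then show ?case using elim unfolding good_def by blast
  qed
  have branch: "\<exists>x\<in>cl. \<forall>n. tv n x = \<omega> n" if "\<omega> \<in> good" for \<omega>
  proof -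
    have edge: "\<omega> (Suc n) \<in> ch (\<omega> n)" for n using that by (simp add: good_def child_iff_edge)
    have lev: "\<omega> n \<in> level n" for n
    proof (induction n)
      case 0
      show ?case using that root_level by (simp add: good_def)
    next
      case (Suc n)
      then show ?case using children_subset edge by blast
    qed
    have "\<exists>x. x \<in> S \<and> tv n x = \<omega> n" for n using lev[of n] unfolding level_def by (metis imageE)
    then obtain x where x: "\<And>n. x n \<in> S" "\<And>n. tv n (x n) = \<omega> n" by metis
    have "tv m (x n) = \<omega> m" if "m \<le> n" for m n
      using that
    proof (induction n rule: dec_induct)
      case (step n)
      have "tv n (x (Suc n)) = parent (tv (Suc n) (x (Suc n)))" by (simp only: parent_tv)
      also have "\<dots> = tv n (x n)" unfolding x using parent_child[OF lev edge] .
      finally have "tv m (x (Suc n)) = tv m (x n)" using step(1) by (rule tree_vertex_mono)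
      then show ?case using step by simp
    qed (rule x(2))
    then obtain z where z: "\<And>n. tv n z = tv n (x n)"
      using convergent_branch[of x] x(2) by metis
    then show ?thesis using x lev by (intro bexI[of _ z]) (auto simp: mem_closure_iff)
  qed
  obtain s0 where s0: "s0 \<in> S" using S_nonempty by blast
  \<comment> \<open>The default \<open>s0\<close> keeps the map inside the closure everywhere; it
    does not affect the law, as \<open>good\<close> has full measure.\<close>
  define lim_pt where "lim_pt \<omega> = (if \<omega> \<in> good then SOME x. x \<in> cl \<and> (\<forall>n. tv n x = \<omega> n) else s0)" for \<omega>
  have lim_good: "lim_pt \<omega> \<in> cl \<and> (\<forall>n. tv n (lim_pt \<omega>) = \<omega> n)" if "\<omega> \<in> good" for \<omega>
    using someI_ex[OF branch[OF that, unfolded Bex_def]] that by (simp add: lim_pt_def)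
  have lim_cl: "lim_pt \<omega> \<in> cl" for \<omega>
    using lim_good[of \<omega>] s0 S_subset_closure by (cases "\<omega> \<in> good") (auto simp: lim_pt_def)
  have lim_cyl: "lim_pt -` cyl b = (good \<inter> {\<omega>. \<omega> (fst b) = b}) \<union> (if s0 \<in> cyl b then - good else {})" for b
  proof (rule set_eqI)
    fix \<omega> show "\<omega> \<in> lim_pt -` cyl b \<longleftrightarrow> \<omega> \<in> (good \<inter> {\<omega>. \<omega> (fst b) = b}) \<union> (if s0 \<in> cyl b then - good else {})"
      using lim_good[of \<omega>] by (cases "\<omega> \<in> good") (auto simp: cyl_def lim_pt_def)
  qed
  have lim_cyl_sets: "lim_pt -` cyl b \<in> sets ?M" for b
    unfolding lim_cyl using good_sets sets.compl_sets[OF good_sets] chain_law_component_measurable[of "\<lambda>y. y = b" "fst b" K root]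
    by (auto simp: Compl_eq_Diff_UNIV)
  have meas: "lim_pt \<in> measurable ?M (closure_borel v S)"
    unfolding closure_borel_def
  proof (rule measurable_measure_of)
    fix U assume "U \<in> {U. openin (closure_topology v S) U}"
    then have "U = (\<Union>b\<in>{b\<in>vertices. cyl b \<subseteq> U}. cyl b)" using open_eq_Union_cyl by simp
    then have "lim_pt -` U \<inter> space ?M = lim_pt -` (\<Union>b\<in>{b\<in>vertices. cyl b \<subseteq> U}. cyl b)" by simp
    also have "\<dots> = (\<Union>b\<in>{b\<in>vertices. cyl b \<subseteq> U}. lim_pt -` cyl b)" by (rule vimage_UN)
    also have "\<dots> \<in> sets ?M"
      using lim_cyl_sets by (intro sets.countable_UN') (auto intro: countable_subset[OF _ countable_vertices])
    finally show "lim_pt -` U \<inter> space ?M \<in> sets ?M" .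
  qed (use lim_cl in \<open>auto simp: openin_closure_topology_iff\<close>)
  have law: "measure ?M {\<omega>. \<omega> h = b} = current b" if "b \<in> level h" for h b
    using that
  proof (induction h arbitrary: b)
    case 0
    have "AE \<omega> in ?M. \<omega> \<in> {\<omega>. \<omega> 0 = root}" using AE_chain_law_0[where K=K and x=root] by simp
    then have "measure ?M {\<omega>. \<omega> 0 = root} = 1"
      using prob_eq_1[OF chain_law_component_measurable[of "\<lambda>y. y = root" 0 K root]] by simp
    then show ?case using 0 current_root[OF k0] by (simp add: level_0)
  next
    case (Suc h)
    let ?p = "parent b"
    have p: "?p \<in> level h" "b \<in> ch ?p" "?p \<in> vertices"
      using parent_level[OF Suc.prems] Suc.prems by (auto simp: child_iff_edge edge_to vertices_def)
    have "emeasure ?M {\<omega>. \<omega> (Suc h) = b} = (\<integral>\<^sup>+\<omega>. ennreal (pmf (K (\<omega> h)) b) \<partial>?M)"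
      by (rule emeasure_chain_law_Suc)
    also have "\<dots> = (\<integral>\<^sup>+\<omega>. ennreal (pmf (K ?p) b) * indicator {\<omega>. \<omega> h = ?p} \<omega> \<partial>?M)"
    proof (rule nn_integral_cong_AE)
      show "AE \<omega> in ?M. ennreal (pmf (K (\<omega> h)) b) = ennreal (pmf (K ?p) b) * indicator {\<omega>. \<omega> h = ?p} \<omega>"
        using inv
      proof eventually_elim
        case (elim \<omega>)
        show ?case
        proof (cases "\<omega> h = ?p")
          case False
          then have "b \<notin> ch (\<omega> h)" by (auto simp: child_iff_edge edge_to)
          then have "pmf (K (\<omega> h)) b = 0" using K(1)[of "\<omega> h"] elim by (auto simp: set_pmf_iff)
          then show ?thesis using False by simp
        qed simp
      qed
    qed
    also have "\<dots> = ennreal (pmf (K ?p) b) * emeasure ?M {\<omega>. \<omega> h = ?p}"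
      by (rule nn_integral_cmult_indicator) (rule chain_law_component_measurable)
    also have "\<dots> = ennreal (current b)"
      using Suc.IH[OF p(1)] K(2)[OF p(3,2)] current_nonneg[OF p(1)]
      by (simp add: emeasure_eq_measure ennreal_mult mult.commute)
    finally show ?case using current_nonneg[OF Suc.prems] by (simp add: emeasure_eq_measure)
  qed
  let ?\<mu> = "distr ?M (closure_borel v S) lim_pt"
  have "measure ?\<mu> (cyl b) = current b" if "b \<in> vertices" for b
  proof -
    obtain h where b: "b \<in> level h" using \<open>b \<in> vertices\<close> unfolding vertices_def by blast
    then have [simp]: "fst b = h" by (rule level_fst)
    have "measure ?\<mu> (cyl b) = measure ?M (lim_pt -` cyl b)"
      using measure_distr[OF meas sets_cyl] by simp
    also have "\<dots> = measure ?M {\<omega>. \<omega> h = b}"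
    proof (rule measure_eq_AE)
      show "AE \<omega> in ?M. \<omega> \<in> lim_pt -` cyl b \<longleftrightarrow> \<omega> \<in> {\<omega>. \<omega> h = b}"
        using good_AE by eventually_elim (simp add: lim_cyl)
      show "{\<omega>. \<omega> h = b} \<in> sets ?M" by (rule chain_law_component_measurable)
    qed (rule lim_cyl_sets)
    finally show ?thesis using law[OF b] by simp
  qed
  then show ?thesis
    using prob_space_distr[OF meas] by (intro exI[of _ ?\<mu>]) simp
qed

text \<open>The definite description has exactly one solution: the values on edges together with the
  total mass fix the measure of every cylinder.\<close>

lemma harmonic_measure:
  assumes k0: "0 < k0"
  shows "prob_space (harmonic_measure v S)"
    and "sets (harmonic_measure v S) = sets (closure_borel v S)"
    and "b \<in> level h \<Longrightarrow> measure (harmonic_measure v S) (cyl b) = current b"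
proof -
  obtain \<mu> where \<mu>: "prob_space \<mu>" "sets \<mu> = sets (closure_borel v S)"
    "\<And>b. b \<in> vertices \<Longrightarrow> measure \<mu> (cyl b) = current b"
    using exists_harmonic_measure[OF k0] by blast
  have edge: "c \<in> vertices" "min_energy_flow v S (a, c) = current c" if "(a, c) \<in> tree_edges v S" for a c
    using that min_energy_flow_eq[OF k0] edge_to unfolding current_edges_def vertices_def by auto
  have "harmonic_measure v S = \<mu>"
    unfolding harmonic_measure_def
  proof (rule the_equality)
    show "prob_space \<mu> \<and> sets \<mu> = sets (closure_borel v S) \<and> (\<forall>(a, c)\<in>tree_edges v S.
          measure \<mu> {x \<in> ring_closure v S. tv (fst c) x = c} = min_energy_flow v S (a, c))"
      using \<mu> edge by (auto simp: cyl_def)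
  next
    fix \<nu> assume \<nu>: "prob_space \<nu> \<and> sets \<nu> = sets (closure_borel v S) \<and> (\<forall>(a, c)\<in>tree_edges v S.
          measure \<nu> {x \<in> ring_closure v S. tv (fst c) x = c} = min_energy_flow v S (a, c))"
    show "\<nu> = \<mu>"
    proof (rule closure_measure_eqI)
      fix b assume "b \<in> vertices"
      then obtain h where b: "b \<in> level h" unfolding vertices_def by blast
      show "measure \<nu> (cyl b) = measure \<mu> (cyl b)"
      proof (cases h)
        \<comment> \<open>No edge ends at the root; its cylinder is the whole space, so total mass 1
          decides.\<close>
        case 0
        then have "b = root" using b by (simp add: level_0)
        moreover have "space \<nu> = cl" "space \<mu> = cl"
          using \<mu>(2) \<nu> space_closure_borel sets_eq_imp_space_eq by metis+
        ultimately show ?thesis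
          using prob_space.prob_space[of \<nu>] prob_space.prob_space[of \<mu>] \<mu>(1) \<nu> by (simp add: cyl_root)
      next
        case (Suc k)
        then have e: "(parent b, b) \<in> tree_edges v S" using b edge_to by blast
        then have "measure \<nu> (cyl b) = min_energy_flow v S (parent b, b)"
          using \<nu> unfolding cyl_def by blast
        then show ?thesis using edge[OF e] \<mu>(3) by simp
      qed
    qed (use \<mu> \<nu> in auto)
  qed
  then show "prob_space (harmonic_measure v S)"
    "sets (harmonic_measure v S) = sets (closure_borel v S)"
    "b \<in> level h \<Longrightarrow> measure (harmonic_measure v S) (cyl b) = current b"
    using \<mu> unfolding vertices_def by blast+
qed

abbreviation har :: "'a measure" where "har \<equiv> harmonic_measure v S"

context
  assumes k0: "0 < k0"
begin

interpretation har: prob_space har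
  by (rule harmonic_measure(1)[OF k0])

lemma space_har: "space har = cl"
  using sets_eq_imp_space_eq[OF harmonic_measure(2)[OF k0]] space_closure_borel by simp

lemma cyl_sets_har [measurable]: "cyl b \<in> sets har"
  using sets_cyl harmonic_measure(2)[OF k0] by simp

lemma emeasure_cyl: "b \<in> level h \<Longrightarrow> emeasure har (cyl b) = ennreal (current b)"
  using harmonic_measure(3)[OF k0] by (simp add: har.emeasure_eq_measure)

lemma sum_indicator_cyl:
  fixes g :: "'a vertex \<Rightarrow> 'b::semiring_1"
  assumes "x \<in> cl"
  shows "(\<Sum>b\<in>level h. g b * indicator (cyl b) x) = g (tv h x)"
proof -
  have "tv h x \<in> level h" using assms mem_closure_iff by blast
  have "(\<Sum>b\<in>level h. g b * indicator (cyl b) x) = (\<Sum>b\<in>level h. if b = tv h x then g b else 0)"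
  proof (rule sum.cong)
    fix b assume "b \<in> level h"
    then have "fst b = h" by (rule level_fst)
    then have "x \<in> cyl b \<longleftrightarrow> b = tv h x" using assms by (auto simp: cyl_def)
    then show "g b * indicator (cyl b) x = (if b = tv h x then g b else 0)" by (simp add: indicator_def)
  qed simp
  also have "\<dots> = g (tv h x)" using \<open>tv h x \<in> level h\<close> finite_level by simp
  finally show ?thesis .
qed

lemma integral_level:
  fixes g :: "'a vertex \<Rightarrow> real"
  shows "(\<integral>x. g (tv h x) \<partial>har) = (\<Sum>b\<in>level h. g b * current b)"
    and "integrable har (\<lambda>x. g (tv h x))"
proof -
  have ind: "integrable har (\<lambda>x. g b * indicator (cyl b) x)" for b
    by (intro integrable_mult_right integrable_real_indicator cyl_sets_har) (simp add: har.emeasure_eq_measure)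
  have "(\<integral>x. g (tv h x) \<partial>har) = (\<integral>x. (\<Sum>b\<in>level h. g b * indicator (cyl b) x) \<partial>har)"
    by (intro Bochner_Integration.integral_cong refl) (simp add: sum_indicator_cyl space_har)
  also have "\<dots> = (\<Sum>b\<in>level h. g b * measure har (cyl b))"
    by (subst Bochner_Integration.integral_sum[OF ind]) (simp add: cyl_sets_har)
  also have "\<dots> = (\<Sum>b\<in>level h. g b * current b)"
    using harmonic_measure(3)[OF k0] by (intro sum.cong refl) metis
  finally show "(\<integral>x. g (tv h x) \<partial>har) = (\<Sum>b\<in>level h. g b * current b)" .
  have "integrable har (\<lambda>x. (\<Sum>b\<in>level h. g b * indicator (cyl b) x))"
    by (intro Bochner_Integration.integrable_sum ind)
  also have "integrable har (\<lambda>x. (\<Sum>b\<in>level h. g b * indicator (cyl b) x)) \<longleftrightarrow> integrable har (\<lambda>x. g (tv h x))"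
    by (intro Bochner_Integration.integrable_cong refl) (simp add: sum_indicator_cyl space_har)
  finally show "integrable har (\<lambda>x. g (tv h x))" .
qed

subsection \<open>Equidistribution\<close>

lemma continuous_measurable:
  assumes "continuous_map (closure_topology v S) euclideanreal f"
  shows "f \<in> borel_measurable har"
proof (rule borel_measurableI)
  fix T :: "real set" assume T: "open T"
  have top: "topspace (closure_topology v S) = cl"
  proof
    show "topspace (closure_topology v S) \<subseteq> cl"
      using openin_topspace[of "closure_topology v S"] unfolding openin_closure_topology_iff by blast
    show "cl \<subseteq> topspace (closure_topology v S)"
      by (rule openin_subset) (simp add: openin_closure_topology_iff)
  qed
  have "openin (closure_topology v S) {x \<in> cl. f x \<in> T}"
    using assms T openin_continuous_map_preimage[of _ _ f T] unfolding top[symmetric] by simp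
  then have "{x \<in> cl. f x \<in> T} \<in> sets har"
    unfolding harmonic_measure(2)[OF k0] sets_closure_borel by (intro sigma_sets.Basic) simp
  moreover have "f -` T \<inter> space har = {x \<in> cl. f x \<in> T}" using space_har by auto
  ultimately show "f -` T \<inter> space har \<in> sets har" by simp
qed

lemma continuous_locally_close:
  assumes "continuous_map (closure_topology v S) euclideanreal f" "x \<in> cl" "0 < e"
  obtains h where "\<And>y. y \<in> cl \<Longrightarrow> tv h y = tv h x \<Longrightarrow> \<bar>f y - f x\<bar> < e"
proof -
  have "openin (closure_topology v S) {y \<in> topspace (closure_topology v S). f y \<in> ball (f x) e}"
    using assms by (intro openin_continuous_map_preimage) auto
  moreover have "x \<in> topspace (closure_topology v S)"
    using assms(2) openin_subset[of "closure_topology v S" cl] by (auto simp: openin_closure_topology_iff)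
  ultimately obtain h where "\<forall>y\<in>cl. tv h y = tv h x \<longrightarrow> f y \<in> ball (f x) e"
    unfolding openin_closure_topology_iff using assms(3) by fastforce
  then show ?thesis using that[of h] by (auto simp: dist_real_def abs_minus_commute)
qed

text \<open>The supremum of a continuous function over the cylinders of level \<open>h\<close> is a step function,
  whose averages are controlled by the convergence of the frequencies. These step functions
  decrease to the function itself, so that no compactness is needed.\<close>

lemma average_upper:
  assumes fd: "factorial_determining v S s"
    and f: "continuous_map (closure_topology v S) euclideanreal f" "bounded (f ` cl)"
    and e: "(\<integral>x. f x \<partial>har) < e"
  shows "\<forall>\<^sub>F N in sequentially. (\<Sum>j<N. f (s j)) / real N < e"
proof -
  obtain B where B: "\<And>x. x \<in> cl \<Longrightarrow> \<bar>f x\<bar> \<le> B" using f(2) by (auto simp: bounded_iff)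
  define g where "g b = Sup (f ` cyl b)" for b
  have bdd: "bdd_above (f ` cyl b)" for b
    using B by (intro bdd_aboveI2[of _ _ B]) (auto simp: cyl_def abs_le_iff)
  have le: "f x \<le> g (tv h x)" if "x \<in> cl" for x h
    unfolding g_def using that bdd by (intro cSup_upper) (auto simp: mem_cyl_tv)
  have gB: "\<bar>g (tv h x)\<bar> \<le> B" if "x \<in> cl" for x h
  proof -
    have "g (tv h x) \<le> B"
      unfolding g_def using that B by (intro cSup_least) (auto simp: mem_cyl_tv abs_le_iff)
    then show ?thesis using le[OF that, of h] B[OF that] by auto
  qed
  have lim: "(\<lambda>h. g (tv h x)) \<longlonglongrightarrow> f x" if x: "x \<in> cl" for x
  proof (rule LIMSEQ_I)
    fix r :: real assume "0 < r"
    then obtain h0 where h0: "\<And>y. y \<in> cl \<Longrightarrow> tv h0 y = tv h0 x \<Longrightarrow> \<bar>f y - f x\<bar> < r / 2"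
      using continuous_locally_close[OF f(1) x, of "r / 2"] by auto
    have "norm (g (tv h x) - f x) < r" if "h \<ge> h0" for h
    proof -
      have "g (tv h x) \<le> f x + r / 2"
        unfolding g_def
      proof (rule cSup_least)
        show "f ` cyl (tv h x) \<noteq> {}" using x by (auto simp: mem_cyl_tv)
        fix z assume "z \<in> f ` cyl (tv h x)"
        then obtain y where "y \<in> cl" "tv h y = tv h x" "z = f y" by (auto simp: mem_cyl_tv)
        then have "\<bar>f y - f x\<bar> < r / 2" using h0[of y] tree_vertex_mono[OF _ \<open>h \<ge> h0\<close>, of y x] by blast
        then show "z \<le> f x + r / 2" unfolding \<open>z = f y\<close> by linarith
      qed
      then show ?thesis using le[OF x, of h] \<open>0 < r\<close> by simp
    qed
    then show "\<exists>N. \<forall>h\<ge>N. norm (g (tv h x) - f x) < r" by blast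
  qed
  have "(\<lambda>h. \<integral>x. g (tv h x) \<partial>har) \<longlonglongrightarrow> (\<integral>x. f x \<partial>har)"
  proof (rule integral_dominated_convergence[where w="\<lambda>_. B"])
    show "f \<in> borel_measurable har" by (rule continuous_measurable[OF f(1)])
    show "(\<lambda>x. g (tv h x)) \<in> borel_measurable har" for h
      using integral_level(2) by (rule borel_measurable_integrable)
    show "AE x in har. (\<lambda>h. g (tv h x)) \<longlonglongrightarrow> f x" using lim by (intro AE_I2) (simp add: space_har)
    show "AE x in har. norm (g (tv h x)) \<le> B" for h using gB by (intro AE_I2) (simp add: space_har)
  qed simp
  then have "\<forall>\<^sub>F h in sequentially. (\<integral>x. g (tv h x) \<partial>har) < e" using e by (rule order_tendstoD)
  then obtain h where h: "(\<Sum>b\<in>level h. g b * current b) < e"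
    unfolding integral_level(1) by (auto simp: eventually_sequentially)
  have "(\<lambda>N. \<Sum>b\<in>level h. g b * freq s N b) \<longlonglongrightarrow> (\<Sum>b\<in>level h. g b * current b)"
    using freq_LIMSEQ[OF fd k0] by (intro tendsto_intros)
  then have "\<forall>\<^sub>F N in sequentially. (\<Sum>b\<in>level h. g b * freq s N b) < e" using h by (rule order_tendstoD)
  then show ?thesis
  proof eventually_elim
    case (elim N)
    have sS: "s j \<in> cl" "tv h (s j) \<in> level h" for j using fd_in_S[OF fd] S_subset_closure tv_in_level by auto
    have "(\<Sum>j<N. f (s j)) \<le> (\<Sum>j<N. g (tv h (s j)))" using le sS by (intro sum_mono) auto
    also have "\<dots> = (\<Sum>b\<in>level h. \<Sum>j | j \<in> {..<N} \<and> tv h (s j) = b. g (tv h (s j)))"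
      using sS finite_level by (intro sum.group[symmetric]) auto
    also have "\<dots> = (\<Sum>b\<in>level h. g b * real (card {j. j < N \<and> tv (fst b) (s j) = b}))"
      by (intro sum.cong refl) (simp add: level_fst)
    finally have "(\<Sum>j<N. f (s j)) / real N \<le> (\<Sum>b\<in>level h. g b * freq s N b)"
      unfolding freq_def by (simp add: sum_divide_distrib[symmetric] divide_right_mono)
    then show ?case using elim by simp
  qed
qed

text \<open>Upper bounds suffice: applied to \<open>- f\<close> they give the lower ones.\<close>

lemma equidistributed_har:
  assumes fd: "factorial_determining v S s"
  shows "equidistributed v S s har"
  unfolding equidistributed_def
proof (intro allI impI, elim conjE)
  fix f assume f: "continuous_map (closure_topology v S) euclideanreal f" "bounded (f ` cl)"
  show "(\<lambda>n. (\<Sum>j<n. f (s j)) / real n) \<longlonglongrightarrow> (\<integral>x. f x \<partial>har)"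
  proof (rule order_tendstoI)
    fix e assume "(\<integral>x. f x \<partial>har) < e"
    then show "\<forall>\<^sub>F n in sequentially. (\<Sum>j<n. f (s j)) / real n < e"
      by (rule average_upper[OF fd f])
  next
    fix e assume "e < (\<integral>x. f x \<partial>har)"
    moreover have "continuous_map (closure_topology v S) euclideanreal (\<lambda>x. - f x)"
      using f(1) by (rule continuous_map_minus)
    moreover have "bounded ((\<lambda>x. - f x) ` cl)" using f(2) by (simp add: bounded_iff)
    ultimately have "\<forall>\<^sub>F n in sequentially. (\<Sum>j<n. - f (s j)) / real n < - e"
      by (intro average_upper[OF fd]) auto
    then show "\<forall>\<^sub>F n in sequentially. e < (\<Sum>j<n. f (s j)) / real n"
      by eventually_elim (simp add: sum_negf)
  qed
qed

subsection \<open>The potential of the harmonic measure\<close>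

text \<open>The index is \<open>Suc h\<close> because all points agree at level 0. As a countable
  sum of indicators of cylinders the valuation is measurable in \<open>y\<close> and can be
  integrated term by term; on the diagonal both sides are infinite.\<close>

lemma val_eq_suminf:
  assumes "x \<in> cl" "y \<in> cl"
  shows "e2ennreal (v (x - y)) = (\<Sum>h. indicator (cyl (tv (Suc h) x)) y)"
proof -
  have ind: "indicator (cyl (tv (Suc h) x)) y = (if ereal (real (Suc h)) \<le> v (x - y) then 1 else 0::ennreal)" for h
    using assms(2) by (simp add: indicator_def mem_cyl_tv tree_vertex_eq_iff val_diff_commute)
  show ?thesis
  proof (cases "x = y")
    case True
    have "(\<Sum>h::nat. 1::ennreal) = top"
      using summable_suminf_not_top[of "\<lambda>_. 1"] summable_const_iff[of "1::real"] by auto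
    then show ?thesis unfolding ind using True by (simp add: val_zero)
  next
    case False
    then obtain n where n: "v (x - y) = ereal (real n)"
      using val_diff_nat assms closure_subset by (metis subsetD)
    have "(\<Sum>h. indicator (cyl (tv (Suc h) x)) y) = (\<Sum>h<n. indicator (cyl (tv (Suc h) x)) y :: ennreal)"
      unfolding ind n by (intro suminf_finite) auto
    also have "\<dots> = of_nat n" unfolding ind n by simp
    finally show ?thesis by (simp add: n ennreal_of_nat_eq_real_of_nat)
  qed
qed

text \<open>By \<open>nn_integral_val\<close> this is the potential of the harmonic measure for the
  kernel \<open>v (x - y)\<close>. The root is left out, as level 0 does not count in the
  valuation.\<close>

definition potential :: "'a \<Rightarrow> ennreal" where
  "potential x = (\<Sum>h. ennreal (current (tv (Suc h) x)))"

lemma val_measurable: "x \<in> cl \<Longrightarrow> (\<lambda>y. e2ennreal (v (x - y))) \<in> borel_measurable har"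
proof -
  assume x: "x \<in> cl"
  have "(\<lambda>y. \<Sum>h. indicator (cyl (tv (Suc h) x)) y :: ennreal) \<in> borel_measurable har"
    by measurable
  then show ?thesis
    by (rule measurable_cong[THEN iffD1, rotated]) (simp add: val_eq_suminf[OF x] space_har)
qed

lemma nn_integral_val:
  assumes x: "x \<in> cl"
  shows "(\<integral>\<^sup>+y. e2ennreal (v (x - y)) \<partial>har) = potential x"
proof -
  have "(\<integral>\<^sup>+y. e2ennreal (v (x - y)) \<partial>har) = (\<integral>\<^sup>+y. (\<Sum>h. indicator (cyl (tv (Suc h) x)) y) \<partial>har)"
    by (intro nn_integral_cong) (simp add: val_eq_suminf[OF x] space_har)
  also have "\<dots> = (\<Sum>h. emeasure har (cyl (tv (Suc h) x)))"
    by (subst nn_integral_suminf) (auto simp: cyl_sets_har)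
  also have "\<dots> = potential x"
    unfolding potential_def using x mem_closure_iff emeasure_cyl by (intro suminf_cong) blast
  finally show ?thesis .
qed

text \<open>\<open>sum_current\<close> is about points of \<open>S\<close>; a point of
  \<open>S\<close> that shares the first \<open>n\<close> levels with \<open>x\<close> takes its
  place.\<close>

lemma sum_current_closure:
  assumes "x \<in> cl"
  shows "(\<Sum>h<n. current (tv (Suc h) x)) \<le> 1 / k0 - 1"
proof -
  obtain y where y: "y \<in> S" "tv n x = tv n y"
    using assms unfolding mem_closure_iff level_def by blast
  have "(\<Sum>h<n. current (tv (Suc h) x)) = (\<Sum>h<n. current (tv (Suc h) y))"
    using tree_vertex_mono[OF y(2)] by (intro sum.cong refl) (metis lessThan_iff Suc_leI)
  also have "\<dots> = (\<Sum>h\<le>n. current (tv h y)) - 1"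
    by (simp add: sum.atMost_shift tv_root[OF y(1)] current_root[OF k0])
  also have "\<dots> \<le> 1 / k0 - 1"
    unfolding sum_current[OF y(1) k0] using voltage_nonneg[OF tv_in_level[OF y(1)]] by simp
  finally show ?thesis .
qed

lemma potential_le:
  assumes "x \<in> cl"
  shows "potential x \<le> ennreal (1 / k0 - 1)"
  unfolding potential_def
proof (rule suminf_le_const)
  fix n
  have "(\<Sum>h<n. ennreal (current (tv (Suc h) x))) = ennreal (\<Sum>h<n. current (tv (Suc h) x))"
    using assms mem_closure_iff current_nonneg by (intro sum_ennreal) blast
  also have "\<dots> \<le> ennreal (1 / k0 - 1)" using sum_current_closure[OF assms] by (rule ennreal_leI)
  finally show "(\<Sum>h<n. ennreal (current (tv (Suc h) x))) \<le> ennreal (1 / k0 - 1)" .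
qed simp

lemma current_tv_measurable: "(\<lambda>x. ennreal (current (tv h x))) \<in> borel_measurable har"
  using borel_measurable_integrable[OF integral_level(2)[of current h]] by measurable

lemma potential_measurable: "potential \<in> borel_measurable har"
  unfolding potential_def[abs_def] using current_tv_measurable by measurable

text \<open>A vertex has mass equal to its current, so the mean of \<open>current\<close> at a level
  is the sum of squares there; the total is the energy of the current without the imagined
  edge.\<close>

lemma nn_integral_potential: "(\<integral>\<^sup>+x. potential x \<partial>har) = ennreal (1 / k0 - 1)"
proof -
  have level: "(\<integral>\<^sup>+x. ennreal (current (tv h x)) \<partial>har) = ennreal (\<Sum>b\<in>level h. (current b)\<^sup>2)" for h
  proof -
    have "(\<integral>\<^sup>+x. ennreal (current (tv h x)) \<partial>har) = ennreal (\<integral>x. current (tv h x) \<partial>har)"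
    proof (rule nn_integral_eq_integral[OF integral_level(2)])
      show "AE x in har. 0 \<le> current (tv h x)"
        using mem_closure_iff current_nonneg by (intro AE_I2) (metis space_har)
    qed
    then show ?thesis by (simp add: integral_level(1) power2_eq_square)
  qed
  have "(\<integral>\<^sup>+x. potential x \<partial>har) = (\<Sum>h. \<integral>\<^sup>+x. ennreal (current (tv (Suc h) x)) \<partial>har)"
    unfolding potential_def using current_tv_measurable by (intro nn_integral_suminf)
  also have "\<dots> = (\<Sum>h. ennreal (\<Sum>b\<in>level (Suc h). (current b)\<^sup>2))"
    unfolding level ..
  also have "\<dots> = ennreal (1 / k0 - 1)"
  proof (rule sums_unique[symmetric])
    have "(\<Sum>h<n. ennreal (\<Sum>b\<in>level (Suc h). (current b)\<^sup>2)) = ennreal (energy_upto n current - 1)" for n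
    proof -
      have "(\<Sum>h<n. ennreal (\<Sum>b\<in>level (Suc h). (current b)\<^sup>2)) = ennreal (\<Sum>h<n. \<Sum>b\<in>level (Suc h). (current b)\<^sup>2)"
        by (rule sum_ennreal) (simp add: sum_nonneg)
      then show ?thesis by (simp add: energy_upto_def sum.atMost_shift level_0 current_root[OF k0])
    qed
    then show "(\<lambda>h. ennreal (\<Sum>b\<in>level (Suc h). (current b)\<^sup>2)) sums ennreal (1 / k0 - 1)"
      unfolding sums_def
      by (simp only:) (intro tendsto_ennrealI tendsto_diff tendsto_const energy_upto_current_LIMSEQ k0)
  qed
  finally show ?thesis .
qed

lemma AE_potential: "AE x in har. potential x = ennreal (1 / k0 - 1)"
proof -
  let ?H = "ennreal (1 / k0 - 1)"
  have "(\<integral>\<^sup>+x. ?H - potential x \<partial>har) = (\<integral>\<^sup>+x. ?H \<partial>har) - (\<integral>\<^sup>+x. potential x \<partial>har)"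
    using potential_measurable potential_le
    by (intro nn_integral_diff) (auto simp: nn_integral_potential space_har intro!: AE_I2)
  also have "\<dots> = 0" by (simp add: nn_integral_potential har.emeasure_space_1)
  finally have "AE x in har. ?H - potential x = 0"
    using potential_measurable by (subst (asm) nn_integral_0_iff_AE) auto
  then show ?thesis
    using AE_space
  proof eventually_elim
    case (elim x)
    then have "?H \<le> potential x" by (simp add: diff_eq_0_iff_ennreal)
    then show ?case using potential_le[of x] elim(2) by (simp add: space_har antisym)
  qed
qed

text \<open>Tonelli reduces the double integral to the mean of \<open>potential\<close>. Removing
  the diagonal costs nothing, since finite potentials rule out atoms.\<close>

lemma nn_integral_val_pairs:
  "(\<integral>\<^sup>+p\<in>{(x, y) \<in> cl \<times> cl. x \<noteq> y}. e2ennreal (v (fst p - snd p)) \<partial>(har \<Otimes>\<^sub>M har)) = ennreal (1 / k0 - 1)"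
proof -
  define D where "D h = (\<Union>b\<in>level h. cyl b \<times> cyl b)" for h
  have memD: "(x, y) \<in> D h \<longleftrightarrow> x \<in> cl \<and> y \<in> cl \<and> tv h x = tv h y" for x y h
  proof
    assume "(x, y) \<in> D h"
    then show "x \<in> cl \<and> y \<in> cl \<and> tv h x = tv h y"
      unfolding D_def using level_fst by (auto simp: cyl_def)
  next
    assume "x \<in> cl \<and> y \<in> cl \<and> tv h x = tv h y"
    then show "(x, y) \<in> D h"
      unfolding D_def using mem_closure_iff by (intro UN_I[of "tv h x"]) (auto simp: mem_cyl_tv)
  qed
  have D_sets [measurable]: "D h \<in> sets (har \<Otimes>\<^sub>M har)" for h
    unfolding D_def using finite_level by (intro sets.finite_UN) (auto simp: cyl_sets_har)
  \<comment> \<open>Agrees with the valuation of the difference on the closure and is measurable for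
    the product, being a sum of indicators of the sets \<open>D\<close>.\<close>
  define F where "F p = (\<Sum>h. indicator (D (Suc h)) p :: ennreal)" for p
  define A where "A = {(x, y) \<in> cl \<times> cl. x \<noteq> y}"
  have F_eq: "F (x, y) = e2ennreal (v (x - y))" if "x \<in> cl" "y \<in> cl" for x y
    unfolding F_def val_eq_suminf[OF that] using that
    by (intro suminf_cong) (auto simp: indicator_def memD mem_cyl_tv)
  \<comment> \<open>The diagonal is the intersection of all \<open>D h\<close>, which makes
    \<open>A\<close> measurable.\<close>
  have A_eq: "A = space (har \<Otimes>\<^sub>M har) - (\<Inter>h. D h)"
  proof -
    have sep: "x = y" if xy: "\<forall>h. tv h x = tv h y" "x \<in> cl" "y \<in> cl" for x y
    proof (rule ccontr)
      assume "x \<noteq> y"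
      then obtain n where "v (x - y) = ereal (real n)"
        using val_diff_nat[of x y] xy(2,3) closure_subset by blast
      then show False using xy(1)[rule_format, of "Suc n"] by (simp add: tree_vertex_eq_iff)
    qed
    show ?thesis
    proof (rule set_eqI)
      fix p :: "'a \<times> 'a"
      obtain x y where p: "p = (x, y)" by (rule prod.exhaust)
      have "p \<in> (\<Inter>h. D h) \<longleftrightarrow> x \<in> cl \<and> y \<in> cl \<and> (\<forall>h. tv h x = tv h y)"
        unfolding p by (simp add: memD)
      then show "p \<in> A \<longleftrightarrow> p \<in> space (har \<Otimes>\<^sub>M har) - (\<Inter>h. D h)"
        using sep[of x y] by (auto simp: p A_def space_pair_measure space_har)
    qed
  qed
  have A_sets [measurable]: "A \<in> sets (har \<Otimes>\<^sub>M har)"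
    unfolding A_eq by measurable
  have F_meas [measurable]: "F \<in> borel_measurable (har \<Otimes>\<^sub>M har)"
    unfolding F_def[abs_def] by measurable
  have "(\<integral>\<^sup>+p\<in>A. e2ennreal (v (fst p - snd p)) \<partial>(har \<Otimes>\<^sub>M har)) = (\<integral>\<^sup>+p. F p * indicator A p \<partial>(har \<Otimes>\<^sub>M har))"
    by (intro nn_integral_cong) (auto simp: space_pair_measure space_har F_eq)
  also have "\<dots> = (\<integral>\<^sup>+x. \<integral>\<^sup>+y. F (x, y) * indicator A (x, y) \<partial>har \<partial>har)"
    by (rule har.nn_integral_fst[symmetric]) measurable
  also have "\<dots> = (\<integral>\<^sup>+x. potential x \<partial>har)"
  proof (rule nn_integral_cong)
    fix x assume "x \<in> space har"
    then have x: "x \<in> cl" by (simp add: space_har)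
    \<comment> \<open>The integrand is infinite at \<open>y = x\<close> while the integral is
      finite, so \<open>x\<close> is not an atom.\<close>
    have "AE y in har. e2ennreal (v (x - y)) \<noteq> \<infinity>"
      using val_measurable[OF x] potential_le[OF x]
      by (intro nn_integral_noteq_infinite) (auto simp: nn_integral_val[OF x] top_unique)
    then have "AE y in har. F (x, y) * indicator A (x, y) = e2ennreal (v (x - y))"
      using AE_space
    proof eventually_elim
      case (elim y)
      then have "y \<in> cl" "x \<noteq> y" by (auto simp: space_har val_zero)
      then show ?case using x by (simp add: F_eq A_def)
    qed
    then have "(\<integral>\<^sup>+y. F (x, y) * indicator A (x, y) \<partial>har) = (\<integral>\<^sup>+y. e2ennreal (v (x - y)) \<partial>har)"
      by (rule nn_integral_cong_AE)
    then show "(\<integral>\<^sup>+y. F (x, y) * indicator A (x, y) \<partial>har) = potential x"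
      by (simp add: nn_integral_val[OF x])
  qed
  finally show ?thesis unfolding A_def nn_integral_potential .
qed

lemma AE_nn_integral_val:
  "AE x in har. (\<integral>\<^sup>+y\<in>cl. e2ennreal (v (x - y)) \<partial>har) = ennreal (1 / k0 - 1)"
  using AE_potential AE_space
proof eventually_elim
  case (elim x)
  have "(\<integral>\<^sup>+y\<in>cl. e2ennreal (v (x - y)) \<partial>har) = (\<integral>\<^sup>+y. e2ennreal (v (x - y)) \<partial>har)"
    by (intro nn_integral_cong) (simp add: space_har)
  then show ?case using elim by (simp add: nn_integral_val space_har)
qed

end

section \<open>Return to \<open>log_factorial\<close> and \<open>H_lim\<close>\<close>

lemma log_factorial_eq:
  obtains s where "factorial_determining v S s" "\<And>n. log_factorial v S n = ereal (real (fact_exp s n))"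
proof -
  define s where "s = (SOME s. factorial_determining v S s)"
  have fd: "factorial_determining v S s"
    unfolding s_def using exists_factorial_determining by (rule someI_ex)
  have "log_factorial v S n = ereal (real (fact_exp s n))" for n
    using val_fact_exp[OF fd] by (simp add: log_factorial_def s_def[symmetric])
  with fd show ?thesis by (rule that)
qed

lemma log_factorial_LIMSEQ_iff:
  assumes "\<And>n. log_factorial v S n = ereal (a n)"
  shows "(\<lambda>n. log_factorial v S n / ereal (real n)) \<longlonglongrightarrow> ereal H \<longleftrightarrow> (\<lambda>n. a n / real n) \<longlonglongrightarrow> H"
proof -
  \<comment> \<open>\<open>n = 0\<close> is avoided because division by zero differs between
    \<open>ereal\<close> and \<open>real\<close>.\<close>
  have "\<forall>\<^sub>F n in sequentially. log_factorial v S n / ereal (real n) = ereal (a n / real n)"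
    using eventually_gt_at_top[of 0] by eventually_elim (simp add: assms)
  then have "(\<lambda>n. log_factorial v S n / ereal (real n)) \<longlonglongrightarrow> ereal H \<longleftrightarrow> (\<lambda>n. ereal (a n / real n)) \<longlonglongrightarrow> ereal H"
    by (rule tendsto_cong)
  then show ?thesis by simp
qed

text \<open>Forward, \<open>1 / k0 - 1\<close> is positive because \<open>k0 < 1\<close>. Backward,
  a convergent quotient is bounded, and a linear bound on the factorials already forces
  \<open>0 < k0\<close>.\<close>

lemma transient_iff_LIMSEQ:
  "transient v S \<longleftrightarrow> (\<exists>H::real. 0 < H \<and> (\<lambda>n. log_factorial v S n / ereal (real n)) \<longlonglongrightarrow> ereal H)"
  and H_lim_eq: "transient v S \<Longrightarrow> H_lim v S = ereal (1 / k0 - 1)"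
proof -
  obtain s where fd: "factorial_determining v S s"
    and a: "\<And>n. log_factorial v S n = ereal (real (fact_exp s n))"
    using log_factorial_eq by blast
  note iff = log_factorial_LIMSEQ_iff[of "\<lambda>n. real (fact_exp s n)", OF a]
  have lim: "(\<lambda>n. log_factorial v S n / ereal (real n)) \<longlonglongrightarrow> ereal (1 / k0 - 1)" if "0 < k0"
    unfolding iff using fact_exp_LIMSEQ[OF fd that] .
  show "transient v S \<longleftrightarrow> (\<exists>H::real. 0 < H \<and> (\<lambda>n. log_factorial v S n / ereal (real n)) \<longlonglongrightarrow> ereal H)"
  proof
    assume "transient v S"
    then have k0: "0 < k0" by (simp add: transient_iff)
    then have "0 < 1 / k0 - 1" using k0_less_1 by (simp add: field_simps)
    with lim[OF k0] show "\<exists>H::real. 0 < H \<and> (\<lambda>n. log_factorial v S n / ereal (real n)) \<longlonglongrightarrow> ereal H" by blast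
  next
    assume "\<exists>H::real. 0 < H \<and> (\<lambda>n. log_factorial v S n / ereal (real n)) \<longlonglongrightarrow> ereal H"
    then obtain H where "(\<lambda>n. real (fact_exp s n) / real n) \<longlonglongrightarrow> H" unfolding iff by blast
    then have "Bseq (\<lambda>n. real (fact_exp s n) / real n)" by (intro convergent_imp_Bseq convergentI)
    then obtain C where C: "0 < C" "\<And>n. real (fact_exp s n) / real n \<le> C" unfolding Bseq_def by auto
    \<comment> \<open>At \<open>n = 0\<close> the quotient carries no information, but the empty sum
      gives \<open>fact_exp s 0 = 0\<close>.\<close>
    have "real (fact_exp s n) \<le> C * real n" for n
      using C(2)[of n] fd by (cases "n = 0") (simp_all add: fact_exp_def divide_le_eq)
    then show "transient v S"
      unfolding transient_iff using C(1) by (intro cond_pos_if_fact_exp_linear[OF fd]) auto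
  qed
  show "H_lim v S = ereal (1 / k0 - 1)" if "transient v S"
    unfolding H_lim_def using lim that unfolding transient_iff by (intro limI)
qed

end

theorem theorem1p8:
  fixes v :: "'a::field \<Rightarrow> ereal" and S :: "'a set"
  assumes "nonarch_local_field v"
    and "S \<subseteq> val_ring v" and "infinite S"
  shows "(transient v S \<longleftrightarrow>
           (\<exists>H::real. 0 < H \<and> (\<lambda>n. log_factorial v S n / ereal (real n)) \<longlonglongrightarrow> ereal H))
       \<and> (transient v S \<longrightarrow>
           (\<forall>s. factorial_determining v S s \<longrightarrow> equidistributed v S s (harmonic_measure v S))
         \<and> H_lim v S = enn2ereal
             (\<integral>\<^sup>+p\<in>{(x, y) \<in> ring_closure v S \<times> ring_closure v S. x \<noteq> y}. e2ennreal (v (fst p - snd p))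
                \<partial>(harmonic_measure v S \<Otimes>\<^sub>M harmonic_measure v S))
         \<and> (AE x0 in harmonic_measure v S.
              H_lim v S = enn2ereal
                (\<integral>\<^sup>+y\<in>ring_closure v S. e2ennreal (v (x0 - y)) \<partial>harmonic_measure v S)))"
proof -
  interpret nonarch_local_field v by fact
  interpret adelic_tree v S
    using assms(2,3) by unfold_locales
  show ?thesis
  proof (intro conjI impI)
    assume tr: "transient v S"
    then have k0: "0 < k0" by (simp add: transient_iff)
    \<comment> \<open>\<open>1 / k0 - 1\<close> is nonnegative, so the passage through
      \<open>ennreal\<close> loses nothing.\<close>
    have H: "H_lim v S = enn2ereal (ennreal (1 / k0 - 1))"
      using H_lim_eq[OF tr] k0 k0_le_1 by (simp add: enn2ereal_ennreal field_simps)
    show "\<forall>s. factorial_determining v S s \<longrightarrow> equidistributed v S s (harmonic_measure v S)"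
      using equidistributed_har[OF k0] by blast
    show "H_lim v S = enn2ereal
        (\<integral>\<^sup>+p\<in>{(x, y) \<in> cl \<times> cl. x \<noteq> y}. e2ennreal (v (fst p - snd p)) \<partial>(har \<Otimes>\<^sub>M har))"
      unfolding nn_integral_val_pairs[OF k0] by (rule H)
    show "AE x0 in har. H_lim v S = enn2ereal (\<integral>\<^sup>+y\<in>cl. e2ennreal (v (x0 - y)) \<partial>har)"
      using AE_nn_integral_val[OF k0] by eventually_elim (simp add: H)
  qed (rule transient_iff_LIMSEQ)
qed

end
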